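(* Let $\mathcal{A}\subset\mathbb{P}^2$ be any line arrangement, $d=|\mathcal{A}|$. Write the graded minimal free resolution of $\mathrm{Jac}(f_{\mathcal{A}})^{sat}$ as $$0\to G\to S^b(-d+1)\oplus F\to \mathrm{Jac}(f_{\mathcal{A}})^{sat}\to 0,$$ where $F$ and $G$ are graded free $S$-modules and $F$ has no direct summand isomorphic to $S(-d+1)$. If $\mathcal{A}$ is not free, then $b\ge 3$, and the Milnor module $M=\mathrm{Jac}(f_{\mathcal{A}})^{sat}/\mathrm{Jac}(f_{\mathcal{A}})$ and the Jacobian ideal $\mathrm{Jac}(f_{\mathcal{A}})$ have graded minimal free resolutions of the form $$0\to S^{b-3}(-2d+2)\oplus F^*(-3d+3)\to G^*(-3d+3)\to G\to S^{b-3}(-d+1)\oplus F\to M\to 0$$ and $$0\to S^{b-3}(-2d+2)\oplus F^*(-3d+3)\to G^*(-3d+3)\to S^3(-d+1)\to\mathrm{Jac}(f_{\mathcal{A}})\to 0.$$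
   Context: $K$ is a field of characteristic zero, $S=K[x_0,x_1,x_2]$ with the standard grading. A line arrangement $\mathcal{A}\subset\mathbb{P}^2$ is a finite set of distinct lines, defined by the product $f_{\mathcal{A}}$ of the corresponding linear forms. $\mathrm{Jac}(f_{\mathcal{A}})$ is the ideal generated by the first partial derivatives of $f_{\mathcal{A}}$, and $\mathrm{Jac}(f_{\mathcal{A}})^{sat}$ is its saturation with respect to the homogeneous maximal ideal. $\mathcal{A}$ is free if $\mathrm{Jac}(f_{\mathcal{A}})=\mathrm{Jac}(f_{\mathcal{A}})^{sat}$. For a graded $S$-module $N$, $N^*=\mathrm{Hom}_S(N,S)$. *)

theory Defs
  imports
    "HOL-Library.Poly_Mapping"
    "HOL-Analysis.Finite_Cartesian_Product"
    "HOL-Algebra.Algebra"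
    "HOL-Algebra.Algebraic_Closure_Type"
begin

section \<open>The polynomial ring $S = K[x_0,x_1,x_2]$\<close>

text \<open>Monomials are exponent vectors indexed by the three-element type \<open>3\<close>, with elements
  \<open>0, 1, 2\<close>.\<close>

type_synonym 'k poly3 = "(3 \<Rightarrow>\<^sub>0 nat) \<Rightarrow>\<^sub>0 'k"

definition var :: "3 \<Rightarrow> 'k::field poly3" where
  "var i = Poly_Mapping.single (Poly_Mapping.single i 1) 1"

definition mon_degree :: "(3 \<Rightarrow>\<^sub>0 nat) \<Rightarrow> nat" where
  "mon_degree m = (\<Sum>i\<in>UNIV. Poly_Mapping.lookup m i)"

text \<open>The graded piece $S_n$; it is zero for negative \<open>n\<close>.\<close>

definition homog :: "int \<Rightarrow> 'k::field poly3 set" where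
  "homog n = {p. \<forall>m\<in>Poly_Mapping.keys p. int (mon_degree m) = n}"

definition poly_eval :: "'k::field poly3 \<Rightarrow> 'k ^ 3 \<Rightarrow> 'k" where
  "poly_eval p v =
     (\<Sum>m\<in>Poly_Mapping.keys p.
        Poly_Mapping.lookup p m * (\<Prod>i\<in>UNIV. (v $ i) ^ Poly_Mapping.lookup m i))"

definition partial_deriv :: "3 \<Rightarrow> 'k::field poly3 \<Rightarrow> 'k poly3" where
  "partial_deriv i p =
     (\<Sum>m\<in>Poly_Mapping.keys p.
        Poly_Mapping.single (m - Poly_Mapping.single i 1)
          (of_nat (Poly_Mapping.lookup m i) * Poly_Mapping.lookup p m))"

abbreviation S_ring :: "'k::field poly3 ring" where
  "S_ring \<equiv> ring_of_type_algebra"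

definition irrelevant_ideal :: "'k::field poly3 set" where
  "irrelevant_ideal = Idl\<^bsub>S_ring\<^esub> (range var)"

primrec ideal_power :: "'k::field poly3 set \<Rightarrow> nat \<Rightarrow> 'k poly3 set" where
  "ideal_power I 0 = UNIV"
| "ideal_power I (Suc n) = I \<cdot>\<^bsub>S_ring\<^esub> ideal_power I n"

text \<open>$I^{sat} = \bigcup_k (I : \mathfrak{m}^k)$.\<close>

definition saturation :: "'k::field poly3 set \<Rightarrow> 'k poly3 set" where
  "saturation I = {g. \<exists>k. \<forall>h\<in>ideal_power irrelevant_ideal k. h * g \<in> I}"

definition Jac :: "'k::field poly3 \<Rightarrow> 'k poly3 set" where
  "Jac f = Idl\<^bsub>S_ring\<^esub> (range (\<lambda>i. partial_deriv i f))"

section \<open>Line arrangements in the projective plane\<close>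

text \<open>A point of $\mathbb{P}^2$ is the class of a nonzero vector of $K^3$ modulo nonzero scalars;
  a line is the zero locus of a nonzero linear form.\<close>

type_synonym 'k point = "('k ^ 3) set"
type_synonym 'k line = "'k point set"

definition proj_point :: "'k::field ^ 3 \<Rightarrow> 'k point" where
  "proj_point v = {c *s v | c. c \<noteq> 0}"

definition zero_locus :: "'k::field poly3 \<Rightarrow> 'k point set" where
  "zero_locus p = {proj_point v | v. v \<noteq> 0 \<and> poly_eval p v = 0}"

definition linear_form :: "'k::field poly3 \<Rightarrow> bool" where
  "linear_form l \<longleftrightarrow> l \<noteq> 0 \<and> l \<in> homog 1"

definition line_arrangement :: "'k::field line set \<Rightarrow> bool" where
  "line_arrangement A \<longleftrightarrow> finite A \<and> (\<forall>L\<in>A. \<exists>l. linear_form l \<and> L = zero_locus l)"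

text \<open>The polynomial $f_{\mathcal{A}}$ depends on the choice of a linear form for each line, so it is
  determined by the arrangement up to a nonzero scalar. This does not affect its Jacobian ideal, and
  in \<open>free_arrangement\<close> it makes no difference whether \<open>f\<close> is quantified existentially or
  universally.\<close>

definition defining_polynomial :: "'k::field line set \<Rightarrow> 'k poly3 \<Rightarrow> bool" where
  "defining_polynomial A f \<longleftrightarrow>
     (\<exists>l. (\<forall>L\<in>A. linear_form (l L) \<and> L = zero_locus (l L)) \<and> f = (\<Prod>L\<in>A. l L))"

definition free_arrangement :: "'k::field line set \<Rightarrow> bool" where
  "free_arrangement A \<longleftrightarrow> (\<exists>f. defining_polynomial A f \<and> Jac f = saturation (Jac f))"

section \<open>Graded modules\<close>

text \<open>A graded \<open>S\<close>-module is a module together with its homogeneous components \<open>hcomp N n\<close>. The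
  record of modules extends that of rings; the fields \<open>mult\<close> and \<open>one\<close> play no role.\<close>

record ('a, 'm) gmodule = "('a, 'm) module" +
  hcomp :: "int \<Rightarrow> 'm set"

definition graded_module :: "('k::field poly3, 'm) gmodule \<Rightarrow> bool" where
  "graded_module N \<longleftrightarrow>
     module S_ring N \<and>
     (\<forall>n. additive_subgroup (hcomp N n) N) \<and>
     (\<forall>i j. \<forall>p\<in>homog i. \<forall>x\<in>hcomp N j. p \<odot>\<^bsub>N\<^esub> x \<in> hcomp N (i + j)) \<and>
     (\<forall>x\<in>carrier N. \<exists>!y. (\<forall>n. y n \<in> hcomp N n) \<and> finite {n. y n \<noteq> \<zero>\<^bsub>N\<^esub>} \<and>
        x = finsum N y {n. y n \<noteq> \<zero>\<^bsub>N\<^esub>})"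

definition S_linear ::
  "('k::field poly3, 'm, 'x) module_scheme \<Rightarrow> ('k poly3, 'n, 'y) module_scheme \<Rightarrow> ('m \<Rightarrow> 'n) set"
where
  "S_linear N P = {h \<in> carrier N \<rightarrow> carrier P.
     (\<forall>x\<in>carrier N. \<forall>y\<in>carrier N. h (x \<oplus>\<^bsub>N\<^esub> y) = h x \<oplus>\<^bsub>P\<^esub> h y) \<and>
     (\<forall>p. \<forall>x\<in>carrier N. h (p \<odot>\<^bsub>N\<^esub> x) = p \<odot>\<^bsub>P\<^esub> h x)}"

text \<open>Graded homomorphisms are homogeneous of degree \<open>0\<close>.\<close>

definition graded_hom ::
  "('k::field poly3, 'm) gmodule \<Rightarrow> ('k poly3, 'n) gmodule \<Rightarrow> ('m \<Rightarrow> 'n) set" where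
  "graded_hom N P = {h \<in> S_linear N P. \<forall>n. h ` hcomp N n \<subseteq> hcomp P n}"

text \<open>The inverse of a bijective graded homomorphism of graded modules is again graded.\<close>

definition graded_iso ::
  "('k::field poly3, 'm) gmodule \<Rightarrow> ('k poly3, 'n) gmodule \<Rightarrow> bool" where
  "graded_iso N P \<longleftrightarrow> (\<exists>h\<in>graded_hom N P. bij_betw h (carrier N) (carrier P))"

definition ideal_gmodule :: "'k::field poly3 set \<Rightarrow> ('k poly3, 'k poly3) gmodule" where
  "ideal_gmodule I =
     \<lparr>carrier = I, monoid.mult = (*), one = 1, ring.zero = 0, add = (+), module.smult = (*),
      hcomp = (\<lambda>n. I \<inter> homog n)\<rparr>"

definition S_mod :: "('k::field poly3, 'k poly3) gmodule" where
  "S_mod = ideal_gmodule UNIV"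

text \<open>The twist $N(a)$, with $N(a)_n = N_{n+a}$.\<close>

definition twist :: "('a, 'm) gmodule \<Rightarrow> int \<Rightarrow> ('a, 'm) gmodule" where
  "twist N a = N\<lparr>hcomp := (\<lambda>n. hcomp N (n + a))\<rparr>"

definition gsum ::
  "('a, 'm) gmodule \<Rightarrow> ('a, 'n) gmodule \<Rightarrow> ('a, 'm \<times> 'n) gmodule"
    (infixr \<open>\<oplus>\<^sub>g\<close> 65) where
  "N \<oplus>\<^sub>g P =
     \<lparr>carrier = carrier N \<times> carrier P,
      monoid.mult = undefined, one = undefined,
      ring.zero = (\<zero>\<^bsub>N\<^esub>, \<zero>\<^bsub>P\<^esub>),
      add = (\<lambda>u v. (fst u \<oplus>\<^bsub>N\<^esub> fst v, snd u \<oplus>\<^bsub>P\<^esub> snd v)),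
      module.smult = (\<lambda>p u. (p \<odot>\<^bsub>N\<^esub> fst u, p \<odot>\<^bsub>P\<^esub> snd u)),
      hcomp = (\<lambda>n. hcomp N n \<times> hcomp P n)\<rparr>"

definition gdirect_sum :: "nat \<Rightarrow> (nat \<Rightarrow> ('a, 'm) gmodule) \<Rightarrow> ('a, nat \<Rightarrow> 'm) gmodule" where
  "gdirect_sum r N =
     \<lparr>carrier = (\<Pi>\<^sub>E i\<in>{..<r}. carrier (N i)),
      monoid.mult = undefined, one = undefined,
      ring.zero = (\<lambda>i\<in>{..<r}. \<zero>\<^bsub>N i\<^esub>),
      add = (\<lambda>u v. \<lambda>i\<in>{..<r}. u i \<oplus>\<^bsub>N i\<^esub> v i),
      module.smult = (\<lambda>p u. \<lambda>i\<in>{..<r}. p \<odot>\<^bsub>N i\<^esub> u i),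
      hcomp = (\<lambda>n. \<Pi>\<^sub>E i\<in>{..<r}. hcomp (N i) n)\<rparr>"

text \<open>$S^r(a)$\<close>

definition S_pow :: "nat \<Rightarrow> int \<Rightarrow> ('k::field poly3, nat \<Rightarrow> 'k poly3) gmodule" where
  "S_pow r a = gdirect_sum r (\<lambda>_. twist S_mod a)"

text \<open>Graded free modules are taken to be of finite rank, as usual for resolutions of finitely
  generated modules.\<close>

definition graded_free :: "('k::field poly3, 'm) gmodule \<Rightarrow> bool" where
  "graded_free N \<longleftrightarrow>
     graded_module N \<and> (\<exists>r a. graded_iso N (gdirect_sum r (\<lambda>i. twist S_mod (a i))))"

text \<open>It is no restriction that the complement \<open>P\<close> has the same carrier type as \<open>N\<close>, since it can
  be realised as a submodule of \<open>N\<close>.\<close>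

definition has_direct_summand ::
  "('k::field poly3, 'm) gmodule \<Rightarrow> ('k poly3, 'n) gmodule \<Rightarrow> bool" where
  "has_direct_summand N Q \<longleftrightarrow>
     (\<exists>P :: ('k poly3, 'm) gmodule. graded_module P \<and> graded_iso N (Q \<oplus>\<^sub>g P))"

text \<open>$N^* = \mathrm{Hom}_S(N,S)$, whose component of degree \<open>n\<close> consists of the homomorphisms that
  raise degrees by \<open>n\<close>. For finitely generated \<open>N\<close> these components span the whole of
  $\mathrm{Hom}_S(N,S)$. Homomorphisms are made extensional on the carrier of \<open>N\<close>.\<close>

definition dual :: "('k::field poly3, 'm) gmodule \<Rightarrow> ('k poly3, 'm \<Rightarrow> 'k poly3) gmodule" where
  "dual N =
     \<lparr>carrier = S_linear N S_mod \<inter> extensional (carrier N),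
      monoid.mult = undefined, one = undefined,
      ring.zero = (\<lambda>x\<in>carrier N. 0),
      add = (\<lambda>g h. \<lambda>x\<in>carrier N. g x + h x),
      module.smult = (\<lambda>p h. \<lambda>x\<in>carrier N. p * h x),
      hcomp = (\<lambda>n. {h \<in> S_linear N S_mod \<inter> extensional (carrier N).
                      \<forall>j. h ` hcomp N j \<subseteq> homog (j + n)})\<rparr>"

text \<open>The quotient of \<open>N\<close> by a submodule \<open>U\<close>, with cosets as elements.\<close>

definition gquot :: "('a, 'm) gmodule \<Rightarrow> 'm set \<Rightarrow> ('a, 'm set) gmodule" where
  "gquot N U =
     \<lparr>carrier = a_rcosets\<^bsub>N\<^esub> U,
      monoid.mult = undefined, one = undefined,
      ring.zero = U,
      add = (\<lambda>C D. C <+>\<^bsub>N\<^esub> D),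
      module.smult = (\<lambda>p C. \<Union>x\<in>C. U +>\<^bsub>N\<^esub> (p \<odot>\<^bsub>N\<^esub> x)),
      hcomp = (\<lambda>n. (\<lambda>x. U +>\<^bsub>N\<^esub> x) ` hcomp N n)\<rparr>"

definition Milnor_module :: "'k::field poly3 \<Rightarrow> ('k poly3, 'k poly3 set) gmodule" where
  "Milnor_module f = gquot (ideal_gmodule (saturation (Jac f))) (Jac f)"

section \<open>Graded minimal free resolutions\<close>

text \<open>The submodule $\mathfrak{m} N$.\<close>

definition irrelevant_mult :: "('k::field poly3, 'm) gmodule \<Rightarrow> 'm set" where
  "irrelevant_mult N =
     generate (add_monoid N) {p \<odot>\<^bsub>N\<^esub> x | p x. p \<in> irrelevant_ideal \<and> x \<in> carrier N}"

definition exact_at ::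
  "('k::field poly3, 'm) gmodule \<Rightarrow> ('m \<Rightarrow> 'n) \<Rightarrow> ('k poly3, 'n) gmodule \<Rightarrow> ('n \<Rightarrow> 'p)
     \<Rightarrow> ('k poly3, 'p) gmodule \<Rightarrow> bool" where
  "exact_at P g Q h R \<longleftrightarrow> g ` carrier P = a_kernel Q R h"

definition minimal_differential ::
  "('k::field poly3, 'm) gmodule \<Rightarrow> ('m \<Rightarrow> 'n) \<Rightarrow> ('k poly3, 'n) gmodule \<Rightarrow> bool" where
  "minimal_differential P h Q \<longleftrightarrow> h \<in> graded_hom P Q \<and> h ` carrier P \<subseteq> irrelevant_mult Q"

definition augmentation ::
  "('k::field poly3, 'm) gmodule \<Rightarrow> ('m \<Rightarrow> 'n) \<Rightarrow> ('k poly3, 'n) gmodule \<Rightarrow> bool" where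
  "augmentation P h N \<longleftrightarrow> h \<in> graded_hom P N \<and> h ` carrier P = carrier N"

text \<open>\<open>minimal_resolution\<^sub>k\<close> says that $0 \to P_k \to \dots \to P_0 \to N \to 0$ is a graded minimal
  free resolution of \<open>N\<close>. There is one predicate for each length because the carrier types of the
  modules differ.\<close>

definition minimal_resolution\<^sub>1 ::
  "('k::field poly3, 'm1) gmodule \<Rightarrow> ('m1 \<Rightarrow> 'm0) \<Rightarrow> ('k poly3, 'm0) gmodule \<Rightarrow> ('m0 \<Rightarrow> 'n)
     \<Rightarrow> ('k poly3, 'n) gmodule \<Rightarrow> bool" where
  "minimal_resolution\<^sub>1 P1 d1 P0 e N \<longleftrightarrow>
     graded_free P1 \<and> graded_free P0 \<and> graded_module N \<and>
     minimal_differential P1 d1 P0 \<and> augmentation P0 e N \<and>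
     inj_on d1 (carrier P1) \<and> exact_at P1 d1 P0 e N"

definition minimal_resolution\<^sub>2 ::
  "('k::field poly3, 'm2) gmodule \<Rightarrow> ('m2 \<Rightarrow> 'm1) \<Rightarrow> ('k poly3, 'm1) gmodule \<Rightarrow> ('m1 \<Rightarrow> 'm0)
     \<Rightarrow> ('k poly3, 'm0) gmodule \<Rightarrow> ('m0 \<Rightarrow> 'n) \<Rightarrow> ('k poly3, 'n) gmodule \<Rightarrow> bool" where
  "minimal_resolution\<^sub>2 P2 d2 P1 d1 P0 e N \<longleftrightarrow>
     graded_free P2 \<and> graded_free P1 \<and> graded_free P0 \<and> graded_module N \<and>
     minimal_differential P2 d2 P1 \<and> minimal_differential P1 d1 P0 \<and> augmentation P0 e N \<and>
     inj_on d2 (carrier P2) \<and> exact_at P2 d2 P1 d1 P0 \<and> exact_at P1 d1 P0 e N"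

definition minimal_resolution\<^sub>3 ::
  "('k::field poly3, 'm3) gmodule \<Rightarrow> ('m3 \<Rightarrow> 'm2) \<Rightarrow> ('k poly3, 'm2) gmodule \<Rightarrow> ('m2 \<Rightarrow> 'm1)
     \<Rightarrow> ('k poly3, 'm1) gmodule \<Rightarrow> ('m1 \<Rightarrow> 'm0) \<Rightarrow> ('k poly3, 'm0) gmodule \<Rightarrow> ('m0 \<Rightarrow> 'n)
     \<Rightarrow> ('k poly3, 'n) gmodule \<Rightarrow> bool" where
  "minimal_resolution\<^sub>3 P3 d3 P2 d2 P1 d1 P0 e N \<longleftrightarrow>
     graded_free P3 \<and> graded_free P2 \<and> graded_free P1 \<and> graded_free P0 \<and> graded_module N \<and>
     minimal_differential P3 d3 P2 \<and> minimal_differential P2 d2 P1 \<and>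
     minimal_differential P1 d1 P0 \<and> augmentation P0 e N \<and>
     inj_on d3 (carrier P3) \<and> exact_at P3 d3 P2 d2 P1 \<and> exact_at P2 d2 P1 d1 P0 \<and>
     exact_at P1 d1 P0 e N"

end

theory Submission
  imports Defs
begin

text \<open>
  Let \<open>f\<^sub>0, f\<^sub>1, f\<^sub>2\<close> be the partial derivatives of \<open>f\<close> and \<open>E\<close> their module of syzygies. Reducing modulo
  each line shows that a vector parallel to the gradient is a multiple of it, so \<open>e \<times> e' = \<omega>(e, e') \<nabla>f\<close>
  defines an alternating form on \<open>E\<close>, which identifies \<open>E\<close> with \<open>E\<^sup>*\<close> up to a twist. The same reduction
  shows that the saturation of the Jacobian ideal vanishes in degrees below \<open>d - 1\<close>; hence the
  partial derivatives, which are linearly independent if the arrangement is not free, can be taken as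
  three of the \<open>b\<close> generators of degree \<open>d - 1\<close>. Dropping them gives \<open>0 \<rightarrow> E \<rightarrow> G \<rightarrow> P \<rightarrow> M \<rightarrow> 0\<close> with
  \<open>P = S\<^bsup>b-3\<^esup>(-d+1) \<oplus> F\<close>. Since \<open>M\<close> has finite length, dualizing yields \<open>0 \<rightarrow> P\<^sup>* \<rightarrow> G\<^sup>* \<rightarrow> E\<^sup>* \<rightarrow> 0\<close>, which is
  spliced with the former sequence through \<open>E \<cong> E\<^sup>*\<close>. A unit in the matrix of \<open>G\<^sup>* \<rightarrow> G\<close> would be a value
  of \<open>\<omega>\<close>, would make \<open>E\<close> free and the Jacobian ideal saturated.
\<close>

section \<open>Syzygies of three elements\<close>

text \<open>Derived functors never appear. Finite length of M is used only through one exponent k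
  such that every \<open>var i ^ k\<close> multiplies the chosen generators into the Jacobian ideal.
  These powers form a regular sequence, and chases in their Koszul complex stand in for the
  vanishing of Hom(M, S), Ext^1(M, S) and Ext^2(M, S). The constant 3d - 3 is the degree of the
  alternating form: a syzygy of degree m in G has entries of degree m - (d - 1), and dividing a
  cross product by the gradient lowers the degree by another d - 1. F stays intact because it has
  generators only in degrees above d - 1; the partial derivatives are therefore exchanged within the
  summand with b generators, which is where b - 3 comes from. Minimality has two sources. The map
  from G to P is the given minimal matrix with three rows removed, in adapted coordinates, and the
  first map of the resolutions is its transpose. For the map into G and the map into the free module
  of rank 3, a unit entry would force the Jacobian ideal to be saturated.\<close>

lemma UNIV_3: "(UNIV::3 set) = {0, 1, 2}"
proof -
  have "x = 0 \<or> x = 1 \<or> x = 2" for x :: 3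
  proof (induct x)
    case (of_int z)
    then have "z = 0 \<or> z = 1 \<or> z = 2" by simp arith
    then show ?case by auto
  qed
  then show ?thesis by auto
qed

lemma forall3: "(\<forall>i::3. P i) \<longleftrightarrow> P 0 \<and> P 1 \<and> P 2"
proof -
  have "(\<forall>i::3. P i) \<longleftrightarrow> (\<forall>i\<in>UNIV. P i)" by simp
  then show ?thesis unfolding UNIV_3 by simp
qed

lemma sum3: "(\<Sum>i\<in>UNIV. g (i::3)) = g 0 + g 1 + g 2"
  unfolding UNIV_3 by (simp add: ac_simps)

lemma prod3: "(\<Prod>i\<in>UNIV. g (i::3)) = g 0 * g 1 * g 2"
  unfolding UNIV_3 by (simp add: ac_simps)

definition dot :: "(3 \<Rightarrow> 'a) \<Rightarrow> (3 \<Rightarrow> 'a) \<Rightarrow> 'a::comm_ring_1" where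
  "dot v w = v 0 * w 0 + v 1 * w 1 + v 2 * w 2"

definition cross :: "(3 \<Rightarrow> 'a) \<Rightarrow> (3 \<Rightarrow> 'a) \<Rightarrow> 3 \<Rightarrow> 'a::comm_ring_1" where
  "cross v w i = (if i = 0 then v 1 * w 2 - v 2 * w 1
     else if i = 1 then v 2 * w 0 - v 0 * w 2 else v 0 * w 1 - v 1 * w 0)"

definition unit3 :: "3 \<Rightarrow> 3 \<Rightarrow> 'a::comm_ring_1" where
  "unit3 i j = (if i = j then 1 else 0)"

lemma cross_simps:
  "cross v w 0 = v 1 * w 2 - v 2 * w 1"
  "cross v w 1 = v 2 * w 0 - v 0 * w 2"
  "cross v w 2 = v 0 * w 1 - v 1 * w 0"
  by (simp_all add: cross_def)

text \<open>The consequences of regularity that the Koszul chases use. Divisibility is asked for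
  every ordered pair, since the chases divide by \<open>y 0\<close> and also by \<open>y 1\<close>;
  the last clause says that \<open>y 2\<close> is regular modulo \<open>y 0\<close> and
  \<open>y 1\<close>.\<close>

definition regular_triple :: "(3 \<Rightarrow> 'a::idom) \<Rightarrow> bool" where
  "regular_triple y \<longleftrightarrow> (\<forall>i. y i \<noteq> 0) \<and> (\<forall>i j a. i \<noteq> j \<longrightarrow> y i dvd y j * a \<longrightarrow> y i dvd a) \<and>
     (\<forall>a b c. y 2 * a = y 0 * b + y 1 * c \<longrightarrow> (\<exists>u v. a = y 0 * u + y 1 * v))"

text \<open>First exactness of the Koszul complex: regularity lets \<open>y 0\<close> be divided out
  of \<open>b 0\<close>, and cancelling \<open>y 0\<close> shows that the same quotient serves every
  coordinate.\<close>

lemma koszul_exact_1: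
  assumes "regular_triple y" and "\<And>i j. y j * b i = y i * b j"
  shows "\<exists>c. \<forall>i. b i = y i * c"
proof -
  have nz: "y i \<noteq> 0" for i using assms(1) by (auto simp: regular_triple_def)
  have "y 1 * b 0 = y 0 * b 1" using assms(2)[of 1 0] .
  then have "y 0 dvd y 1 * b 0" by simp
  then have "y 0 dvd b 0" using assms(1) unfolding regular_triple_def by (metis zero_neq_one)
  then obtain c where c: "b 0 = y 0 * c" by auto
  have "b i = y i * c" for i
  proof -
    have "y 0 * b i = y 0 * (y i * c)" using assms(2)[of 0 i] c by (simp add: ac_simps)
    then show ?thesis using nz by simp
  qed
  then show ?thesis by blast
qed

text \<open>Relations among the \<open>y i\<close> come from the trivial ones. Regularity of
  \<open>y 2\<close> modulo the other two clears \<open>b 2\<close>; what remains is a relation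
  between \<open>y 0\<close> and \<open>y 1\<close>, a multiple of the obvious one.\<close>

lemma koszul_exact_2:
  assumes y: "regular_triple y" and "dot y b = 0"
  shows "\<exists>u. b = cross y u"
proof -
  have nz: "y i \<noteq> 0" for i using y by (auto simp: regular_triple_def)
  have eq: "y 0 * b 0 + y 1 * b 1 + y 2 * b 2 = 0" using assms(2) by (simp add: dot_def)
  then have "y 2 * b 2 = y 0 * (- b 0) + y 1 * (- b 1)" by (simp add: algebra_simps add_eq_0_iff)
  then obtain p q where b2: "b 2 = y 0 * p + y 1 * q"
    using y unfolding regular_triple_def by blast
  have eq': "y 0 * (b 0 + y 2 * p) = y 1 * (- b 1 - y 2 * q)"
    using eq unfolding b2 by Groebner_Basis.algebra
  then have "y 1 dvd y 0 * (b 0 + y 2 * p)" by simp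
  then have "y 1 dvd b 0 + y 2 * p" using y unfolding regular_triple_def by (metis zero_neq_one)
  then obtain w where w: "b 0 + y 2 * p = y 1 * w" by auto
  have "y 1 * (- b 1 - y 2 * q) = y 1 * (y 0 * w)" using eq' unfolding w by (simp only: ac_simps)
  then have w': "- b 1 - y 2 * q = y 0 * w" using nz mult_left_cancel by blast
  define u where "u = (\<lambda>i::3. if i = 0 then - q else if i = 1 then p else w)"
  have "b 0 = y 1 * w - y 2 * p" using w by Groebner_Basis.algebra
  moreover have "b 1 = y 2 * (- q) - y 0 * w" using w' by Groebner_Basis.algebra
  moreover have "b 2 = y 0 * p - y 1 * (- q)" using b2 by Groebner_Basis.algebra
  ultimately have "\<forall>i. b i = cross y u i"
    unfolding forall3 cross_simps u_def by simp
  then show ?thesis by (intro exI[of _ u]) auto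
qed

text \<open>Read in the cyclic order 12, 20, 01, an alternating family is a vector and the cyclic
  condition is orthogonality to \<open>y\<close>. In this form Cech cocycles become
  coboundaries.\<close>

lemma koszul_cocycle:
  assumes y: "regular_triple y" and anti: "\<And>i j. \<beta> i j = - \<beta> j i" "\<And>i. \<beta> i i = 0"
    and cyc: "y 0 * \<beta> 1 2 + y 1 * \<beta> 2 0 + y 2 * \<beta> 0 1 = 0"
  shows "\<exists>u. \<forall>i j. \<beta> i j = y j * u i - y i * u j"
proof -
  define b where "b = (\<lambda>i. if i = (0::3) then \<beta> 1 2 else if i = 1 then \<beta> 2 0 else \<beta> 0 1)"
  have "dot y b = 0" using cyc by (simp add: dot_def b_def)
  then obtain u where "b = cross y u" using koszul_exact_2[OF y] by blast
  then have "\<forall>i. b i = cross y u i" by auto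
  then have *: "\<beta> 1 2 = y 1 * u 2 - y 2 * u 1" "\<beta> 2 0 = y 2 * u 0 - y 0 * u 2" "\<beta> 0 1 = y 0 * u 1 - y 1 * u 0"
    unfolding forall3 cross_simps b_def by simp_all
  have "\<forall>i j. \<beta> i j = y j * (- u i) - y i * (- u j)"
    unfolding forall3 using * anti(1)[of 2 1] anti(1)[of 0 2] anti(1)[of 1 0] by (simp add: anti(2))
  then show ?thesis by (intro exI[of _ "\<lambda>i. - u i"])
qed

text \<open>\<open>parallel\<close> plays the part of a depth condition: in a factorial domain it
  says that the \<open>f i\<close> have no common factor. It is what makes the alternating form take
  values in the ring itself.\<close>

locale syzygies =
  fixes f :: "3 \<Rightarrow> 'a::idom"
  assumes nonzero: "\<exists>i. f i \<noteq> 0"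
    and parallel: "(\<And>i j. a i * f j = a j * f i) \<Longrightarrow> \<exists>w. \<forall>i. a i = w * f i"
begin

text \<open>Meaningful for syzygies \<open>e\<close> and \<open>x\<close> only: then \<open>e \<times> x\<close> and \<open>f\<close> are both orthogonal to \<open>e\<close> and \<open>x\<close>, hence
  parallel.\<close>

definition om :: "(3 \<Rightarrow> 'a) \<Rightarrow> (3 \<Rightarrow> 'a) \<Rightarrow> 'a" where
  "om e x = (SOME w. \<forall>i. cross e x i = w * f i)"

lemma om:
  assumes "dot e f = 0" "dot x f = 0"
  shows "cross e x i = om e x * f i"
proof -
  have e: "e 0 * f 0 + e 1 * f 1 + e 2 * f 2 = 0" and x: "x 0 * f 0 + x 1 * f 1 + x 2 * f 2 = 0"
    using assms by (simp_all add: dot_def)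
  have "cross e x 0 * f 1 = cross e x 1 * f 0" unfolding cross_simps using e x by Groebner_Basis.algebra
  moreover have "cross e x 0 * f 2 = cross e x 2 * f 0" unfolding cross_simps using e x by Groebner_Basis.algebra
  moreover have "cross e x 1 * f 2 = cross e x 2 * f 1" unfolding cross_simps using e x by Groebner_Basis.algebra
  ultimately have "\<forall>i j. cross e x i * f j = cross e x j * f i" unfolding forall3 by simp
  then have "\<exists>w. \<forall>i. cross e x i = w * f i" using parallel by blast
  then show ?thesis unfolding om_def by (rule someI2_ex) auto
qed

lemma om_eqI:
  assumes "dot e f = 0" "dot x f = 0" "\<And>i. cross e x i = w * f i"
  shows "om e x = w"
  using nonzero om[OF assms(1,2)] assms(3) by force

lemma dot_linear:
  assumes "finite T" "\<And>i. x i = p * x0 i + (\<Sum>t\<in>T. c t * xs t i)"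
  shows "dot x f = p * dot x0 f + (\<Sum>t\<in>T. c t * dot (xs t) f)"
  using assms(1) unfolding dot_def assms(2)
  by (simp add: algebra_simps sum.distrib sum_distrib_left sum_distrib_right)

text \<open>Linearity of the cross product passes to \<open>om\<close> because the factor of
  \<open>f\<close> is unique. The term with \<open>x0\<close> is kept apart from the sum so that
  sums, multiples, differences and expansions in a basis are all instances.\<close>

lemma om_linear:
  assumes T: "finite T" and e: "dot e f = 0" and x0: "dot x0 f = 0" and xs: "\<And>t. t \<in> T \<Longrightarrow> dot (xs t) f = 0"
    and x: "\<And>i. x i = p * x0 i + (\<Sum>t\<in>T. c t * xs t i)"
  shows "om e x = p * om e x0 + (\<Sum>t\<in>T. c t * om e (xs t))"
proof (rule om_eqI[OF e])
  show "dot x f = 0" unfolding dot_linear[OF T x] using x0 xs by simp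
  have "cross e x i = p * cross e x0 i + (\<Sum>t\<in>T. c t * cross e (xs t) i)" for i
    unfolding cross_def x using T
    by (simp add: algebra_simps sum.distrib sum_distrib_left sum_distrib_right sum_subtractf)
  also have "\<dots> i = p * (om e x0 * f i) + (\<Sum>t\<in>T. c t * (om e (xs t) * f i))" for i
    using om[OF e x0] om[OF e xs] by simp
  finally show "cross e x i = (p * om e x0 + (\<Sum>t\<in>T. c t * om e (xs t))) * f i" for i
    by (simp add: algebra_simps sum_distrib_left sum_distrib_right)
qed

lemma om_add:
  assumes "dot e f = 0" "dot x f = 0" "dot x' f = 0"
  shows "om e (\<lambda>i. x i + x' i) = om e x + om e x'"
  using om_linear[of "{()}" e x "\<lambda>_. x'" "\<lambda>i. x i + x' i" 1 "\<lambda>_. 1"] assms by simp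

lemma om_smult:
  assumes "dot e f = 0" "dot x f = 0"
  shows "om e (\<lambda>i. p * x i) = p * om e x"
  using om_linear[of "{}" e x undefined "\<lambda>i. p * x i" p] assms by simp

lemma om_diff:
  assumes "dot e f = 0" "dot x f = 0" "dot x' f = 0"
  shows "om e (\<lambda>i. p * x i - q * x' i) = p * om e x - q * om e x'"
  using om_linear[of "{()}" e x "\<lambda>_. x'" "\<lambda>i. p * x i - q * x' i" p "\<lambda>_. - q"] assms by simp

text \<open>These are the Koszul syzygies. They serve as test vectors: a functional on the syzygies
  turns out to be determined by its values on the three of them.\<close>

lemma dot_koszul: "dot (cross (unit3 i) f) f = 0"
  unfolding dot_def cross_def unit3_def by (simp add: algebra_simps)

text \<open>The syzygies form a module of rank 2, so three of them are dependent.\<close>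

lemma om_plucker:
  assumes "dot e f = 0" "dot e' f = 0" "dot x f = 0"
  shows "om e e' * x i = om x e' * e i + om e x * e' i"
proof -
  have om': "cross u v j = om u v * f j" if "u \<in> {e,e',x}" "v \<in> {e,e',x}" for u v j
    using that assms om by auto
  obtain j where j: "f j \<noteq> 0" using nonzero by auto
  \<comment> \<open>Multiplying by a nonzero \<open>f j\<close> replaces values of \<open>om\<close>
    by entries of cross products and leaves a polynomial identity.\<close>
  have "f j * (om e e' * x i) = f j * (om x e' * e i + om e x * e' i)"
  proof -
    have *: "f j * (om u v * z) = cross u v j * z" if "u \<in> {e,e',x}" "v \<in> {e,e',x}" for u v z
      using om'[OF that, of j] by (simp add: ac_simps)
    have c: "e 0 * f 0 + e 1 * f 1 + e 2 * f 2 = 0" "x 0 * f 0 + x 1 * f 1 + x 2 * f 2 = 0"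
       "e' 0 * f 0 + e' 1 * f 1 + e' 2 * f 2 = 0"
      using assms by (simp_all add: dot_def)
    \<comment> \<open>Three syzygies lie in a module of rank two, so their determinant vanishes; the
      identity below holds modulo this determinant.\<close>
    have "dot (cross e e') x = 0"
    proof -
      have "dot (cross e e') x = om e e' * dot x f"
        unfolding dot_def by (simp add: om' algebra_simps)
      then show ?thesis using assms by simp
    qed
    then have det: "cross e e' 0 * x 0 + cross e e' 1 * x 1 + cross e e' 2 * x 2 = 0"
      by (simp add: dot_def)
    have "\<forall>i j. cross e e' j * x i = cross x e' j * e i + cross e x j * e' i"
      unfolding forall3 cross_simps
      by (intro conjI; ((simp add: algebra_simps; fail) | (use det[unfolded cross_simps] in Groebner_Basis.algebra)))
    then show ?thesis by (simp add: distrib_left *)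
  qed
  then show ?thesis using j by simp
qed

text \<open>Dividing the relation of \<open>om_plucker\<close> by the unit gives the
  coefficients.\<close>

lemma om_unit_spans:
  assumes "dot e f = 0" "dot e' f = 0" "om e e' dvd 1" "dot x f = 0"
  shows "\<exists>p q. \<forall>i. x i = p * e i + q * e' i"
proof -
  obtain w where w: "1 = om e e' * w" using assms(3) by auto
  have "x i = (w * om x e') * e i + (w * om e x) * e' i" for i
  proof -
    have "x i = w * (om e e' * x i)" using w by (metis mult.assoc mult.commute mult.left_neutral)
    also have "\<dots> = w * (om x e' * e i + om e x * e' i)" using om_plucker[OF assms(1,2,4)] by simp
    finally show ?thesis by (simp add: algebra_simps)
  qed
  then show ?thesis by blast
qed

text \<open>The depth statement of the Hilbert-Burch theorem, by a diagram chase in the Koszul complex of \<open>y\<close>.\<close>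

lemma free_syzygies_saturated:
  assumes e: "dot e f = 0" "dot e' f = 0"
    and span: "\<And>x. dot x f = 0 \<Longrightarrow> \<exists>p q. \<forall>i. x i = p * e i + q * e' i"
    and indep: "\<And>p q. (\<And>i. p * e i + q * e' i = 0) \<Longrightarrow> p = 0 \<and> q = 0"
    and y: "regular_triple y" and g: "\<And>i. \<exists>a. y i * g = dot a f"
  shows "\<exists>a. g = dot a f"
proof -
  obtain a where a: "y i * g = dot (a i) f" for i using g by metis
  \<comment> \<open>Two expressions of \<open>y i * y j * g\<close> through \<open>f\<close> differ
    by a syzygy.\<close>
  define b where "b = (\<lambda>i j s. y j * a i s - y i * a j s)"
  have "dot (b i j) f = y j * dot (a i) f - y i * dot (a j) f" for i j
    unfolding b_def dot_def by (simp add: algebra_simps)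
  then have b0: "dot (b i j) f = 0" for i j by (simp flip: a)
  obtain P Q where PQ: "b i j s = P i j * e s + Q i j * e' s" for i j s using span[OF b0] by metis
  have cyc: "y 0 * b 1 2 s + y 1 * b 2 0 s + y 2 * b 0 1 s = 0" for s
    unfolding b_def by Groebner_Basis.algebra
  have "(y 0 * P 1 2 + y 1 * P 2 0 + y 2 * P 0 1) * e s + (y 0 * Q 1 2 + y 1 * Q 2 0 + y 2 * Q 0 1) * e' s = 0" for s
    using cyc[of s] unfolding PQ by Groebner_Basis.algebra
  then have z: "y 0 * P 1 2 + y 1 * P 2 0 + y 2 * P 0 1 = 0" "y 0 * Q 1 2 + y 1 * Q 2 0 + y 2 * Q 0 1 = 0"
    using indep by blast+
  \<comment> \<open>By independence of \<open>e\<close> and \<open>e'\<close> the cocycle condition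
    splits into two scalar ones; the entries in cyclic order form the vectors to which Koszul
    exactness applies.\<close>
  define trip where "trip = (\<lambda>P i. if i = (0::3) then P 1 2 else if i = 1 then P 2 0 else P (0::3) (1::3) :: 'a)"
  have "dot y (trip P) = 0" "dot y (trip Q) = 0"
    using z by (simp_all add: dot_def trip_def)
  then obtain u v where "trip P = cross y u" "trip Q = cross y v"
    using koszul_exact_2[OF y] by blast
  then have "\<forall>i. trip P i = cross y u i" "\<forall>i. trip Q i = cross y v i" by auto
  then have uv: "P 1 2 = y 1 * u 2 - y 2 * u 1" "P 2 0 = y 2 * u 0 - y 0 * u 2" "P 0 1 = y 0 * u 1 - y 1 * u 0"
    "Q 1 2 = y 1 * v 2 - y 2 * v 1" "Q 2 0 = y 2 * v 0 - y 0 * v 2" "Q 0 1 = y 0 * v 1 - y 1 * v 0"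
    unfolding forall3 cross_simps trip_def by simp_all
  \<comment> \<open>Adding multiples of \<open>e\<close> and \<open>e'\<close> leaves
    \<open>dot (a i) f\<close> unchanged but makes the lifts compatible: \<open>a'\<close> becomes
    proportional to \<open>y\<close>, and the quotient represents \<open>g\<close>.\<close>
  define a' where "a' = (\<lambda>s i. a i s + u i * e s + v i * e' s)"
  have "\<exists>c. \<forall>i. a' s i = y i * c" for s
  proof (rule koszul_exact_1[OF y])
    have 1: "y 2 * a 1 s - y 1 * a 2 s = P 1 2 * e s + Q 1 2 * e' s"
      "y 0 * a 2 s - y 2 * a 0 s = P 2 0 * e s + Q 2 0 * e' s"
      "y 1 * a 0 s - y 0 * a 1 s = P 0 1 * e s + Q 0 1 * e' s"
      using PQ unfolding b_def by blast+
    have "\<forall>i j. y j * a' s i = y i * a' s j"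
      unfolding forall3 a'_def
      by (intro conjI; ((rule refl; fail) | (use 1[unfolded uv] in Groebner_Basis.algebra)))
    then show "y j * a' s i = y i * a' s j" for i j by blast
  qed
  then obtain c where c: "a' s i = y i * c s" for s i by metis
  have "y 0 * g = y 0 * dot c f"
  proof -
    have "dot (\<lambda>s. a' s 0) f = dot (a 0) f + u 0 * dot e f + v 0 * dot e' f"
      unfolding a'_def dot_def by Groebner_Basis.algebra
    then have "y 0 * g = dot (\<lambda>s. a' s 0) f" using a e by simp
    also have "\<dots> = y 0 * dot c f" unfolding c dot_def by Groebner_Basis.algebra
    finally show ?thesis .
  qed
  then have "g = dot c f" using y by (auto simp: regular_triple_def)
  then show ?thesis by blast
qed

text \<open>A unit value of \<open>om\<close> makes \<open>e\<close> and \<open>e'\<close> a basis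
  of the syzygies. Both obstacles to minimality, a unit in the matrix into \<open>G\<close> and a
  syzygy with a constant entry, are excluded by way of this lemma.\<close>

lemma om_unit_saturated:
  assumes "dot e f = 0" "dot e' f = 0" "om e e' dvd 1" "regular_triple y" "\<And>i. \<exists>a. y i * g = dot a f"
  shows "\<exists>a. g = dot a f"
proof (rule free_syzygies_saturated[OF assms(1,2) _ _ assms(4,5)])
  show "\<exists>p q. \<forall>i. x i = p * e i + q * e' i" if "dot x f = 0" for x
    using om_unit_spans[OF assms(1-3) that] .
  show "p = 0 \<and> q = 0" if "\<And>i. p * e i + q * e' i = 0" for p q
  proof -
    \<comment> \<open>Crossing the relation with \<open>e'\<close> isolates \<open>p\<close>,
      crossing it with \<open>e\<close> isolates \<open>q\<close>.\<close>
    have "\<forall>i. p * cross e e' i = 0" "\<forall>i. q * cross e e' i = 0"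
      unfolding forall3 cross_simps using that[of 0] that[of 1] that[of 2]
      by (intro conjI; Groebner_Basis.algebra)+
    then have "\<forall>i. p * om e e' * f i = 0" "\<forall>i. q * om e e' * f i = 0"
      using om[OF assms(1,2)] by (simp_all add: mult.assoc)
    then show ?thesis using nonzero assms(3) by auto
  qed
qed

text \<open>A constant vector \<open>c\<close> orthogonal to \<open>f\<close> can be completed to a basis of the syzygies: choosing \<open>n\<close>
  with \<open>n \<bullet> c = 1\<close>, the cross product of \<open>c\<close> and \<open>f \<times> n\<close> is \<open>f\<close>.\<close>

lemma constant_syzygy_saturated:
  assumes "dot c f = 0" "dot n c = 1" "regular_triple y" "\<And>i. \<exists>a. y i * g = dot a f"
  shows "\<exists>a. g = dot a f"
proof (rule om_unit_saturated[OF assms(1) _ _ assms(3,4)])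
  show d: "dot (cross f n) f = 0" unfolding dot_def cross_simps by Groebner_Basis.algebra
  have c: "c 0 * f 0 + c 1 * f 1 + c 2 * f 2 = 0" "n 0 * c 0 + n 1 * c 1 + n 2 * c 2 = 1"
    using assms(1,2) by (simp_all add: dot_def)
  \<comment> \<open>Triple product: c x (f x n) = (n.c) f - (c.f) n.\<close>
  have "\<forall>i. cross c (cross f n) i = 1 * f i"
    unfolding forall3 cross_simps using c by (intro conjI; Groebner_Basis.algebra)
  then show "om c (cross f n) dvd 1" using om_eqI[OF assms(1) d, of 1] by auto
qed

text \<open>The syzygy module is isomorphic to its dual via \<open>om\<close>.\<close>

lemma functional_om:
  assumes add: "\<And>x x'. dot x f = 0 \<Longrightarrow> dot x' f = 0 \<Longrightarrow> l (\<lambda>i. x i + x' i) = l x + l x'"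
    and smult: "\<And>p x. dot x f = 0 \<Longrightarrow> l (\<lambda>i. p * x i) = p * l x"
    and e_def: "e = (\<lambda>i. - l (cross (unit3 i) f))"
  shows "dot e f = 0" "dot x f = 0 \<Longrightarrow> l x = om e x"
proof -
  define K where "K = (\<lambda>i. cross (unit3 i) f)"
  have K: "dot (K i) f = 0" for i unfolding K_def by (rule dot_koszul)
  have l3: "l (\<lambda>s. p 0 * K 0 s + p 1 * K 1 s + p 2 * K 2 s) = - dot p e" for p
  proof -
    have d1: "dot (\<lambda>s. p i * K i s) f = 0" for i
      using K[of i] unfolding dot_def by Groebner_Basis.algebra
    have d2: "dot (\<lambda>s. p 0 * K 0 s + p 1 * K 1 s) f = 0"
      using K[of 0] K[of 1] unfolding dot_def by Groebner_Basis.algebra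
    show ?thesis
      using add[OF d2 d1] add[OF d1 d1] smult[OF K] by (simp add: dot_def e_def K_def)
  qed
  \<comment> \<open>This combination is the cross product of \<open>f\<close> with itself. Applying
    the functional to it gives the orthogonality of \<open>e\<close> and \<open>f\<close>.\<close>
  have "(\<lambda>s. f 0 * K 0 s + f 1 * K 1 s + f 2 * K 2 s) = (\<lambda>s. 0 * K 0 s)"
  proof
    have "\<forall>s. f 0 * K 0 s + f 1 * K 1 s + f 2 * K 2 s = 0 * K 0 s"
      unfolding forall3 K_def cross_simps unit3_def by (simp; Groebner_Basis.algebra)
    then show "f 0 * K 0 s + f 1 * K 1 s + f 2 * K 2 s = 0 * K 0 s" for s by blast
  qed
  then have "- dot f e = 0" using l3[of f] smult[OF K, of 0 0] by simp
  then show e: "dot e f = 0" unfolding dot_def by Groebner_Basis.algebra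
  assume x: "dot x f = 0"
  obtain j where j: "f j \<noteq> 0" using nonzero by auto
  \<comment> \<open>By the triple product formula \<open>cross p f\<close> equals \<open>f j\<close>
    times \<open>x\<close> minus \<open>dot x f\<close> times a unit vector. As
    \<open>dot x f\<close> vanishes, a nonzero multiple of \<open>x\<close> is a combination of
    Koszul syzygies.\<close>
  define p where "p = cross (unit3 j) x"
  have x': "x 0 * f 0 + x 1 * f 1 + x 2 * f 2 = 0" using x by (simp add: dot_def)
  have eq: "f j * x s = p 0 * K 0 s + p 1 * K 1 s + p 2 * K 2 s" for s
  proof -
    have "\<forall>j s. f j * x s = cross (unit3 j) x 0 * K 0 s + cross (unit3 j) x 1 * K 1 s + cross (unit3 j) x 2 * K 2 s"
      unfolding forall3 K_def cross_simps unit3_def using x' by (simp; Groebner_Basis.algebra)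
    then show ?thesis unfolding p_def by blast
  qed
  have "f j * l x = - dot p e" using smult[OF x, of "f j"] l3[of p] eq by simp
  also have "\<dots> = cross e x j"
  proof -
    have "\<forall>j. - dot (cross (unit3 j) x) e = cross e x j"
      unfolding forall3 dot_def cross_simps unit3_def by (simp add: algebra_simps)
    then show ?thesis unfolding p_def by blast
  qed
  also have "\<dots> = om e x * f j" by (rule om[OF e x])
  finally show "l x = om e x" using j by simp
qed

text \<open>Again the triple product, where the term with \<open>dot e f\<close> drops out. It
  recovers \<open>e\<close> from the functional \<open>om e\<close>, with the sign that
  \<open>functional_om\<close> puts into its representing vector.\<close>

lemma om_koszul:
  assumes "dot e f = 0"
  shows "om e (cross (unit3 i) f) = - e i"
proof (rule om_eqI[OF assms dot_koszul])
  have e': "e 0 * f 0 + e 1 * f 1 + e 2 * f 2 = 0" using assms by (simp add: dot_def)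
  have "\<forall>i j. cross e (cross (unit3 i) f) j = - e i * f j"
    unfolding forall3 cross_simps unit3_def using e' by (simp; Groebner_Basis.algebra)
  then show "cross e (cross (unit3 i) f) j = - e i * f j" for j by blast
qed

text \<open>Functionals on the syzygies extend to the relations between \<open>f\<close> and elements \<open>h t\<close> of the
  saturation. This amounts to \<open>Ext\<^sup>2(M, S) = 0\<close> for a module \<open>M\<close> of finite length, and the proof
  is a Cech argument with respect to \<open>y\<close>.\<close>

lemma om_extends:
  fixes h :: "'t \<Rightarrow> 'a"
  defines "rel \<equiv> \<lambda>T q c. dot q f + (\<Sum>t\<in>T. c t * h t) = 0"
  assumes T: "finite T" and e: "dot e f = 0" and y: "regular_triple y"
    and h: "\<And>i t. t \<in> T \<Longrightarrow> \<exists>a. y i * h t = dot a f"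
  obtains L :: "(3 \<Rightarrow> 'a) \<Rightarrow> ('t \<Rightarrow> 'a) \<Rightarrow> 'a"
  where "\<And>q q' q'' c c' c''. rel T q c \<Longrightarrow> rel T q' c' \<Longrightarrow> (\<And>s. q'' s = q s + q' s) \<Longrightarrow>
      (\<And>t. t \<in> T \<Longrightarrow> c'' t = c t + c' t) \<Longrightarrow> L q'' c'' = L q c + L q' c'"
    and "\<And>p q q' c c'. rel T q c \<Longrightarrow> (\<And>s. q' s = p * q s) \<Longrightarrow> (\<And>t. t \<in> T \<Longrightarrow> c' t = p * c t) \<Longrightarrow>
      L q' c' = p * L q c"
    and "\<And>q c. dot q f = 0 \<Longrightarrow> (\<And>t. t \<in> T \<Longrightarrow> c t = 0) \<Longrightarrow> L q c = om e q"
proof -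
  have nz: "y i \<noteq> 0" for i using y by (auto simp: regular_triple_def)
  define a where "a = (\<lambda>i t. SOME a. y i * h t = dot a f)"
  have a: "y i * h t = dot (a i t) f" if "t \<in> T" for i t unfolding a_def using someI_ex[OF h[OF that]] .
  \<comment> \<open>Differences of two lifts of \<open>y i * y j * h t\<close>: these are syzygies,
    and for fixed \<open>t\<close> they form a cocycle.\<close>
  define w where "w = (\<lambda>i j t s. y j * a i t s - y i * a j t s)"
  have w: "dot (w i j t) f = 0" if "t \<in> T" for i j t
  proof -
    have "dot (w i j t) f = y j * dot (a i t) f - y i * dot (a j t) f"
      unfolding w_def dot_def by (simp add: algebra_simps)
    then show ?thesis by (simp flip: a[OF that])
  qed
  have om0: "om e (\<lambda>s. 0) = 0" by (rule om_eqI[OF e]) (simp_all add: dot_def cross_def)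
  \<comment> \<open>Applying \<open>om e\<close> to the cocycle \<open>w\<close> gives a cocycle
    with values in the ring, hence a coboundary. Its potential \<open>u\<close> supplies the
    corrections in \<open>lam\<close>.\<close>
  have "\<exists>u. \<forall>i j. om e (w i j t) = y j * u i - y i * u j" if t: "t \<in> T" for t
  proof (rule koszul_cocycle[OF y])
    show "om e (w i j t) = - om e (w j i t)" for i j
      using om_smult[OF e w[OF t], of "-1" j i] by (simp add: w_def)
    show "om e (w i i t) = 0" for i using om0 by (simp add: w_def)
    have d: "dot (\<lambda>s. p * w i j t s) f = 0" for p i j
      using w[OF t, of i j] by (simp add: dot_def mult.assoc flip: distrib_left)
    have "om e (\<lambda>s. (y 0 * w 1 2 t s + y 1 * w 2 0 t s) + y 2 * w 0 1 t s)
       = y 0 * om e (w 1 2 t) + y 1 * om e (w 2 0 t) + y 2 * om e (w 0 1 t)"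
    proof -
      have "dot (\<lambda>s. y 0 * w 1 2 t s + y 1 * w 2 0 t s) f = dot (\<lambda>s. y 0 * w 1 2 t s) f + dot (\<lambda>s. y 1 * w 2 0 t s) f"
        unfolding dot_def by (simp add: algebra_simps)
      then show ?thesis using om_add[OF e _ d] d om_add[OF e d d] om_smult[OF e w[OF t]] by simp
    qed
    moreover have "(y 0 * w 1 2 t s + y 1 * w 2 0 t s) + y 2 * w 0 1 t s = 0" for s
      unfolding w_def by (simp add: algebra_simps)
    ultimately show "y 0 * om e (w 1 2 t) + y 1 * om e (w 2 0 t) + y 2 * om e (w 0 1 t) = 0"
      using om0 by simp
  qed
  then obtain u where u: "om e (w i j t) = y j * u t i - y i * u t j" if "t \<in> T" for t i j by metis
  \<comment> \<open>Multiplying the relation by \<open>y i\<close> and replacing each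
    \<open>y i * h t\<close> by its lift gives a genuine syzygy, on which \<open>om e\<close> makes
    sense.\<close>
  define z where "z = (\<lambda>i q c s. y i * q s + (\<Sum>t\<in>T. c t * a i t s))"
  define lam where "lam = (\<lambda>i q c. om e (z i q c) - (\<Sum>t\<in>T. c t * u t i))"
  have z: "dot (z i q c) f = 0" if "rel T q c" for i q c
  proof -
    have "dot (z i q c) f = y i * dot q f + (\<Sum>t\<in>T. c t * dot (a i t) f)"
      by (rule dot_linear[OF T]) (simp add: z_def)
    also have "\<dots> = y i * (dot q f + (\<Sum>t\<in>T. c t * h t))"
      by (simp add: distrib_left sum_distrib_left mult.left_commute flip: a)
    finally show ?thesis using that by (simp add: rel_def)
  qed
  \<comment> \<open>The corrected values agree up to the factors \<open>y i\<close>; their common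
    quotient is the value of the extension.\<close>
  have "\<exists>l. \<forall>i. lam i q c = y i * l" if r: "rel T q c" for q c
  proof (rule koszul_exact_1[OF y])
    fix i j
    have "y j * om e (z i q c) - y i * om e (z j q c) = om e (\<lambda>s. y j * z i q c s - y i * z j q c s)"
      using om_diff[OF e z[OF r] z[OF r]] by simp
    also have "\<dots> = 0 * om e (\<lambda>s. 0) + (\<Sum>t\<in>T. c t * om e (w i j t))"
      by (rule om_linear[OF T e _ w])
        (simp_all add: dot_def z_def w_def algebra_simps sum_distrib_left sum_subtractf)
    also have "\<dots> = y j * (\<Sum>t\<in>T. c t * u t i) - y i * (\<Sum>t\<in>T. c t * u t j)"
      by (simp add: u algebra_simps sum_distrib_left sum_subtractf)
    finally show "y j * lam i q c = y i * lam j q c" unfolding lam_def by (simp add: algebra_simps)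
  qed
  then obtain L where L: "rel T q c \<Longrightarrow> lam i q c = y i * L q c" for q c i by metis
  show thesis
  proof (rule that[of L])
    fix q q' q'' c c' c''
    assume r: "rel T q c" "rel T q' c'" and q'': "\<And>s. q'' s = q s + q' s" and c'': "\<And>t. t \<in> T \<Longrightarrow> c'' t = c t + c' t"
    have "dot q'' f + (\<Sum>t\<in>T. c'' t * h t) = (dot q f + (\<Sum>t\<in>T. c t * h t)) + (dot q' f + (\<Sum>t\<in>T. c' t * h t))"
      unfolding dot_def q'' by (simp add: c'' algebra_simps sum.distrib)
    then have r'': "rel T q'' c''" using r by (simp add: rel_def)
    have "z 0 q'' c'' = (\<lambda>s. z 0 q c s + z 0 q' c' s)"
      by (rule ext) (simp add: z_def q'' c'' algebra_simps sum.distrib)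
    then have "om e (z 0 q'' c'') = om e (z 0 q c) + om e (z 0 q' c')"
      by (simp only: om_add[OF e z[OF r(1)] z[OF r(2)]])
    then have "lam 0 q'' c'' = lam 0 q c + lam 0 q' c'"
      by (simp add: lam_def c'' algebra_simps sum.distrib)
    then have "y 0 * L q'' c'' = y 0 * (L q c + L q' c')" using L r r'' by (simp add: distrib_left)
    then show "L q'' c'' = L q c + L q' c'" using nz by simp
  next
    fix p q q' c c'
    assume r: "rel T q c" and q': "\<And>s. q' s = p * q s" and c': "\<And>t. t \<in> T \<Longrightarrow> c' t = p * c t"
    have "dot q' f + (\<Sum>t\<in>T. c' t * h t) = p * (dot q f + (\<Sum>t\<in>T. c t * h t))"
      unfolding dot_def q' by (simp add: c' algebra_simps sum_distrib_left)
    then have r': "rel T q' c'" using r by (simp add: rel_def)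
    have "z 0 q' c' = (\<lambda>s. p * z 0 q c s)"
      by (rule ext) (simp add: z_def q' c' algebra_simps sum_distrib_left)
    then have "lam 0 q' c' = p * lam 0 q c"
      using om_smult[OF e z[OF r]] by (simp add: lam_def c' algebra_simps sum_distrib_left)
    then have "y 0 * L q' c' = y 0 * (p * L q c)" using L r r' by (simp add: mult.left_commute)
    then show "L q' c' = p * L q c" using nz by simp
  next
    fix q :: "3 \<Rightarrow> 'a" and c :: "'t \<Rightarrow> 'a"
    assume q: "dot q f = 0" and c: "\<And>t. t \<in> T \<Longrightarrow> c t = 0"
    have r: "rel T q c" using q c by (simp add: rel_def)
    have "z 0 q c = (\<lambda>s. y 0 * q s)" by (rule ext) (simp add: z_def c)
    then have "lam 0 q c = y 0 * om e q" using om_smult[OF e q] by (simp add: lam_def c)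
    then show "L q c = om e q" using L[OF r] nz by simp
  qed
qed

end


section \<open>The polynomial ring in three variables\<close>

abbreviation "lookup \<equiv> Poly_Mapping.lookup"
abbreviation "single \<equiv> Poly_Mapping.single"
abbreviation "keys \<equiv> Poly_Mapping.keys"

lemma poly_sum_single:
  fixes p :: "'k::field poly3"
  shows "p = (\<Sum>m\<in>keys p. single m (lookup p m))"
  by (rule poly_mapping_eqI) (simp add: lookup_sum lookup_single when_def not_in_keys_iff_lookup_eq_zero)

lemma poly_induct [case_names single add]:
  fixes P :: "'k::field poly3 \<Rightarrow> bool"
  assumes "\<And>m c. P (single m c)" "\<And>p q. P p \<Longrightarrow> P q \<Longrightarrow> P (p + q)"
  shows "P p"
proof -
  have "P (\<Sum>m\<in>K. single m (lookup p m))" if "finite K" for K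
    using that
  proof induction
    case empty
    show ?case using assms(1)[of undefined 0] by simp
  next
    case (insert m K)
    then show ?case using assms by simp
  qed
  from this[OF finite_keys[of p]] show ?thesis by (simp flip: poly_sum_single)
qed

text \<open>Common shape of differentiation, substitution and projection to a degree: once
  \<open>h\<close> is additive in the coefficient, identities need only be checked on single
  terms.\<close>

definition lin_ext :: "((3 \<Rightarrow>\<^sub>0 nat) \<Rightarrow> 'k \<Rightarrow> 'b) \<Rightarrow> 'k::field poly3 \<Rightarrow> 'b::comm_monoid_add" where
  "lin_ext h p = (\<Sum>m\<in>keys p. h m (lookup p m))"

lemma lin_ext_add:
  assumes "\<And>m. h m 0 = 0" "\<And>m a b. h m (a + b) = h m a + h m b"
  shows "lin_ext h (p + q) = lin_ext h p + lin_ext h q"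
  unfolding lin_ext_def by (rule setsum_keys_plus_distrib) (use assms in auto)

lemma lin_ext_single:
  assumes "\<And>m. h m 0 = 0"
  shows "lin_ext h (single m c) = h m c"
  by (cases "c = 0") (simp_all add: lin_ext_def assms)

abbreviation cst :: "'k::field \<Rightarrow> 'k poly3" where
  "cst c \<equiv> single 0 c"

lemma cst_simps: "cst (a + b) = cst a + cst b" "cst (a * b) = cst a * cst b" "cst (- a) = - cst a"
  "cst (a - b) = cst a - cst b"
  by (simp_all add: single_add mult_single single_uminus single_diff)

lemma lookup_cst_mult: "lookup (cst c * p) m = c * lookup p m"
proof (induction p rule: poly_induct)
  case (single m' c')
  then show ?case by (simp add: mult_single lookup_single when_def)
next
  case (add p q)
  then show ?case by (simp add: distrib_left lookup_add)
qed

text \<open>Exponent vectors add up to zero only if both vanish. Thus the constant term is a ring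
  homomorphism, namely reduction modulo the irrelevant ideal, and minimality is tested through
  it.\<close>

lemma lookup_mult_0:
  fixes p q :: "'k::field poly3"
  shows "lookup (p * q) 0 = lookup p 0 * lookup q 0"
proof (induction p rule: poly_induct)
  case (single m c)
  show ?case
  proof (induction q rule: poly_induct)
    case (single m' c')
    have "m + m' = 0 \<longleftrightarrow> m = 0 \<and> m' = 0"
      by (auto simp: poly_mapping_eq_iff fun_eq_iff lookup_add)
    then show ?case by (auto simp add: mult_single lookup_single when_def)
  next
    case (add p q)
    then show ?case by (simp add: distrib_left lookup_add)
  qed
next
  case (add p q)
  then show ?case by (simp add: distrib_right lookup_add)
qed

lemma var_power: "var i ^ k = single (single i k) 1"
proof (induction k)
  case (Suc k)
  have "single i 1 + single i k = single i (Suc k)"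
    by (simp flip: single_add)
  with Suc show ?case by (simp add: var_def mult_single)
qed simp

lemma single_eq_prod: "single m c = cst c * (\<Prod>i\<in>UNIV. var i ^ lookup m i)"
proof -
  let ?e = "\<lambda>i. single i (lookup m i)"
  have "(\<Sum>i\<in>UNIV. ?e i) = m"
    by (rule poly_mapping_eqI) (simp add: lookup_sum lookup_single when_def)
  then have "single m c = single (?e 0 + ?e 1 + ?e 2) c"
    by (simp only: sum3)
  also have "\<dots> = cst c * (single (?e 0) 1 * single (?e 1) 1 * single (?e 2) 1)"
    by (simp only: mult_single mult_1_left mult_1_right add_0_left)
  finally show ?thesis by (simp only: prod3 var_power)
qed

lemma poly_ring_induct [case_names cst var add mult]:
  fixes P :: "'k::field poly3 \<Rightarrow> bool"
  assumes "\<And>c. P (cst c)" "\<And>i. P (var i)" "\<And>p q. P p \<Longrightarrow> P q \<Longrightarrow> P (p + q)"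
    "\<And>p q. P p \<Longrightarrow> P q \<Longrightarrow> P (p * q)"
  shows "P p"
proof (induction p rule: poly_induct)
  case (single m c)
  have pow: "P (var i ^ k)" for i k
    by (induction k) (use assms(1)[of 1] assms(2,4) in auto)
  show ?case unfolding single_eq_prod[of m c] prod3 by (intro assms(4) assms(1) pow)
qed (rule assms(3))

subsection \<open>Grading\<close>

lemma mon_degree_add: "mon_degree (m + m') = mon_degree m + mon_degree m'"
  by (simp add: mon_degree_def lookup_add sum.distrib)

lemma mon_degree_single: "mon_degree (single i k) = k"
  by (simp add: mon_degree_def lookup_single when_def)

lemma mon_degree_0_iff: "mon_degree m = 0 \<longleftrightarrow> m = 0"
  by (auto simp: mon_degree_def poly_mapping_eq_iff fun_eq_iff)

lemma homog_0 [simp]: "0 \<in> homog n"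
  by (simp add: homog_def)

lemma homog_single: "single m c \<in> homog (int (mon_degree m))"
  by (simp add: homog_def)

lemma homog_cst [simp]: "cst c \<in> homog 0"
  by (simp add: homog_def mon_degree_def)

lemma homog_1: "1 \<in> homog 0"
  using homog_cst[of 1] by simp

lemma homog_var: "var i \<in> homog 1"
  by (simp add: homog_def var_def mon_degree_single)

lemma homog_add: "p \<in> homog n \<Longrightarrow> q \<in> homog n \<Longrightarrow> p + q \<in> homog n"
  using keys_add[of p q] by (auto simp: homog_def)

lemma homog_uminus: "p \<in> homog n \<Longrightarrow> - p \<in> homog n"
  by (auto simp: homog_def in_keys_iff)

lemma homog_diff: "p \<in> homog n \<Longrightarrow> q \<in> homog n \<Longrightarrow> p - q \<in> homog n"
  using homog_add[of p n "- q"] homog_uminus[of q n] by simp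

lemma homog_sum: "(\<And>x. x \<in> Y \<Longrightarrow> p x \<in> homog n) \<Longrightarrow> sum p Y \<in> homog n"
  by (induction Y rule: infinite_finite_induct) (simp_all add: homog_add)

lemma homog_mult: "p \<in> homog n \<Longrightarrow> q \<in> homog k \<Longrightarrow> p * q \<in> homog (n + k)"
  using keys_mult[of p q] by (fastforce simp: homog_def mon_degree_add)

lemma homog_mult': "p \<in> homog n \<Longrightarrow> q \<in> homog k \<Longrightarrow> n + k = j \<Longrightarrow> p * q \<in> homog j"
  using homog_mult by blast

lemma homog_prod: "(\<And>x. x \<in> Y \<Longrightarrow> p x \<in> homog 1) \<Longrightarrow> prod p Y \<in> homog (int (card Y))"
proof (induction Y rule: infinite_finite_induct)
  case (insert x Y)
  then show ?case by (auto intro!: homog_mult')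
qed (simp_all add: homog_1)

lemma homog_neg: "p \<in> homog n \<Longrightarrow> n < 0 \<Longrightarrow> p = 0"
  by (force simp: homog_def simp flip: keys_eq_empty)

lemma homog_0_cst:
  assumes "p \<in> homog 0" shows "p = cst (lookup p 0)"
proof (rule poly_mapping_eqI)
  fix m show "lookup p m = lookup (cst (lookup p 0)) m"
    using assms by (cases "m = 0")
      (auto simp: homog_def mon_degree_0_iff lookup_single when_def in_keys_iff)
qed

lemma homog_lookup_0: "p \<in> homog n \<Longrightarrow> n \<noteq> 0 \<Longrightarrow> lookup p 0 = 0"
  using mon_degree_0_iff[of 0] by (fastforce simp: homog_def in_keys_iff)

definition hproj :: "int \<Rightarrow> 'k::field poly3 \<Rightarrow> 'k poly3" where
  "hproj n p = lin_ext (\<lambda>m c. if int (mon_degree m) = n then single m c else 0) p"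

lemma hproj_add: "hproj n (p + q) = hproj n p + hproj n q"
  unfolding hproj_def by (rule lin_ext_add) (simp_all add: single_add)

lemma hproj_single:
  "hproj n (single m c) = (if int (mon_degree m) = n then single m c else 0)"
  unfolding hproj_def by (rule lin_ext_single) simp

lemma lookup_hproj:
  "lookup (hproj n p) m = (if int (mon_degree m) = n then lookup p m else 0)"
  by (induction p rule: poly_induct) (auto simp: hproj_single hproj_add lookup_add lookup_single when_def)

lemma hproj_homog: "hproj n p \<in> homog n"
  by (auto simp: homog_def in_keys_iff lookup_hproj split: if_splits)

lemma hproj_0 [simp]: "hproj n 0 = 0"
  by (rule poly_mapping_eqI) (simp add: lookup_hproj)

lemma hproj_diff: "hproj n (p - q) = hproj n p - hproj n q"
  by (rule poly_mapping_eqI) (simp add: lookup_hproj lookup_minus)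

lemma hproj_sum: "hproj n (sum p Y) = (\<Sum>x\<in>Y. hproj n (p x))"
  by (induction Y rule: infinite_finite_induct) (simp_all add: hproj_add)

lemma hproj_of_homog: "p \<in> homog k \<Longrightarrow> hproj n p = (if n = k then p else 0)"
  by (rule poly_mapping_eqI) (auto simp: lookup_hproj homog_def in_keys_iff)

lemma hproj_mult:
  assumes "p \<in> homog j" shows "hproj n (p * q) = p * hproj (n - j) q"
proof (induction q rule: poly_induct)
  case (single m c)
  have "p * single m c \<in> homog (j + int (mon_degree m))"
    using homog_mult[OF assms homog_single] .
  then show ?case by (auto simp: hproj_single hproj_of_homog[where k = "j + int (mon_degree m)"])
next
  case (add q r)
  then show ?case by (simp add: distrib_left hproj_add)
qed

definition degs :: "'k::field poly3 \<Rightarrow> int set" where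
  "degs p = (\<lambda>m. int (mon_degree m)) ` keys p"

lemma finite_degs [simp]: "finite (degs p)"
  by (simp add: degs_def)

lemma hproj_notin_degs: "n \<notin> degs p \<Longrightarrow> hproj n p = 0"
  by (rule poly_mapping_eqI) (auto simp: lookup_hproj degs_def in_keys_iff)

lemma hproj_decomp:
  assumes "finite D" "degs p \<subseteq> D" shows "p = (\<Sum>n\<in>D. hproj n p)"
proof (rule poly_mapping_eqI)
  fix m show "lookup p m = lookup (\<Sum>n\<in>D. hproj n p) m"
    using assms by (cases "m \<in> keys p")
      (auto simp: lookup_sum lookup_hproj degs_def in_keys_iff)
qed

subsection \<open>Powers of the variables\<close>

lemma single_mult_dvd_iff:
  fixes p :: "'k::field poly3"
  shows "single s 1 dvd p \<longleftrightarrow> (\<forall>m\<in>keys p. \<exists>m'. m = s + m')"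
proof
  assume "single s 1 dvd p"
  then obtain q where q: "p = single s 1 * q" by auto
  show "\<forall>m\<in>keys p. \<exists>m'. m = s + m'"
    using keys_mult[of "single s 1" q] unfolding q by fastforce
next
  assume *: "\<forall>m\<in>keys p. \<exists>m'. m = s + m'"
  have "p = (\<Sum>m\<in>keys p. single m (lookup p m))"
    by (rule poly_sum_single)
  also have "single s 1 dvd \<dots>"
  proof (rule dvd_sum)
    fix m assume "m \<in> keys p"
    then obtain m' where "m = s + m'" using * by auto
    then have "single m (lookup p m)
      = single s 1 * single m' (lookup p m)"
      by (simp add: mult_single)
    then show "single s 1 dvd single m (lookup p m)" by simp
  qed
  finally show "single s 1 dvd p" .
qed

lemma adds_single_iff:
  fixes m :: "3 \<Rightarrow>\<^sub>0 nat"
  shows "(\<exists>m'. m = single i k + m') \<longleftrightarrow> k \<le> lookup m (i::3)"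
proof
  assume "k \<le> lookup m i"
  then have "m = single i k + (m - single i k)"
    by (intro poly_mapping_eqI) (auto simp: lookup_add lookup_minus lookup_single when_def)
  then show "\<exists>m'. m = single i k + m'" by blast
qed (auto simp: lookup_add)

lemma var_power_dvd_iff:
  "var i ^ k dvd p \<longleftrightarrow> (\<forall>m\<in>keys p. k \<le> lookup m i)"
  unfolding var_power single_mult_dvd_iff adds_single_iff ..

lemma keys_single_mult:
  fixes p :: "'k::field poly3"
  shows "keys (single s 1 * p) = (+) s ` keys p"
proof -
  have *: "lookup (single s 1 * p) (s + m) = lookup p m" for m
    by (induction p rule: poly_induct)
      (simp_all add: mult_single lookup_single when_def distrib_left lookup_add)
  show ?thesis
    using keys_mult[of "single s 1" p] by (auto simp: in_keys_iff * split: if_splits)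
qed

lemma var_nonzero: "var i \<noteq> (0 :: 'k::field poly3)"
  unfolding var_def by (metis lookup_single_eq lookup_zero zero_neq_one)

text \<open>Powers of variables generate monomial ideals, so each clause can be checked monomial by
  monomial.\<close>

lemma regular_triple_var_power: "regular_triple (\<lambda>i. var i ^ k :: 'k::field poly3)"
  unfolding regular_triple_def
proof (intro conjI allI impI)
  show "var i ^ k \<noteq> (0 :: 'k poly3)" for i
    by (simp add: var_nonzero)
  have keys: "keys (var j ^ k * a) = (+) (single j k) ` keys a"
    for j and a :: "'k poly3" by (simp add: var_power keys_single_mult)
  show "var i ^ k dvd a" if "i \<noteq> j" "var i ^ k dvd var j ^ k * a" for i j and a :: "'k poly3"
    using that unfolding var_power_dvd_iff keys by (auto simp: lookup_add lookup_single when_def)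
  fix a b c :: "'k poly3"
  assume eq: "var 2 ^ k * a = var 0 ^ k * b + var 1 ^ k * c"
  \<comment> \<open>\<open>a0\<close> collects the monomials divisible by the power of the first
    variable; the equation forces all others to be divisible by the power of the second.\<close>
  define a0 where "a0 = (\<Sum>m\<in>{m\<in>keys a. k \<le> lookup m 0}. single m (lookup a m))"
  define a1 where "a1 = (\<Sum>m\<in>{m\<in>keys a. \<not> k \<le> lookup m 0}. single m (lookup a m))"
  have "a = a0 + a1"
    unfolding a0_def a1_def by (subst poly_sum_single, subst sum.union_disjoint[symmetric])
      (auto intro!: sum.cong)
  moreover have "var 0 ^ k dvd a0"
    unfolding a0_def by (intro dvd_sum) (auto simp: var_power_dvd_iff)
  moreover have "var 1 ^ k dvd a1"
    unfolding a1_def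
  proof (rule dvd_sum)
    fix m assume m: "m \<in> {m \<in> keys a. \<not> k \<le> lookup m 0}"
    let ?m = "single 2 k + m"
    have "?m \<in> keys (var 2 ^ k * a)" using m by (auto simp: keys)
    then have "?m \<in> keys (var 0 ^ k * b) \<union> keys (var 1 ^ k * c)"
      unfolding eq by (rule subsetD[OF keys_add])
    then have "(\<exists>m'. ?m = single 0 k + m') \<or> (\<exists>m'. ?m = single 1 k + m')"
      unfolding keys by blast
    then have "k \<le> lookup ?m 0 \<or> k \<le> lookup ?m 1"
      unfolding adds_single_iff .
    then have "k \<le> lookup m 1" using m by (simp add: lookup_add lookup_single)
    then show "var 1 ^ k dvd single m (lookup a m)"
      by (simp add: var_power_dvd_iff)
  qed
  ultimately show "\<exists>u v. a = var 0 ^ k * u + var 1 ^ k * v" by (auto simp: dvd_def)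
qed

subsection \<open>Linear forms\<close>

definition subst :: "(3 \<Rightarrow> 'k::field poly3) \<Rightarrow> 'k poly3 \<Rightarrow> 'k poly3" where
  "subst g = lin_ext (\<lambda>m c. cst c * (\<Prod>i\<in>UNIV. g i ^ lookup m i))"

lemma subst_add: "subst g (p + q) = subst g p + subst g q"
  unfolding subst_def by (rule lin_ext_add) (simp_all add: cst_simps distrib_right)

lemma subst_single: "subst g (single m c) = cst c * (\<Prod>i\<in>UNIV. g i ^ lookup m i)"
  unfolding subst_def by (rule lin_ext_single) simp

lemma subst_mult: "subst g (p * q) = subst g p * subst g q"
proof (induction p rule: poly_induct)
  case (single m c)
  show ?case
  proof (induction q rule: poly_induct)
    case (single m' c')
    show ?case
      unfolding mult_single[of m c m' c'] subst_single lookup_add power_add prod.distrib cst_simps(2)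
      by (simp only: ac_simps)
  next
    case (add p q)
    then show ?case by (simp add: distrib_left subst_add)
  qed
next
  case (add p q)
  then show ?case by (simp add: distrib_right subst_add)
qed

lemma subst_cst: "subst g (cst c) = cst c"
  by (simp add: subst_single)

lemma subst_var: "subst g (var i) = g i"
proof -
  have "\<forall>i. subst g (var i) = g i"
    unfolding forall3 var_def subst_single prod3 by (simp add: lookup_single)
  then show ?thesis by blast
qed

lemma subst_diff: "subst g (p - q) = subst g p - subst g q"
  using subst_add[of g "p - q" q] by simp

lemma subst_0: "subst g 0 = 0"
  using subst_diff[of g 0 0] by simp

lemma subst_power: "subst g (p ^ k) = subst g p ^ k"
  by (induction k) (use subst_cst[of g 1] in \<open>simp_all add: subst_mult\<close>)

lemma subst_sum: "subst g (sum p Y) = (\<Sum>x\<in>Y. subst g (p x))"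
  by (induction Y rule: infinite_finite_induct) (simp_all add: subst_0 subst_add)

lemma subst_prod: "subst g (prod p Y) = (\<Prod>x\<in>Y. subst g (p x))"
  using subst_cst[of g 1] by (induction Y rule: infinite_finite_induct) (simp_all add: subst_mult)

lemma homog_1_decomp:
  fixes l :: "'k::field poly3"
  assumes "l \<in> homog 1"
  shows "l = (\<Sum>i\<in>UNIV. cst (lookup l (single i 1)) * var i)"
proof -
  have *: "cst c * var i = single (single i 1) c" for c and i :: 3
    by (simp add: var_def mult_single)
  have inj: "inj (\<lambda>i::3. single i (1::nat))"
    by (rule injI) (metis lookup_single_eq lookup_single_not_eq zero_neq_one)
  have "m \<in> range (\<lambda>i::3. single i 1)" if m: "m \<in> keys l" for m
  proof -
    have d: "mon_degree m = 1" using assms m by (auto simp: homog_def)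
    have "\<exists>i. 1 \<le> lookup m i"
    proof (rule ccontr)
      assume "\<nexists>i. 1 \<le> lookup m i"
      then have "lookup m i = 0" for i by (simp add: not_le)
      then show False using d by (simp add: mon_degree_def)
    qed
    then obtain i m' where m': "m = single i 1 + m'"
      unfolding adds_single_iff[symmetric] by blast
    have "mon_degree m' = 0" using d m' by (simp add: mon_degree_add mon_degree_single)
    then show ?thesis using m' by (simp add: mon_degree_0_iff)
  qed
  then have "l = (\<Sum>m\<in>range (\<lambda>i::3. single i 1). single m (lookup l m))"
    by (subst poly_sum_single, intro sum.mono_neutral_left) (auto simp: in_keys_iff)
  also have "\<dots> = (\<Sum>i\<in>UNIV. cst (lookup l (single i 1)) * var i)"
    using inj by (simp add: sum.reindex * o_def)
  finally show ?thesis .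
qed


definition lcoeff :: "'k::field poly3 \<Rightarrow> 3 \<Rightarrow> 'k" where
  "lcoeff l i = lookup l (single i 1)"

lemma linear_form_coeff: "linear_form l \<Longrightarrow> \<exists>i. lcoeff l i \<noteq> 0"
proof (rule ccontr)
  assume "linear_form l" "\<nexists>i. lcoeff l i \<noteq> 0"
  moreover from this have "l = (\<Sum>i\<in>UNIV. cst (lcoeff l i) * var i)"
    using homog_1_decomp[of l] by (simp add: linear_form_def lcoeff_def)
  ultimately show False by (simp add: linear_form_def)
qed

text \<open>Substitution that eliminates the variable \<open>x\<^sub>k\<close> modulo the linear form \<open>l\<close>.\<close>

definition elim :: "'k::field poly3 \<Rightarrow> 3 \<Rightarrow> 'k poly3 \<Rightarrow> 'k poly3" where
  "elim l k = subst (\<lambda>i. if i = k then var k - cst (1 / lcoeff l k) * l else var i)"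

lemma elim_var: "elim l k (var i) = (if i = k then var k - cst (1 / lcoeff l k) * l else var i)"
  unfolding elim_def subst_var by simp

lemma elim_self:
  assumes "linear_form l" "lcoeff l k \<noteq> 0" shows "elim l k l = 0"
proof -
  have l: "l = (\<Sum>i\<in>UNIV. cst (lcoeff l i) * var i)"
    using assms homog_1_decomp[of l] by (simp add: linear_form_def lcoeff_def)
  then have "elim l k l = elim l k (\<Sum>i\<in>UNIV. cst (lcoeff l i) * var i)" by (rule arg_cong)
  also have "\<dots> = (\<Sum>i\<in>UNIV. cst (lcoeff l i) * elim l k (var i))"
    by (simp add: elim_def subst_sum subst_mult subst_cst)
  also have "\<dots> = (\<Sum>i\<in>UNIV. cst (lcoeff l i) * var i - (if i = k then cst (lcoeff l k) * (cst (1 / lcoeff l k) * l) else 0))"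
    by (rule sum.cong) (auto simp: elim_var right_diff_distrib)
  also have "\<dots> = l - cst (lcoeff l k) * (cst (1 / lcoeff l k) * l)"
    by (simp add: sum_subtractf flip: l)
  also have "cst (lcoeff l k) * (cst (1 / lcoeff l k) * l) = l"
    using assms(2) by (simp add: mult_single flip: mult.assoc)
  finally show ?thesis by simp
qed

lemma elim_mult: "elim l k (p * q) = elim l k p * elim l k q"
  unfolding elim_def by (rule subst_mult)

text \<open>The substitution moves each variable by a multiple of \<open>l\<close>, and congruence
  modulo \<open>l\<close> is compatible with sums and products.\<close>

lemma dvd_diff_elim: "l dvd p - elim l k p"
proof (induction p rule: poly_ring_induct)
  case (cst c)
  then show ?case by (simp add: elim_def subst_cst)
next
  case (var i)
  then show ?case by (simp add: elim_var)
next
  case (add p q)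
  have "p + q - elim l k (p + q) = (p - elim l k p) + (q - elim l k q)"
    by (simp add: elim_def subst_add)
  then show ?case using add by (metis dvd_add)
next
  case (mult p q)
  have "p * q - elim l k (p * q) = p * (q - elim l k q) + (p - elim l k p) * elim l k q"
    by (simp add: elim_def subst_mult algebra_simps)
  then show ?case using mult by (metis dvd_add dvd_mult dvd_mult2)
qed

lemma linear_form_dvd_iff:
  assumes "linear_form l" "lcoeff l k \<noteq> 0"
  shows "l dvd p \<longleftrightarrow> elim l k p = 0"
proof (rule iffI)
  assume "l dvd p"
  then obtain q where "p = l * q" by (rule dvdE)
  then have "elim l k p = elim l k l * elim l k q" by (simp only: elim_mult)
  then show "elim l k p = 0" using elim_self[OF assms] by simp
next
  assume "elim l k p = 0"
  with dvd_diff_elim[of l p k] show "l dvd p" by simp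
qed

text \<open>Elimination is a ring homomorphism into a domain, and its kernel consists of the
  multiples of \<open>l\<close>.\<close>

lemma linear_form_prime:
  assumes "linear_form l" "l dvd p * q" shows "l dvd p \<or> l dvd q"
proof -
  obtain k where k: "lcoeff l k \<noteq> 0" using linear_form_coeff[OF assms(1)] by blast
  note iff = linear_form_dvd_iff[OF assms(1) k]
  have "elim l k (p * q) = 0" using assms(2) by (rule iffD1[OF iff])
  then have "elim l k p * elim l k q = 0" by (simp only: elim_mult)
  then have "elim l k p = 0 \<or> elim l k q = 0" by (rule iffD1[OF mult_eq_0_iff])
  then show ?thesis using iffD2[OF iff] by blast
qed

lemma linear_form_prime_prod:
  assumes "linear_form l" "finite A" "l dvd prod g A" shows "\<exists>x\<in>A. l dvd g x"
  using assms(2,3)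
proof (induction A)
  case empty
  then have "l dvd 1" by simp
  then obtain q where "1 = l * q" by (rule dvdE)
  then have "lookup l 0 * lookup q 0 = 1"
    using lookup_mult_0[of l q] by (simp flip: \<open>1 = l * q\<close>)
  moreover have "lookup l 0 = 0"
    by (rule homog_lookup_0[of l 1]) (use assms(1) in \<open>simp_all add: linear_form_def\<close>)
  ultimately show ?case by simp
next
  case (insert x A)
  then show ?case using linear_form_prime[OF assms(1)] by auto
qed

text \<open>Comparing components of degree one reduces the cofactor to a constant.\<close>

lemma dvd_linear_form:
  assumes "linear_form l" "linear_form l'" "l dvd l'"
  obtains c where "c \<noteq> 0" "l' = cst c * l"
proof -
  obtain q where q: "l' = l * q" using assms(3) by (rule dvdE)
  have "hproj 1 l' = l'" using assms(2) hproj_of_homog[of l' 1 1] by (simp add: linear_form_def)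
  moreover have "hproj 1 l' = l * hproj 0 q"
    unfolding q using hproj_mult[of l 1 1 q] assms(1) by (simp add: linear_form_def)
  moreover have "hproj 0 q = cst (lookup (hproj 0 q) 0)"
    by (rule homog_0_cst[OF hproj_homog])
  ultimately have *: "l' = cst (lookup (hproj 0 q) 0) * l"
    by (metis mult.commute)
  have "lookup (hproj 0 q) 0 \<noteq> 0"
    using assms(2) * by (auto simp: linear_form_def)
  with * show thesis by (rule that[rotated])
qed

lemma zero_locus_cst_mult:
  assumes "c \<noteq> 0" shows "zero_locus (cst c * l) = zero_locus l"
proof -
  have k: "keys (cst c * l) = keys l"
    using assms by (auto simp: in_keys_iff lookup_cst_mult)
  have "poly_eval (cst c * l) v = c * poly_eval l v" for v
    unfolding poly_eval_def k lookup_cst_mult by (simp add: sum_distrib_left mult.assoc)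
  then show ?thesis unfolding zero_locus_def using assms by simp
qed

lemma prod_linear_forms_dvd:
  assumes "finite A" "\<And>x. x \<in> A \<Longrightarrow> linear_form (l x)"
    and "\<And>x y. x \<in> A \<Longrightarrow> y \<in> A \<Longrightarrow> x \<noteq> y \<Longrightarrow> \<not> l x dvd l y"
    and "\<And>x. x \<in> A \<Longrightarrow> l x dvd h"
  shows "prod l A dvd h"
  using assms
proof (induction A)
  case (insert x A)
  then have "prod l A dvd h" by auto
  then obtain r where r: "h = prod l A * r" by (rule dvdE)
  have "l x dvd prod l A * r" using insert r by auto
  moreover have "\<not> l x dvd prod l A"
    using linear_form_prime_prod[of "l x" A l] insert by (metis insertCI)
  ultimately have "l x dvd r" using linear_form_prime insert by blast
  then show ?case using insert r by (simp add: mult.commute mult_dvd_mono)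
qed simp

text \<open>Here the forms may be proportional, as happens for the restrictions of distinct lines to
  another line. The factors are therefore split off from \<open>g\<close> one at a time, each being
  prime and missing \<open>s\<close> or \<open>t\<close>.\<close>

lemma prod_linear_forms_dvd_common:
  assumes "finite A" "\<And>x. x \<in> A \<Longrightarrow> linear_form (q x)"
    and "\<And>x. x \<in> A \<Longrightarrow> \<not> (q x dvd s \<and> q x dvd t)"
    and "prod q A dvd s * g" "prod q A dvd t * g"
  shows "prod q A dvd g"
  using assms
proof (induction A arbitrary: g)
  case (insert x A)
  have "q x dvd s * g" "q x dvd t * g" using insert.prems(3,4) insert.hyps by (auto intro: dvd_mult_left)
  then have "q x dvd g" using linear_form_prime insert.prems(1,2) by blast
  then obtain g' where g': "g = q x * g'" by (rule dvdE)
  have nz: "q x \<noteq> 0" using insert.prems(1) by (auto simp: linear_form_def)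
  have "prod q A dvd u * g'" if "prod q (insert x A) dvd u * g" for u
  proof -
    have "q x * prod q A dvd q x * (u * g')" using that insert.hyps by (simp add: g' mult.left_commute)
    then show ?thesis using nz by simp
  qed
  note * = this[OF insert.prems(3)] this[OF insert.prems(4)]
  have "prod q A dvd g'"
  proof (rule insert.IH[OF _ _ *])
    show "linear_form (q y)" if "y \<in> A" for y using that insert.prems(1) by simp
    show "\<not> (q y dvd s \<and> q y dvd t)" if "y \<in> A" for y using that insert.prems(2)[of y] by simp
  qed
  then show ?case using insert.hyps g' by (simp add: mult_dvd_mono)
qed simp


section \<open>Jacobian ideals of line arrangements\<close>

subsection \<open>Partial derivatives\<close>

lemma partial_deriv_lin_ext: "partial_deriv i = lin_ext (\<lambda>m c. single (m - single i 1)
    (of_nat (lookup m i) * c))"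
  by (rule ext) (simp add: partial_deriv_def lin_ext_def)

lemma partial_deriv_add: "partial_deriv i (p + q) = partial_deriv i p + partial_deriv i q"
  unfolding partial_deriv_lin_ext by (rule lin_ext_add) (simp_all add: distrib_left single_add)

lemma partial_deriv_single: "partial_deriv i (single m c) =
    single (m - single i 1) (of_nat (lookup m i) * c)"
  unfolding partial_deriv_lin_ext by (rule lin_ext_single) simp

lemma partial_deriv_sum: "partial_deriv i (sum p Y) = (\<Sum>y\<in>Y. partial_deriv i (p y))"
proof -
  have "partial_deriv i 0 = 0" by (simp add: partial_deriv_def)
  then show ?thesis by (induction Y rule: infinite_finite_induct) (simp_all add: partial_deriv_add)
qed

lemma partial_deriv_mult: "partial_deriv i (p * q) = partial_deriv i p * q + p * partial_deriv i q"
proof (induction p rule: poly_induct)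
  case (single m c)
  show ?case
  proof (induction q rule: poly_induct)
    case (single m' c')
    let ?e = "single i (1::nat)"
    \<comment> \<open>Truncated subtraction of exponents goes wrong only where the exponent is zero,
      and there the coefficient of the derivative is zero as well.\<close>
    have shift: "single (n - ?e + n') (of_nat (lookup n i) * x) =
        single (n + n' - ?e) (of_nat (lookup n i) * x)" for n n' and x :: 'a
    proof (cases "lookup n i = 0")
      case False
      have "n - ?e + n' = n + n' - ?e"
        using False by (intro poly_mapping_eqI) (auto simp: lookup_add lookup_minus lookup_single when_def)
      then show ?thesis by simp
    qed simp
    have "partial_deriv i (single m c) * single m' c'
      = single (m + m' - ?e) (of_nat (lookup m i) * (c * c'))"
      unfolding partial_deriv_single mult_single mult.assoc by (rule shift)
    moreover have "single m c * partial_deriv i (single m' c')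
      = single (m + m' - ?e) (of_nat (lookup m' i) * (c * c'))"
      using shift[of m' m "c * c'"] unfolding partial_deriv_single mult_single
      by (simp only: ac_simps)
    moreover have "partial_deriv i (single m c * single m' c') =
        single (m + m' - ?e) (of_nat (lookup (m + m') i) * (c * c'))"
      by (simp only: mult_single partial_deriv_single)
    ultimately show ?case
      by (simp only: lookup_add of_nat_add distrib_right single_add)
  next
    case (add p q)
    then show ?case by (simp add: distrib_left partial_deriv_add algebra_simps)
  qed
next
  case (add p q)
  then show ?case by (simp add: distrib_right partial_deriv_add algebra_simps)
qed

lemma partial_deriv_linear_form:
  fixes l :: "'k::field poly3"
  assumes "l \<in> homog 1" shows "partial_deriv i l = cst (lcoeff l i)"
proof -
  have "partial_deriv i (cst c * var j) = (if i = j then cst c else 0)" for c :: 'k and j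
  proof (cases "i = j")
    case True
    then show ?thesis by (simp add: var_def mult_single partial_deriv_single)
  next
    case False
    then show ?thesis by (simp add: var_def mult_single partial_deriv_single lookup_single)
  qed
  then have "partial_deriv i (\<Sum>j\<in>UNIV. cst (lcoeff l j) * var j) = cst (lcoeff l i)"
    by (simp add: partial_deriv_sum)
  then show ?thesis using homog_1_decomp[OF assms] by (simp add: lcoeff_def)
qed

lemma var_mult_partial_deriv: "var i * partial_deriv i (single m c)
    = single m (of_nat (lookup m i) * c)"
proof (cases "lookup m i = 0")
  case False
  then obtain m' where "m = single i 1 + m'" using adds_single_iff[of m i 1] by auto
  then show ?thesis unfolding partial_deriv_single var_def mult_single by simp
qed (simp add: partial_deriv_single)

lemma euler_formula:
  fixes p :: "'k::field poly3"
  assumes "p \<in> homog (int d)"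
  shows "(\<Sum>i\<in>UNIV. var i * partial_deriv i p) = cst (of_nat d) * p"
proof -
  let ?h = "\<lambda>m c. single m (of_nat (mon_degree m) * c) :: 'k poly3"
  have lin: "lin_ext ?h (p + q) = lin_ext ?h p + lin_ext ?h q" for p q
    by (rule lin_ext_add) (simp_all add: single_add distrib_left)
  have "(\<Sum>i\<in>UNIV. var i * partial_deriv i p) = lin_ext ?h p"
  proof (induction p rule: poly_induct)
    case (single m c)
    have "lin_ext ?h (single m c) = ?h m c" by (rule lin_ext_single) simp
    then show ?case
      by (simp add: var_mult_partial_deriv sum3 mon_degree_def single_add distrib_right)
  next
    case (add p q)
    then show ?case by (simp add: partial_deriv_add distrib_left sum.distrib lin)
  qed
  also have "\<dots> = (\<Sum>m\<in>keys p. cst (of_nat d) * single m (lookup p m))"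
    unfolding lin_ext_def using assms by (intro sum.cong) (auto simp: homog_def mult_single simp del: single_of_nat)
  also have "\<dots> = cst (of_nat d) * p"
    unfolding sum_distrib_left[symmetric] by (simp flip: poly_sum_single)
  finally show ?thesis .
qed

lemma partial_deriv_homog:
  assumes "p \<in> homog n" shows "partial_deriv i p \<in> homog (n - 1)"
  unfolding partial_deriv_def
proof (rule homog_sum)
  fix m assume m: "m \<in> keys p"
  show "single (m - single i 1)
      (of_nat (lookup m i) * lookup p m) \<in> homog (n - 1)"
  proof (cases "lookup m i = 0")
    case False
    then obtain m' where m': "m = single i 1 + m'" using adds_single_iff[of m i 1] by auto
    have "int (mon_degree m) = n" using m assms by (auto simp: homog_def)
    then have "int (mon_degree m') = n - 1" by (simp add: m' mon_degree_add mon_degree_single)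
    then show ?thesis using homog_single[of m'] unfolding m' by simp
  qed simp
qed

subsection \<open>Ideals\<close>

lemma ideal_polyI:
  fixes I :: "'k::field poly3 set"
  assumes "0 \<in> I" "\<And>a b. a \<in> I \<Longrightarrow> b \<in> I \<Longrightarrow> a + b \<in> I" "\<And>r a. a \<in> I \<Longrightarrow> r * a \<in> I"
  shows "ideal I S_ring"
proof (rule idealI)
  show "ring (S_ring :: 'k poly3 ring)" by (rule ring_from_type_algebra)
  have group: "group (add_monoid (S_ring :: 'k poly3 ring))"
    using ring_from_type_algebra abelian_group.a_group ring.is_abelian_group by blast
  show "subgroup I (add_monoid S_ring)"
  proof (rule group.subgroupI[OF group])
    show "inv\<^bsub>add_monoid S_ring\<^esub> a \<in> I" if "a \<in> I" for a
    proof -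
      have "inv\<^bsub>add_monoid S_ring\<^esub> a = - a"
        by (rule group.inv_equality[OF group]) (simp_all add: ring_of_type_algebra_def)
      then show ?thesis using assms(3)[OF that, of "-1"] by simp
    qed
  qed (use assms in \<open>auto simp: ring_of_type_algebra_def\<close>)
qed (use assms in \<open>auto simp: ring_of_type_algebra_def mult.commute\<close>)

lemma genideal_poly:
  fixes Y :: "'k::field poly3 set"
  defines "I \<equiv> Idl\<^bsub>S_ring\<^esub> Y"
  shows "Y \<subseteq> I" "0 \<in> I" "a \<in> I \<Longrightarrow> b \<in> I \<Longrightarrow> a + b \<in> I" "a \<in> I \<Longrightarrow> r * a \<in> I"
    "ideal J S_ring \<Longrightarrow> Y \<subseteq> J \<Longrightarrow> I \<subseteq> J"
proof -
  interpret r: ring "S_ring :: 'k poly3 ring" by (rule ring_from_type_algebra)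
  interpret I: ideal I S_ring
    unfolding I_def by (rule r.genideal_ideal) (simp add: ring_of_type_algebra_def)
  show "Y \<subseteq> I" unfolding I_def by (rule r.genideal_self) (simp add: ring_of_type_algebra_def)
  show "0 \<in> I" using I.zero_closed by (simp add: ring_of_type_algebra_def)
  show "a \<in> I \<Longrightarrow> b \<in> I \<Longrightarrow> a + b \<in> I" using I.a_closed by (simp add: ring_of_type_algebra_def)
  show "a \<in> I \<Longrightarrow> r * a \<in> I" using I.I_l_closed[of a r] by (simp add: ring_of_type_algebra_def)
  show "ideal J S_ring \<Longrightarrow> Y \<subseteq> J \<Longrightarrow> I \<subseteq> J" unfolding I_def by (rule r.genideal_minimal)
qed

lemma Jac_eq: "Jac f = range (\<lambda>a. dot a (\<lambda>i. partial_deriv i f))"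
proof
  show "Jac f \<subseteq> range (\<lambda>a. dot a (\<lambda>i. partial_deriv i f))"
    unfolding Jac_def
  proof (rule genideal_poly(5)[OF ideal_polyI])
    show "0 \<in> range (\<lambda>a. dot a (\<lambda>i. partial_deriv i f))"
      by (rule range_eqI[of _ _ "\<lambda>_. 0"]) (simp add: dot_def)
    fix a b assume "a \<in> range (\<lambda>a. dot a (\<lambda>i. partial_deriv i f))" "b \<in> range (\<lambda>a. dot a (\<lambda>i. partial_deriv i f))"
    then obtain u v where uv: "a = dot u (\<lambda>i. partial_deriv i f)" "b = dot v (\<lambda>i. partial_deriv i f)" by auto
    show "a + b \<in> range (\<lambda>a. dot a (\<lambda>i. partial_deriv i f))"
      by (rule range_eqI[of _ _ "\<lambda>i. u i + v i"]) (simp add: uv dot_def algebra_simps)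
  next
    fix r a assume "a \<in> range (\<lambda>a. dot a (\<lambda>i. partial_deriv i f))"
    then obtain u where u: "a = dot u (\<lambda>i. partial_deriv i f)" by auto
    show "r * a \<in> range (\<lambda>a. dot a (\<lambda>i. partial_deriv i f))"
      by (rule range_eqI[of _ _ "\<lambda>i. r * u i"]) (simp add: u dot_def algebra_simps)
  next
    have "\<forall>i. partial_deriv i f = dot (unit3 i) (\<lambda>i. partial_deriv i f)"
      unfolding forall3 by (simp add: dot_def unit3_def)
    then show "range (\<lambda>i. partial_deriv i f) \<subseteq> range (\<lambda>a. dot a (\<lambda>i. partial_deriv i f))" by blast
  qed
  show "range (\<lambda>a. dot a (\<lambda>i. partial_deriv i f)) \<subseteq> Jac f"
    unfolding Jac_def dot_def
    using genideal_poly(1)[of "range (\<lambda>i. partial_deriv i f)"]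
    by (auto intro!: genideal_poly(3,4))
qed

text \<open>Every nonconstant monomial contains a variable. Membership becomes a condition on one
  coefficient, and minimality of a differential a condition on constant terms.\<close>

lemma irrelevant_ideal_eq: "irrelevant_ideal = {p. lookup p 0 = 0}"
proof
  show "irrelevant_ideal \<subseteq> {p. lookup p 0 = 0}"
    unfolding irrelevant_ideal_def
  proof (rule genideal_poly(5)[OF ideal_polyI])
    have "lookup (var i) 0 = 0" for i
      using homog_lookup_0[OF homog_var] by simp
    then show "range var \<subseteq> {p. lookup p 0 = 0}" by auto
  qed (simp_all add: lookup_add lookup_mult_0)
  show "{p. lookup p 0 = 0} \<subseteq> (irrelevant_ideal :: 'a poly3 set)"
  proof
    fix p :: "'a poly3" assume p: "p \<in> {p. lookup p 0 = 0}"
    have sum: "sum g Y \<in> irrelevant_ideal" if "\<And>y. y \<in> Y \<Longrightarrow> g y \<in> irrelevant_ideal" for g and Y :: "(3 \<Rightarrow>\<^sub>0 nat) set"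
      using that by (induction Y rule: infinite_finite_induct)
        (auto simp: irrelevant_ideal_def intro: genideal_poly(2,3))
    have "(\<Sum>m\<in>keys p. single m (lookup p m)) \<in> irrelevant_ideal"
    proof (rule sum)
      fix m assume "m \<in> keys p"
      then have "m \<noteq> 0" using p by auto
      have "\<exists>i. 1 \<le> lookup m i"
      proof (rule ccontr)
        assume "\<nexists>i. 1 \<le> lookup m i"
        then have "lookup m i = 0" for i by (simp add: not_le)
        then show False using \<open>m \<noteq> 0\<close> by (simp add: poly_mapping_eq_iff fun_eq_iff)
      qed
      then obtain i m' where m': "m = single i 1 + m'"
        unfolding adds_single_iff[symmetric] by blast
      have "var i \<in> irrelevant_ideal"
        unfolding irrelevant_ideal_def by (rule subsetD[OF genideal_poly(1) rangeI])
      then have "single m' (lookup p m) * var i \<in> irrelevant_ideal"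
        unfolding irrelevant_ideal_def by (rule genideal_poly(4))
      then show "single m (lookup p m) \<in> irrelevant_ideal"
        unfolding var_def mult_single m' by (simp add: add.commute)
    qed
    then show "p \<in> irrelevant_ideal" by (simp flip: poly_sum_single)
  qed
qed

lemma var_power_in_ideal_power: "var i ^ k \<in> ideal_power irrelevant_ideal k"
proof (induction k)
  case (Suc k)
  have "var i \<in> irrelevant_ideal"
    unfolding irrelevant_ideal_def by (rule subsetD[OF genideal_poly(1) rangeI])
  from ideal_prod.prod[OF this Suc, of S_ring] show ?case by (simp add: ring_of_type_algebra_def)
qed simp

text \<open>Of the power of the irrelevant ideal only the pure powers are kept; they form the
  regular triple of the Koszul chases.\<close>

lemma saturation_var_power:
  "g \<in> saturation I \<Longrightarrow> \<exists>k. \<forall>i. var i ^ k * g \<in> I"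
  unfolding saturation_def using var_power_in_ideal_power by blast

text \<open>\<open>om_extends\<close> works with a single triple \<open>y\<close> for all generators
  \<open>h t\<close>, hence with one exponent for all of them.\<close>

lemma saturation_common_power:
  assumes "finite T" "\<And>t. t \<in> T \<Longrightarrow> h t \<in> saturation (Jac f)"
  shows "\<exists>k. \<forall>t\<in>T. \<forall>i. var i ^ k * h t \<in> Jac f"
  using assms
proof (induction T)
  case (insert t T)
  obtain k where k: "\<forall>s\<in>T. \<forall>i. var i ^ k * h s \<in> Jac f" using insert by auto
  obtain k' where k': "\<forall>i. var i ^ k' * h t \<in> Jac f" using saturation_var_power insert by blast
  have mult: "p * a \<in> Jac f" if "a \<in> Jac f" for a p
    using that unfolding Jac_def by (rule genideal_poly(4))
  have "var i ^ (k + k') * h s \<in> Jac f" if "s \<in> insert t T" for s i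
  proof (cases "s = t")
    case True
    have "var i ^ k * (var i ^ k' * h t) \<in> Jac f" using k' mult by blast
    then show ?thesis using True by (simp add: power_add mult.assoc)
  next
    case False
    have "var i ^ k' * (var i ^ k * h s) \<in> Jac f" using k that False mult by blast
    then show ?thesis by (simp add: power_add mult.assoc mult.left_commute)
  qed
  then show ?case by blast
qed simp

lemma Jac_subset_saturation: "Jac f \<subseteq> saturation (Jac f)"
proof
  fix g assume g: "g \<in> Jac f"
  have "\<forall>h\<in>ideal_power irrelevant_ideal 0. h * g \<in> Jac f"
    using g unfolding Jac_def by (auto intro: genideal_poly(4))
  then show "g \<in> saturation (Jac f)" unfolding saturation_def by blast
qed


subsection \<open>Products of distinct linear forms\<close>

lemma homog_dvd_low_degree:
  assumes "p \<in> homog j" "g \<in> homog n" "p dvd g" "n < j" shows "g = 0"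
proof -
  obtain r where r: "g = p * r" using assms(3) by (rule dvdE)
  have "hproj n g = p * hproj (n - j) r" unfolding r by (rule hproj_mult[OF assms(1)])
  moreover have "hproj (n - j) r = 0" by (rule homog_neg[OF hproj_homog]) (use assms(4) in simp)
  ultimately show ?thesis using hproj_of_homog[OF assms(2), of n] by simp
qed

lemma elim_homog:
  assumes l: "l \<in> homog 1" and p: "p \<in> homog n" shows "elim l k p \<in> homog n"
proof -
  have v: "(if i = k then var k - cst (1 / lcoeff l k) * l else var i) \<in> homog 1" (is "?g i \<in> _") for i
  proof -
    have "cst (1 / lcoeff l k) * l \<in> homog 1" using homog_mult'[OF homog_cst l] by simp
    then show ?thesis by (simp add: homog_diff homog_var)
  qed
  have pow: "?g i ^ e \<in> homog (int e)" for i e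
  proof (induction e)
    case (Suc e)
    show ?case unfolding power_Suc by (rule homog_mult'[OF v Suc]) simp
  qed (simp add: homog_1)
  show ?thesis
    unfolding elim_def subst_def lin_ext_def prod3
  proof (rule homog_sum)
    fix m assume "m \<in> keys p"
    then have n: "0 + ((int (lookup m 0) + int (lookup m 1)) + int (lookup m 2)) = n"
      using p by (auto simp: homog_def mon_degree_def sum3)
    show "cst (lookup p m) * (?g 0 ^ lookup m 0 * ?g 1 ^ lookup m 1 * ?g 2 ^ lookup m 2) \<in> homog n"
      by (rule homog_mult'[OF homog_cst homog_mult[OF homog_mult[OF pow pow] pow] n])
  qed
qed

lemma linear_form_var: "linear_form (var i)"
  by (simp add: linear_form_def homog_var var_nonzero)

lemma linear_form_dvd_power:
  assumes "linear_form l" "l dvd p ^ k" shows "l dvd p"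
  using linear_form_prime_prod[OF assms(1), of "{..<k}" "\<lambda>_. p"] assms(2) by simp

text \<open>Such a form would divide both variables and so be proportional to each of them.\<close>

lemma linear_form_dvd_two_vars:
  assumes "linear_form q" "i \<noteq> j" shows "\<not> (q dvd var i ^ k \<and> q dvd var j ^ k)"
proof
  assume "q dvd var i ^ k \<and> q dvd var j ^ k"
  then have q: "q dvd var i" "q dvd var j" using linear_form_dvd_power[OF assms(1)] by blast+
  obtain c where c: "c \<noteq> 0" "var i = cst c * q" using dvd_linear_form[OF assms(1) linear_form_var q(1)] .
  obtain c' where c': "c' \<noteq> 0" "var j = cst c' * q" using dvd_linear_form[OF assms(1) linear_form_var q(2)] .
  let ?e = "single i (1::nat)"
  have "lookup (var i) ?e = c * lookup q ?e" unfolding c(2) by (rule lookup_cst_mult)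
  then have "c * lookup q ?e = 1" by (simp add: var_def)
  then have "lookup q ?e \<noteq> 0" by auto
  moreover have "lookup (var j) ?e = c' * lookup q ?e" unfolding c'(2) by (rule lookup_cst_mult)
  moreover have "single j (1::nat) \<noteq> ?e"
    using assms(2) by (metis lookup_single_eq lookup_single_not_eq zero_neq_one)
  ultimately show False using c'(1) by (simp add: var_def lookup_single_not_eq)
qed

text \<open>With f = l g and f_i = e g + l p this is the reduction of d f a_i = h f_i modulo the
  factor l.\<close>

lemma reduce_mod_factor:
  fixes d :: "'a::comm_ring_1"
  assumes "d * (l * g) * a = h * (e * g + l * p)" shows "h * e * g = l * (d * g * a - h * p)"
  using assms by (simp add: algebra_simps)

text \<open>\<open>not_dvd\<close> expresses distinctness of the lines through their forms.
  Characteristic zero and a nonempty \<open>A\<close> make the factor \<open>card A\<close> in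
  Euler's formula invertible.\<close>

locale distinct_lines =
  fixes A :: "'x set" and l :: "'x \<Rightarrow> 'k::field_char_0 poly3" and f :: "'k poly3" and fd :: "3 \<Rightarrow> 'k poly3"
  assumes finite_A: "finite A" and A_nonempty: "A \<noteq> {}"
    and linear: "x \<in> A \<Longrightarrow> linear_form (l x)"
    and not_dvd: "x \<in> A \<Longrightarrow> y \<in> A \<Longrightarrow> x \<noteq> y \<Longrightarrow> \<not> l x dvd l y"
  defines "f \<equiv> prod l A" and "fd \<equiv> \<lambda>i. partial_deriv i f"
begin

lemma l_homog: "x \<in> A \<Longrightarrow> l x \<in> homog 1" and l_nonzero: "x \<in> A \<Longrightarrow> l x \<noteq> 0"
  using linear by (auto simp: linear_form_def)

lemma f_homog: "f \<in> homog (int (card A))"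
  unfolding f_def using l_homog by (rule homog_prod)

lemma f_nonzero: "f \<noteq> 0"
  unfolding f_def using finite_A l_nonzero by auto

lemma fd_homog: "fd i \<in> homog (int (card A) - 1)"
  unfolding fd_def by (rule partial_deriv_homog[OF f_homog])

lemma euler: "(\<Sum>i\<in>UNIV. var i * fd i) = cst (of_nat (card A)) * f"
  unfolding fd_def by (rule euler_formula[OF f_homog])

lemma cst_card_nonzero: "cst (of_nat (card A)) \<noteq> (0 :: 'k poly3)"
proof -
  have "(of_nat (card A) :: 'k) \<noteq> 0" using finite_A A_nonempty by simp
  then show ?thesis by (metis lookup_single_eq lookup_zero)
qed

lemma fd_nonzero: "\<exists>i. fd i \<noteq> 0"
proof (rule ccontr)
  assume "\<nexists>i. fd i \<noteq> 0"
  then have "cst (of_nat (card A)) * f = 0" unfolding euler[symmetric] by simp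
  then show False using f_nonzero cst_card_nonzero by simp
qed

text \<open>The Leibniz rule. Modulo the form of one line the gradient is a constant vector times
  the product of the other forms.\<close>

lemma fd_mod_line:
  assumes "x \<in> A" shows "fd i = cst (lcoeff (l x) i) * prod l (A - {x}) + l x * partial_deriv i (prod l (A - {x}))"
  using assms finite_A
  by (simp add: fd_def f_def prod.remove[of A x] partial_deriv_mult partial_deriv_linear_form l_homog)

lemma not_dvd_rest: "x \<in> A \<Longrightarrow> \<not> l x dvd prod l (A - {x})"
  using linear_form_prime_prod[OF linear, of x "A - {x}" l] finite_A not_dvd by blast

text \<open>By Euler's formula \<open>d f a\<^sub>i = h f\<^sub>i\<close> with \<open>h = \<Sum> x\<^sub>j a\<^sub>j\<close>, and reducing this modulo each of the
  lines shows that \<open>f\<close> divides \<open>h\<close>.\<close>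

lemma fd_parallel:
  assumes "\<And>i j. a i * fd j = a j * fd i" shows "\<exists>w. \<forall>i. a i = w * fd i"
proof -
  let ?d = "of_nat (card A) :: 'k"
  define h where "h = (\<Sum>j\<in>UNIV. var j * a j)"
  have eq: "cst ?d * f * a i = h * fd i" for i
  proof -
    have "(\<Sum>j\<in>UNIV. var j * fd j) * a i = (\<Sum>j\<in>UNIV. var j * (a i * fd j))"
      unfolding sum_distrib_right by (intro sum.cong) (simp_all add: ac_simps)
    also have "\<dots> = (\<Sum>j\<in>UNIV. var j * (a j * fd i))" by (simp only: assms[of i])
    also have "\<dots> = h * fd i" unfolding h_def by (simp add: sum_distrib_right mult.assoc)
    finally show ?thesis unfolding euler .
  qed
  have "l x dvd h" if x: "x \<in> A" for x
  proof -
    obtain i where i: "lcoeff (l x) i \<noteq> 0" using linear_form_coeff[OF linear[OF x]] by blast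
    define g where "g = prod l (A - {x})"
    have f': "f = l x * g" unfolding f_def g_def using x finite_A by (simp add: prod.remove)
    have fdi: "fd i = cst (lcoeff (l x) i) * g + l x * partial_deriv i g"
      unfolding g_def by (rule fd_mod_line[OF x])
    have "cst ?d * (l x * g) * a i = cst ?d * f * a i" by (rule arg_cong[OF f'[symmetric], of "\<lambda>z. cst ?d * z * a i"])
    also have "\<dots> = h * fd i" by (rule eq)
    also have "\<dots> = h * (cst (lcoeff (l x) i) * g + l x * partial_deriv i g)" by (rule arg_cong[OF fdi])
    finally have "cst ?d * (l x * g) * a i = h * (cst (lcoeff (l x) i) * g + l x * partial_deriv i g)" .
    then have "h * cst (lcoeff (l x) i) * g = l x * (cst ?d * g * a i - h * partial_deriv i g)"
      by (rule reduce_mod_factor)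
    then have "l x dvd h * cst (lcoeff (l x) i) * g" by (rule dvdI)
    then have "l x dvd h * cst (lcoeff (l x) i)"
      using linear_form_prime[OF linear[OF x]] not_dvd_rest[OF x] unfolding g_def by blast
    then have "l x dvd h * cst (lcoeff (l x) i) * cst (1 / lcoeff (l x) i)" by (rule dvd_mult2)
    moreover have "cst (lcoeff (l x) i) * cst (1 / lcoeff (l x) i) = 1"
      using i by (simp add: mult_single)
    ultimately show ?thesis by (simp add: mult.assoc)
  qed
  then have "f dvd h" unfolding f_def by (intro prod_linear_forms_dvd finite_A linear not_dvd)
  then obtain r where r: "h = f * r" by (rule dvdE)
  have "a i = (cst (1 / ?d) * r) * fd i" for i
  proof -
    have "f * (cst ?d * a i) = f * (r * fd i)" using eq[of i] unfolding r by (simp add: ac_simps)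
    then have "cst ?d * a i = r * fd i" using f_nonzero by simp
    then have "cst (1 / ?d) * (cst ?d * a i) = cst (1 / ?d) * (r * fd i)" by (rule arg_cong)
    then have "cst (1 / ?d) * cst ?d * a i = cst (1 / ?d) * r * fd i" by (simp only: mult.assoc)
    moreover have "cst (1 / ?d) * cst ?d = 1"
      using finite_A A_nonempty unfolding mult_single by simp
    ultimately show ?thesis by (simp only: mult_1_left)
  qed
  then show ?thesis by blast
qed

sublocale syzygies fd
  using fd_nonzero fd_parallel by unfold_locales auto

lemma Jac_eq_dot: "Jac f = range (\<lambda>a. dot a fd)"
  unfolding fd_def by (rule Jac_eq)

text \<open>Modulo the line \<open>l x\<close> the Jacobian ideal is generated by the product of the other lines, which
  has degree \<open>d - 1\<close>.\<close>

lemma saturation_low_degree: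
  assumes g: "g \<in> saturation (Jac f)" "g \<in> homog n" and n: "n < int (card A) - 1"
  shows "g = 0"
proof -
  obtain e where e: "\<And>i. var i ^ e * g \<in> Jac f" using saturation_var_power[OF g(1)] by blast
  have "l x dvd g" if x: "x \<in> A" for x
  proof -
    obtain k where k: "lcoeff (l x) k \<noteq> 0" using linear_form_coeff[OF linear[OF x]] by blast
    define \<sigma> where "\<sigma> = elim (l x) k"
    have \<sigma>_mult: "\<sigma> (p * q) = \<sigma> p * \<sigma> q" and \<sigma>_add: "\<sigma> (p + q) = \<sigma> p + \<sigma> q"
      and \<sigma>_power: "\<sigma> (p ^ j) = \<sigma> p ^ j" and \<sigma>_prod: "\<sigma> (prod g' Y) = (\<Prod>y\<in>Y. \<sigma> (g' y))"
      for p q j g' and Y :: "'x set"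
      unfolding \<sigma>_def elim_def by (rule subst_mult subst_add subst_power subst_prod)+
    have \<sigma>_l: "\<sigma> (l x) = 0" unfolding \<sigma>_def by (rule elim_self[OF linear[OF x] k])
    have \<sigma>_var: "\<sigma> (var i) = var i" if "i \<noteq> k" for i unfolding \<sigma>_def elim_var using that by simp
    \<comment> \<open>The other forms restricted to the line of \<open>x\<close>. Factors can be
      proportional, when two lines meet it in the same point.\<close>
    let ?Q = "\<Prod>y\<in>A - {x}. \<sigma> (l y)"
    have \<sigma>_fd: "?Q dvd \<sigma> (fd i)" for i
      unfolding fd_mod_line[OF x, of i] by (simp add: \<sigma>_add \<sigma>_mult \<sigma>_l \<sigma>_prod)
    have dvd: "?Q dvd var i ^ e * \<sigma> g" if "i \<noteq> k" for i
    proof -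
      obtain a where a: "var i ^ e * g = dot a fd" using e[of i] unfolding Jac_eq_dot by blast
      have "var i ^ e * \<sigma> g = \<sigma> (var i ^ e * g)" using that by (simp add: \<sigma>_mult \<sigma>_power \<sigma>_var)
      also have "\<dots> = \<sigma> (a 0) * \<sigma> (fd 0) + \<sigma> (a 1) * \<sigma> (fd 1) + \<sigma> (a 2) * \<sigma> (fd 2)"
        unfolding a dot_def by (simp only: \<sigma>_mult \<sigma>_add)
      also have "?Q dvd \<dots>" by (intro dvd_add dvd_mult \<sigma>_fd)
      finally show ?thesis .
    qed
    \<comment> \<open>Variables other than \<open>k\<close> are fixed by the elimination, and no
      linear form divides powers of two of them; so these powers can be removed from the
      divisibilities.\<close>
    obtain i j where ij: "i \<noteq> k" "j \<noteq> k" "i \<noteq> j"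
    proof -
      have "(1::3) \<noteq> 0 \<and> (2::3) \<noteq> 0 \<and> (2::3) \<noteq> 1" by simp
      have "\<forall>k::3. \<exists>i j. i \<noteq> k \<and> j \<noteq> k \<and> i \<noteq> j"
        unfolding forall3 using \<open>(1::3) \<noteq> 0 \<and> (2::3) \<noteq> 0 \<and> (2::3) \<noteq> 1\<close> by metis
      then show thesis using that by blast
    qed
    \<comment> \<open>The restriction is nonzero because \<open>l x\<close> does not divide
      \<open>l y\<close>.\<close>
    have lin: "linear_form (\<sigma> (l y))" if "y \<in> A - {x}" for y
      using that elim_homog[OF l_homog[OF x] l_homog, of y k] not_dvd[of x y] x
        linear_form_dvd_iff[OF linear[OF x] k, of "l y"]
      unfolding \<sigma>_def linear_form_def by auto
    have "?Q dvd \<sigma> g"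
      by (rule prod_linear_forms_dvd_common[OF _ lin linear_form_dvd_two_vars[OF lin ij(3)] dvd[OF ij(1)] dvd[OF ij(2)]])
        (use finite_A in auto)
    moreover have "?Q \<in> homog (int (card (A - {x})))"
      using lin by (intro homog_prod) (auto simp: linear_form_def)
    moreover have "\<sigma> g \<in> homog n" unfolding \<sigma>_def by (rule elim_homog[OF l_homog[OF x] g(2)])
    moreover have "n < int (card (A - {x}))" using n x finite_A A_nonempty
      by (simp add: card_gt_0_iff of_nat_diff Suc_leI)
    ultimately have "\<sigma> g = 0" by (intro homog_dvd_low_degree)
    then show ?thesis using linear_form_dvd_iff[OF linear[OF x] k] unfolding \<sigma>_def by blast
  qed
  then have "f dvd g" unfolding f_def by (intro prod_linear_forms_dvd finite_A linear not_dvd)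
  then show ?thesis using homog_dvd_low_degree[OF f_homog g(2)] n by simp
qed

end


section \<open>Coordinates of graded free modules\<close>

lemma cring_S: "cring (S_ring :: 'k::field poly3 ring)"
  by (rule cring_from_type_algebra)

lemma S_ring_simps [simp]:
  "carrier S_ring = UNIV" "p \<otimes>\<^bsub>S_ring\<^esub> q = p * q" "\<one>\<^bsub>S_ring\<^esub> = 1" "\<zero>\<^bsub>S_ring\<^esub> = 0" "p \<oplus>\<^bsub>S_ring\<^esub> q = p + q"
  by (simp_all add: ring_of_type_algebra_def)

text \<open>Additive projections give existence of the homogeneous decomposition directly, and
  uniqueness because \<open>pr\<close> applied to any other decomposition returns its
  components.\<close>

lemma graded_moduleI:
  fixes N :: "('k::field poly3, 'm) gmodule" and pr :: "int \<Rightarrow> 'm \<Rightarrow> 'm"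
  assumes N: "module S_ring N"
    and sub: "\<And>n. hcomp N n \<subseteq> carrier N"
    and zero: "\<And>n. \<zero>\<^bsub>N\<^esub> \<in> hcomp N n"
    and add: "\<And>n x y. x \<in> hcomp N n \<Longrightarrow> y \<in> hcomp N n \<Longrightarrow> x \<oplus>\<^bsub>N\<^esub> y \<in> hcomp N n"
    and smult: "\<And>i j p x. p \<in> homog i \<Longrightarrow> x \<in> hcomp N j \<Longrightarrow> p \<odot>\<^bsub>N\<^esub> x \<in> hcomp N (i + j)"
    and pr: "\<And>n x. x \<in> carrier N \<Longrightarrow> pr n x \<in> hcomp N n"
    and fin: "\<And>x. x \<in> carrier N \<Longrightarrow> finite {n. pr n x \<noteq> \<zero>\<^bsub>N\<^esub>}"
    and decomp: "\<And>x. x \<in> carrier N \<Longrightarrow> x = finsum N (\<lambda>n. pr n x) {n. pr n x \<noteq> \<zero>\<^bsub>N\<^esub>}"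
    and pr_add: "\<And>n x y. x \<in> carrier N \<Longrightarrow> y \<in> carrier N \<Longrightarrow> pr n (x \<oplus>\<^bsub>N\<^esub> y) = pr n x \<oplus>\<^bsub>N\<^esub> pr n y"
    and pr_hcomp: "\<And>n m x. x \<in> hcomp N m \<Longrightarrow> pr n x = (if n = m then x else \<zero>\<^bsub>N\<^esub>)"
  shows "graded_module N"
proof -
  interpret m: module S_ring N by (rule N)
  have "additive_subgroup (hcomp N n) N" for n
  proof (rule additive_subgroupI, rule group.subgroupI[OF m.M.a_group])
    show "hcomp N n \<noteq> {}" using zero by blast
    fix x assume x: "x \<in> hcomp N n"
    then have xc: "x \<in> carrier N" using sub by blast
    have "(-1) \<odot>\<^bsub>N\<^esub> x \<oplus>\<^bsub>N\<^esub> x = \<zero>\<^bsub>N\<^esub>"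
      using m.smult_l_distr[of "-1" 1 x] m.smult_l_null[OF xc] m.smult_one[OF xc] xc by simp
    then have "inv\<^bsub>add_monoid N\<^esub> x = (-1) \<odot>\<^bsub>N\<^esub> x"
      by (intro group.inv_equality[OF m.M.a_group]) (use xc m.smult_closed[of "-1" x] in simp_all)
    moreover have "(-1) \<odot>\<^bsub>N\<^esub> x \<in> hcomp N (0 + n)"
      by (rule smult[OF homog_uminus[OF homog_1] x])
    ultimately show "inv\<^bsub>add_monoid N\<^esub> x \<in> hcomp N n" by simp
  qed (use sub add in auto)
  moreover have "\<exists>!y. (\<forall>n. y n \<in> hcomp N n) \<and> finite {n. y n \<noteq> \<zero>\<^bsub>N\<^esub>} \<and> x = finsum N y {n. y n \<noteq> \<zero>\<^bsub>N\<^esub>}"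
    if x: "x \<in> carrier N" for x
  proof (rule ex1I[of _ "\<lambda>n. pr n x"])
    show "(\<forall>n. pr n x \<in> hcomp N n) \<and> finite {n. pr n x \<noteq> \<zero>\<^bsub>N\<^esub>} \<and> x = finsum N (\<lambda>n. pr n x) {n. pr n x \<noteq> \<zero>\<^bsub>N\<^esub>}"
      using pr[OF x] fin[OF x] decomp[OF x] by blast
    fix z assume z: "(\<forall>n. z n \<in> hcomp N n) \<and> finite {n. z n \<noteq> \<zero>\<^bsub>N\<^esub>} \<and> x = finsum N z {n. z n \<noteq> \<zero>\<^bsub>N\<^esub>}"
    have zc: "z n \<in> carrier N" "z n \<in> hcomp N n" for n using z sub by blast+
    have "pr m (finsum N z E) = (if m \<in> E then z m else \<zero>\<^bsub>N\<^esub>)" if "finite E" for m E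
      using that
    proof (induction E)
      case empty
      then show ?case using pr_hcomp[OF zero, of m m] by simp
    next
      case (insert e E)
      have "pr m (z e \<oplus>\<^bsub>N\<^esub> finsum N z E) = pr m (z e) \<oplus>\<^bsub>N\<^esub> pr m (finsum N z E)"
        by (rule pr_add) (use zc in auto)
      moreover have "finsum N z (insert e E) = z e \<oplus>\<^bsub>N\<^esub> finsum N z E"
        using insert.hyps zc by (intro m.M.finsum_insert) auto
      ultimately show ?case using insert pr_hcomp[OF zc(2)[of e], of m] zc by auto
    qed
    from this[of "{n. z n \<noteq> \<zero>\<^bsub>N\<^esub>}"] have "pr m x = z m" for m using z by auto
    then show "z = (\<lambda>n. pr n x)" by auto
  qed
  ultimately show ?thesis unfolding graded_module_def using N smult by blast
qed

text \<open>A homogeneous basis in terms of its coordinate functions: the basis element with index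
  \<open>i\<close> has degree \<open>- a i\<close>. Carrier and index types stay arbitrary, so that
  powers of S, sums, twists and duals are all handled by the same lemmas.\<close>

locale graded_coords =
  fixes N :: "('k::field poly3, 'm) gmodule" and I :: "'i set" and a :: "'i \<Rightarrow> int" and c :: "'m \<Rightarrow> 'i \<Rightarrow> 'k poly3"
  assumes finite_I: "finite I"
    and coords_inj: "\<And>x y. x \<in> carrier N \<Longrightarrow> y \<in> carrier N \<Longrightarrow> (\<And>i. i \<in> I \<Longrightarrow> c x i = c y i) \<Longrightarrow> x = y"
    and coords_surj: "\<And>v. \<exists>x\<in>carrier N. \<forall>i\<in>I. c x i = v i"
    and add_closed: "\<And>x y. x \<in> carrier N \<Longrightarrow> y \<in> carrier N \<Longrightarrow> x \<oplus>\<^bsub>N\<^esub> y \<in> carrier N"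
    and coords_add: "\<And>x y i. x \<in> carrier N \<Longrightarrow> y \<in> carrier N \<Longrightarrow> i \<in> I \<Longrightarrow> c (x \<oplus>\<^bsub>N\<^esub> y) i = c x i + c y i"
    and smult_closed: "\<And>p x. x \<in> carrier N \<Longrightarrow> p \<odot>\<^bsub>N\<^esub> x \<in> carrier N"
    and coords_smult: "\<And>p x i. x \<in> carrier N \<Longrightarrow> i \<in> I \<Longrightarrow> c (p \<odot>\<^bsub>N\<^esub> x) i = p * c x i"
    and zero_closed: "\<zero>\<^bsub>N\<^esub> \<in> carrier N"
    and coords_zero: "\<And>i. i \<in> I \<Longrightarrow> c \<zero>\<^bsub>N\<^esub> i = 0"
    and hcomp_eq: "\<And>n. hcomp N n = {x \<in> carrier N. \<forall>i\<in>I. c x i \<in> homog (n + a i)}"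
begin

definition elt :: "('i \<Rightarrow> 'k poly3) \<Rightarrow> 'm" where
  "elt v = (SOME x. x \<in> carrier N \<and> (\<forall>i\<in>I. c x i = v i))"

lemma elt_closed: "elt v \<in> carrier N" and coords_elt: "i \<in> I \<Longrightarrow> c (elt v) i = v i"
proof -
  have "\<exists>x. x \<in> carrier N \<and> (\<forall>i\<in>I. c x i = v i)" using coords_surj[of v] by blast
  from someI_ex[OF this] show "elt v \<in> carrier N" "i \<in> I \<Longrightarrow> c (elt v) i = v i"
    unfolding elt_def by auto
qed

lemmas closed = add_closed smult_closed zero_closed elt_closed
lemmas coords = coords_add coords_smult coords_zero coords_elt

lemma elt_eqI: "x \<in> carrier N \<Longrightarrow> (\<And>i. i \<in> I \<Longrightarrow> v i = c x i) \<Longrightarrow> elt v = x"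
  by (rule coords_inj) (simp_all add: closed coords)

lemma abelian_group_N: "abelian_group N"
proof (rule abelian_groupI)
  fix x assume x: "x \<in> carrier N"
  show "\<exists>y\<in>carrier N. y \<oplus>\<^bsub>N\<^esub> x = \<zero>\<^bsub>N\<^esub>"
  proof (intro bexI[of _ "(-1) \<odot>\<^bsub>N\<^esub> x"])
    show "(-1) \<odot>\<^bsub>N\<^esub> x \<oplus>\<^bsub>N\<^esub> x = \<zero>\<^bsub>N\<^esub>" by (rule coords_inj) (simp_all add: x closed coords)
  qed (simp add: x closed)
  show "\<zero>\<^bsub>N\<^esub> \<oplus>\<^bsub>N\<^esub> x = x" by (rule coords_inj) (simp_all add: x closed coords)
  fix y assume y: "y \<in> carrier N"
  show "x \<oplus>\<^bsub>N\<^esub> y = y \<oplus>\<^bsub>N\<^esub> x" by (rule coords_inj) (simp_all add: x y closed coords ac_simps)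
  fix z assume z: "z \<in> carrier N"
  show "x \<oplus>\<^bsub>N\<^esub> y \<oplus>\<^bsub>N\<^esub> z = x \<oplus>\<^bsub>N\<^esub> (y \<oplus>\<^bsub>N\<^esub> z)"
    by (rule coords_inj) (simp_all add: x y z closed coords ac_simps)
qed (auto simp: closed)

lemma module_N: "module S_ring N"
proof (rule moduleI[OF cring_S abelian_group_N])
  fix p q :: "'k poly3" and x y assume *: "x \<in> carrier N"
  show "(p \<oplus>\<^bsub>S_ring\<^esub> q) \<odot>\<^bsub>N\<^esub> x = p \<odot>\<^bsub>N\<^esub> x \<oplus>\<^bsub>N\<^esub> q \<odot>\<^bsub>N\<^esub> x"
    by (rule coords_inj) (simp_all add: * closed coords distrib_right)
  show "(p \<otimes>\<^bsub>S_ring\<^esub> q) \<odot>\<^bsub>N\<^esub> x = p \<odot>\<^bsub>N\<^esub> (q \<odot>\<^bsub>N\<^esub> x)"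
    by (rule coords_inj) (simp_all add: * closed coords ac_simps)
  show "\<one>\<^bsub>S_ring\<^esub> \<odot>\<^bsub>N\<^esub> x = x"
    by (rule coords_inj) (simp_all add: * closed coords)
  assume y: "y \<in> carrier N"
  show "p \<odot>\<^bsub>N\<^esub> (x \<oplus>\<^bsub>N\<^esub> y) = p \<odot>\<^bsub>N\<^esub> x \<oplus>\<^bsub>N\<^esub> p \<odot>\<^bsub>N\<^esub> y"
    by (rule coords_inj) (simp_all add: * y closed coords distrib_left)
qed (simp add: closed)

lemma finsum_in_carrier:
  assumes "finite D" "\<And>n. n \<in> D \<Longrightarrow> y n \<in> carrier N"
  shows "finsum N y D \<in> carrier N"
proof -
  interpret abelian_group N by (rule abelian_group_N)
  show ?thesis using assms by (intro finsum_closed) auto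
qed

lemma coords_finsum:
  assumes "finite D" "\<And>n. n \<in> D \<Longrightarrow> y n \<in> carrier N" "i \<in> I"
  shows "c (finsum N y D) i = (\<Sum>n\<in>D. c (y n) i)"
proof -
  interpret abelian_group N by (rule abelian_group_N)
  from assms(1,2) show ?thesis
  proof (induction D)
    case empty
    then show ?case using assms(3) by (simp add: coords)
  next
    case (insert d D)
    have "c (y d \<oplus>\<^bsub>N\<^esub> finsum N y D) i = c (y d) i + c (finsum N y D) i"
      using insert.prems insert.hyps by (intro coords_add assms(3) finsum_in_carrier) auto
    then show ?case using insert by (simp add: Pi_def)
  qed
qed

lemma graded_module_N: "graded_module N"
proof (rule graded_moduleI[OF module_N])
  let ?pr = "\<lambda>n x. elt (\<lambda>i. hproj (n + a i) (c x i))"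
  show "p \<odot>\<^bsub>N\<^esub> x \<in> hcomp N (i + j)" if "p \<in> homog i" "x \<in> hcomp N j" for i j p x
    using that by (auto simp: hcomp_eq closed coords add.assoc intro!: homog_mult)
  show "?pr n (x \<oplus>\<^bsub>N\<^esub> y) = ?pr n x \<oplus>\<^bsub>N\<^esub> ?pr n y" if "x \<in> carrier N" "y \<in> carrier N" for n x y
    using that by (intro elt_eqI) (simp_all add: closed coords hproj_add)
  show "?pr n x = (if n = m then x else \<zero>\<^bsub>N\<^esub>)" if x: "x \<in> hcomp N m" for n m x
  proof (rule elt_eqI)
    show "hproj (n + a i) (c x i) = c (if n = m then x else \<zero>\<^bsub>N\<^esub>) i" if "i \<in> I" for i
      using x that hproj_of_homog[of "c x i" "m + a i" "n + a i"] by (auto simp: hcomp_eq coords)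
  qed (use x in \<open>auto simp: hcomp_eq closed\<close>)
  fix x assume x: "x \<in> carrier N"
  define y where "y = (\<lambda>n. ?pr n x)"
  define D where "D = {n. y n \<noteq> \<zero>\<^bsub>N\<^esub>}"
  have y: "y n \<in> carrier N" "i \<in> I \<Longrightarrow> c (y n) i = hproj (n + a i) (c x i)" for n i
    unfolding y_def by (simp_all add: closed coords)
  \<comment> \<open>A component can be nonzero only in degrees that occur in some coordinate,
    shifted by the degree of the basis element.\<close>
  define D' where "D' = (\<Union>i\<in>I. (\<lambda>e. e - a i) ` degs (c x i))"
  have fin': "finite D'" unfolding D'_def using finite_I by simp
  have sub: "D \<subseteq> D'"
  proof
    fix n assume n: "n \<in> D"
    show "n \<in> D'"
    proof (rule ccontr)
      assume "n \<notin> D'"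
      have nd: "n + a i \<notin> degs (c x i)" if "i \<in> I" for i
      proof
        assume "n + a i \<in> degs (c x i)"
        then have "n + a i - a i \<in> D'" unfolding D'_def using that by blast
        then show False using \<open>n \<notin> D'\<close> by simp
      qed
      have "y n = \<zero>\<^bsub>N\<^esub>"
        by (rule coords_inj) (simp_all add: y closed coords hproj_notin_degs nd)
      with n show False by (simp add: D_def)
    qed
  qed
  have fin: "finite D" by (rule finite_subset[OF sub fin'])
  have "x = finsum N y D"
  proof (rule coords_inj)
    fix i assume i: "i \<in> I"
    have "c x i = (\<Sum>m\<in>(\<lambda>n. n + a i) ` D'. hproj m (c x i))"
    proof (rule hproj_decomp)
      show "degs (c x i) \<subseteq> (\<lambda>n. n + a i) ` D'"
      proof
        fix e assume "e \<in> degs (c x i)"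
        then have "e - a i \<in> D'" unfolding D'_def using i by blast
        then have "(e - a i) + a i \<in> (\<lambda>n. n + a i) ` D'" by (rule imageI)
        then show "e \<in> (\<lambda>n. n + a i) ` D'" by simp
      qed
    qed (simp add: fin')
    also have "\<dots> = (\<Sum>n\<in>D'. hproj (n + a i) (c x i))"
      by (subst sum.reindex) (auto simp: inj_on_def)
    also have "\<dots> = (\<Sum>n\<in>D. hproj (n + a i) (c x i))"
    proof (rule sum.mono_neutral_right[OF fin' sub])
      show "\<forall>n\<in>D' - D. hproj (n + a i) (c x i) = 0"
      proof
        fix n assume "n \<in> D' - D"
        then have "y n = \<zero>\<^bsub>N\<^esub>" by (simp add: D_def)
        then have "c (y n) i = 0" by (simp add: coords_zero[OF i])
        then show "hproj (n + a i) (c x i) = 0" by (simp add: y(2)[OF i])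
      qed
    qed
    also have "\<dots> = c (finsum N y D) i" using coords_finsum[OF fin y(1) i] y(2)[OF i] by simp
    finally show "c x i = c (finsum N y D) i" .
  qed (use x fin y in \<open>auto intro: finsum_in_carrier\<close>)
  show "finite {n. ?pr n x \<noteq> \<zero>\<^bsub>N\<^esub>}" "x = finsum N (\<lambda>n. ?pr n x) {n. ?pr n x \<noteq> \<zero>\<^bsub>N\<^esub>}"
    using fin \<open>x = finsum N y D\<close> unfolding D_def y_def by simp_all
qed (auto simp: hcomp_eq closed coords homog_add hproj_homog)

lemma graded_free_N: "graded_free N"
proof -
  obtain \<beta> where \<beta>: "bij_betw \<beta> {..<card I} I"
    using ex_bij_betw_nat_finite[OF finite_I] by (auto simp: atLeast0LessThan)
  let ?r = "card I"
  let ?P = "gdirect_sum ?r (\<lambda>j. twist (S_mod :: ('k poly3, 'k poly3) gmodule) (a (\<beta> j)))"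
  define h where "h = (\<lambda>x. \<lambda>j\<in>{..<?r}. c x (\<beta> j))"
  have \<beta>I: "\<beta> j \<in> I" if "j < ?r" for j using \<beta> that by (auto simp: bij_betw_def)
  have "h \<in> graded_hom N ?P"
    unfolding graded_hom_def S_linear_def h_def
    by (auto simp: gdirect_sum_def twist_def S_mod_def ideal_gmodule_def PiE_def Pi_def extensional_def
        coords \<beta>I hcomp_eq fun_eq_iff)
  moreover have "bij_betw h (carrier N) (carrier ?P)"
  proof (rule bij_betwI')
    fix x y assume xy: "x \<in> carrier N" "y \<in> carrier N"
    show "(h x = h y) = (x = y)"
    proof
      assume eq: "h x = h y"
      show "x = y"
      proof (rule coords_inj[OF xy])
        fix i assume "i \<in> I"
        then obtain j where "j < ?r" "i = \<beta> j" using \<beta> by (auto simp: bij_betw_def)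
        then show "c x i = c y i" using fun_cong[OF eq, of j] by (simp add: h_def)
      qed
    qed simp
  next
    show "h x \<in> carrier ?P" for x
      by (auto simp: h_def gdirect_sum_def twist_def S_mod_def ideal_gmodule_def)
    fix u assume u: "u \<in> carrier ?P"
    define x where "x = elt (\<lambda>i. u (inv_into {..<?r} \<beta> i))"
    have "h x = u"
    proof
      fix j show "h x j = u j"
        using u \<beta> by (cases "j < ?r") (auto simp: h_def x_def coords \<beta>I bij_betw_def gdirect_sum_def PiE_def extensional_def)
    qed
    then show "\<exists>x\<in>carrier N. u = h x" using elt_closed[of "\<lambda>i. u (inv_into {..<?r} \<beta> i)"] unfolding x_def[symmetric] by auto
  qed
  ultimately show ?thesis
    unfolding graded_free_def graded_iso_def
    by (intro conjI graded_module_N exI[of _ ?r] exI[of _ "\<lambda>j. a (\<beta> j)"] bexI[of _ h])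
qed

text \<open>Makes minimality a statement about constant terms of matrix entries. For the inclusion
  from right to left the element is built up one coordinate at a time.\<close>

lemma irrelevant_mult_eq: "irrelevant_mult N = {x \<in> carrier N. \<forall>i\<in>I. lookup (c x i) 0 = 0}"
proof -
  interpret G: abelian_group N by (rule abelian_group_N)
  let ?H = "{p \<odot>\<^bsub>N\<^esub> x | p x. p \<in> irrelevant_ideal \<and> x \<in> carrier N}"
  have H: "?H \<subseteq> carrier (add_monoid N)" by (auto simp: closed)
  have gen: "irrelevant_mult N = generate (add_monoid N) ?H" by (simp add: irrelevant_mult_def)
  have "subgroup {x \<in> carrier N. \<forall>i\<in>I. lookup (c x i) 0 = 0} (add_monoid N)"
  proof (rule group.subgroupI[OF G.a_group])
    fix x assume x: "x \<in> {x \<in> carrier N. \<forall>i\<in>I. lookup (c x i) 0 = 0}"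
    have "inv\<^bsub>add_monoid N\<^esub> x = (-1) \<odot>\<^bsub>N\<^esub> x"
      by (rule group.inv_equality[OF G.a_group]) (use x in \<open>auto simp: closed coords intro!: coords_inj\<close>)
    then show "inv\<^bsub>add_monoid N\<^esub> x \<in> {x \<in> carrier N. \<forall>i\<in>I. lookup (c x i) 0 = 0}"
      using x by (simp add: closed coords)
  qed (use closed coords in \<open>auto simp: closed coords lookup_add\<close>)
  moreover have "?H \<subseteq> {x \<in> carrier N. \<forall>i\<in>I. lookup (c x i) 0 = 0}"
    by (auto simp: closed coords irrelevant_ideal_eq lookup_mult_0)
  ultimately have "irrelevant_mult N \<subseteq> {x \<in> carrier N. \<forall>i\<in>I. lookup (c x i) 0 = 0}"
    unfolding gen using group.generate_subgroup_incl[OF G.a_group] by blast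
  moreover have "x \<in> irrelevant_mult N" if x: "x \<in> carrier N" "\<forall>i\<in>I. lookup (c x i) 0 = 0" for x
  proof -
    have "elt (\<lambda>i. if i \<in> J then c x i else 0) \<in> generate (add_monoid N) ?H" if "finite J" "J \<subseteq> I" for J
      using that
    proof (induction J)
      case empty
      have "elt (\<lambda>i. 0) = \<zero>\<^bsub>N\<^esub>" by (rule elt_eqI) (simp_all add: closed coords)
      moreover have "\<zero>\<^bsub>N\<^esub> \<in> generate (add_monoid N) ?H" using generate.one[of "add_monoid N" ?H] by simp
      ultimately show ?case by simp
    next
      case (insert j J)
      let ?y = "c x j \<odot>\<^bsub>N\<^esub> elt (\<lambda>i. if i = j then 1 else 0)"
      have "?y \<in> ?H" using x insert.prems irrelevant_ideal_eq elt_closed by blast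
      then have "?y \<in> generate (add_monoid N) ?H" by (rule generate.incl)
      moreover have "elt (\<lambda>i. if i \<in> J then c x i else 0) \<in> generate (add_monoid N) ?H" using insert by simp
      ultimately have "elt (\<lambda>i. if i \<in> J then c x i else 0) \<oplus>\<^bsub>N\<^esub> ?y \<in> generate (add_monoid N) ?H"
        using generate.eng[of _ "add_monoid N" ?H] by simp
      moreover have "elt (\<lambda>i. if i \<in> insert j J then c x i else 0) = elt (\<lambda>i. if i \<in> J then c x i else 0) \<oplus>\<^bsub>N\<^esub> ?y"
        by (rule elt_eqI) (use insert.hyps in \<open>auto simp: closed coords\<close>)
      ultimately show ?case by simp
    qed
    from this[OF finite_I subset_refl] have "elt (\<lambda>i. if i \<in> I then c x i else 0) \<in> irrelevant_mult N"
      unfolding gen .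
    moreover have "elt (\<lambda>i. if i \<in> I then c x i else 0) = x" by (rule elt_eqI) (use x in auto)
    ultimately show ?thesis by simp
  qed
  ultimately show ?thesis by blast
qed

definition basis :: "'i \<Rightarrow> 'm" where
  "basis i = elt (\<lambda>j. if j = i then 1 else 0)"

lemma basis_closed: "basis i \<in> carrier N"
  by (simp add: basis_def elt_closed)

lemma coords_basis: "j \<in> I \<Longrightarrow> c (basis i) j = (if j = i then 1 else 0)"
  by (simp add: basis_def coords_elt)

lemma basis_hcomp: "basis i \<in> hcomp N (- a i)"
  by (auto simp: hcomp_eq basis_closed coords_basis homog_1)

lemma linear_expand:
  assumes add: "\<And>x y. x \<in> carrier N \<Longrightarrow> y \<in> carrier N \<Longrightarrow> h (x \<oplus>\<^bsub>N\<^esub> y) = h x + h y"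
    and smult: "\<And>p x. x \<in> carrier N \<Longrightarrow> h (p \<odot>\<^bsub>N\<^esub> x) = p * h x"
    and x: "x \<in> carrier N"
  shows "h x = (\<Sum>i\<in>I. c x i * h (basis i))"
proof -
  have h0: "h (elt (\<lambda>i. 0)) = 0"
  proof -
    have "elt (\<lambda>i. 0) = 0 \<odot>\<^bsub>N\<^esub> x" by (rule elt_eqI) (simp_all add: closed coords x)
    then show ?thesis by (simp add: smult x)
  qed
  have "h (elt (\<lambda>i. if i \<in> J then c x i else 0)) = (\<Sum>i\<in>J. c x i * h (basis i))" if "finite J" for J
    using that
  proof (induction J)
    case empty
    then show ?case using h0 by simp
  next
    case (insert j J)
    have "elt (\<lambda>i. if i \<in> insert j J then c x i else 0) = c x j \<odot>\<^bsub>N\<^esub> basis j \<oplus>\<^bsub>N\<^esub> elt (\<lambda>i. if i \<in> J then c x i else 0)"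
      by (rule elt_eqI) (use insert.hyps in \<open>auto simp: closed coords basis_closed coords_basis\<close>)
    then show ?case using insert by (simp add: add smult closed basis_closed)
  qed
  from this[OF finite_I] have "h (elt (\<lambda>i. if i \<in> I then c x i else 0)) = (\<Sum>i\<in>I. c x i * h (basis i))" .
  moreover have "elt (\<lambda>i. if i \<in> I then c x i else 0) = x" by (rule elt_eqI) (use x in auto)
  ultimately show ?thesis by simp
qed

end


section \<open>Homomorphisms, and coordinates on sums, twists and duals\<close>

lemma S_linearI:
  assumes "\<And>x. x \<in> carrier N \<Longrightarrow> h x \<in> carrier P"
    and "\<And>x y. x \<in> carrier N \<Longrightarrow> y \<in> carrier N \<Longrightarrow> h (x \<oplus>\<^bsub>N\<^esub> y) = h x \<oplus>\<^bsub>P\<^esub> h y"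
    and "\<And>p x. x \<in> carrier N \<Longrightarrow> h (p \<odot>\<^bsub>N\<^esub> x) = p \<odot>\<^bsub>P\<^esub> h x"
  shows "h \<in> S_linear N P"
  using assms by (auto simp: S_linear_def)

lemma S_linearD:
  assumes "h \<in> S_linear N P"
  shows "x \<in> carrier N \<Longrightarrow> h x \<in> carrier P"
    and "x \<in> carrier N \<Longrightarrow> y \<in> carrier N \<Longrightarrow> h (x \<oplus>\<^bsub>N\<^esub> y) = h x \<oplus>\<^bsub>P\<^esub> h y"
    and "x \<in> carrier N \<Longrightarrow> h (p \<odot>\<^bsub>N\<^esub> x) = p \<odot>\<^bsub>P\<^esub> h x"
  using assms by (auto simp: S_linear_def)

lemma graded_homI:
  assumes "h \<in> S_linear N P" "\<And>n x. x \<in> hcomp N n \<Longrightarrow> h x \<in> hcomp P n"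
  shows "h \<in> graded_hom N P"
  using assms by (auto simp: graded_hom_def)

lemma ideal_gmodule_simps [simp]:
  "carrier (ideal_gmodule I) = I" "\<zero>\<^bsub>ideal_gmodule I\<^esub> = 0" "x \<oplus>\<^bsub>ideal_gmodule I\<^esub> y = x + y"
  "p \<odot>\<^bsub>ideal_gmodule I\<^esub> x = p * x" "hcomp (ideal_gmodule I) n = I \<inter> homog n"
  by (simp_all add: ideal_gmodule_def)

lemma S_mod_simps [simp]:
  "carrier S_mod = UNIV" "\<zero>\<^bsub>S_mod\<^esub> = 0" "x \<oplus>\<^bsub>S_mod\<^esub> y = x + y"
  "p \<odot>\<^bsub>S_mod\<^esub> x = p * x" "hcomp S_mod n = homog n"
  by (simp_all add: S_mod_def)

lemma twist_simps [simp]: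
  "carrier (twist N s) = carrier N" "\<zero>\<^bsub>twist N s\<^esub> = \<zero>\<^bsub>N\<^esub>" "x \<oplus>\<^bsub>twist N s\<^esub> y = x \<oplus>\<^bsub>N\<^esub> y"
  "p \<odot>\<^bsub>twist N s\<^esub> x = p \<odot>\<^bsub>N\<^esub> x" "hcomp (twist N s) n = hcomp N (n + s)"
  by (simp_all add: twist_def)

lemma gsum_simps [simp]:
  "carrier (N \<oplus>\<^sub>g P) = carrier N \<times> carrier P" "\<zero>\<^bsub>N \<oplus>\<^sub>g P\<^esub> = (\<zero>\<^bsub>N\<^esub>, \<zero>\<^bsub>P\<^esub>)"
  "u \<oplus>\<^bsub>N \<oplus>\<^sub>g P\<^esub> v = (fst u \<oplus>\<^bsub>N\<^esub> fst v, snd u \<oplus>\<^bsub>P\<^esub> snd v)"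
  "p \<odot>\<^bsub>N \<oplus>\<^sub>g P\<^esub> u = (p \<odot>\<^bsub>N\<^esub> fst u, p \<odot>\<^bsub>P\<^esub> snd u)" "hcomp (N \<oplus>\<^sub>g P) n = hcomp N n \<times> hcomp P n"
  by (simp_all add: gsum_def)

lemma gdirect_sum_simps:
  "carrier (gdirect_sum r N) = (\<Pi>\<^sub>E i\<in>{..<r}. carrier (N i))"
  "\<zero>\<^bsub>gdirect_sum r N\<^esub> = (\<lambda>i\<in>{..<r}. \<zero>\<^bsub>N i\<^esub>)"
  "u \<oplus>\<^bsub>gdirect_sum r N\<^esub> v = (\<lambda>i\<in>{..<r}. u i \<oplus>\<^bsub>N i\<^esub> v i)"
  "p \<odot>\<^bsub>gdirect_sum r N\<^esub> u = (\<lambda>i\<in>{..<r}. p \<odot>\<^bsub>N i\<^esub> u i)"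
  "hcomp (gdirect_sum r N) n = (\<Pi>\<^sub>E i\<in>{..<r}. hcomp (N i) n)"
  by (simp_all add: gdirect_sum_def)

lemma dual_simps [simp]:
  "carrier (dual N) = S_linear N S_mod \<inter> extensional (carrier N)"
  "\<zero>\<^bsub>dual N\<^esub> = (\<lambda>x\<in>carrier N. 0)"
  "g \<oplus>\<^bsub>dual N\<^esub> h = (\<lambda>x\<in>carrier N. g x + h x)"
  "p \<odot>\<^bsub>dual N\<^esub> h = (\<lambda>x\<in>carrier N. p * h x)"
  "hcomp (dual N) n = {h \<in> S_linear N S_mod \<inter> extensional (carrier N). \<forall>j. h ` hcomp N j \<subseteq> homog (j + n)}"
  by (simp_all add: dual_def)

lemma graded_coords_S_pow: "graded_coords (S_pow r s) {..<r} (\<lambda>_. s) (\<lambda>u. u)"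
proof (rule graded_coords.intro)
  fix u v :: "nat \<Rightarrow> 'a poly3"
  assume "u \<in> carrier (S_pow r s)" "v \<in> carrier (S_pow r s)" "\<And>i. i \<in> {..<r} \<Longrightarrow> u i = v i"
  then show "u = v" unfolding S_pow_def gdirect_sum_simps by (auto intro: PiE_ext)
next
  fix v :: "nat \<Rightarrow> 'a poly3"
  show "\<exists>x\<in>carrier (S_pow r s). \<forall>i\<in>{..<r}. x i = v i"
    by (rule bexI[of _ "restrict v {..<r}"]) (auto simp: S_pow_def gdirect_sum_simps)
qed (auto simp: S_pow_def gdirect_sum_simps PiE_def Pi_def)

lemma graded_coords_gsum:
  fixes N :: "('k::field poly3, 'm) gmodule" and P :: "('k poly3, 'n) gmodule" and I :: "'i set" and J :: "'j set"
  assumes "graded_coords N I a c" "graded_coords P J b c'"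
  shows "graded_coords (N \<oplus>\<^sub>g P) (Sum_Type.Plus I J) (case_sum a b) (\<lambda>u. case_sum (c (fst u)) (c' (snd u)))"
proof -
  interpret N: graded_coords N I a c by fact
  interpret P: graded_coords P J b c' by fact
  show ?thesis
  proof (rule graded_coords.intro)
    show "finite (Sum_Type.Plus I J)" using N.finite_I P.finite_I by simp
    fix u v assume uv: "u \<in> carrier (N \<oplus>\<^sub>g P)" "v \<in> carrier (N \<oplus>\<^sub>g P)"
      and eq: "\<And>i. i \<in> Sum_Type.Plus I J \<Longrightarrow> case_sum (c (fst u)) (c' (snd u)) i = case_sum (c (fst v)) (c' (snd v)) i"
    have "fst u = fst v" using uv eq[OF InlI] by (intro N.coords_inj) auto
    moreover have "snd u = snd v" using uv eq[OF InrI] by (intro P.coords_inj) auto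
    ultimately show "u = v" by (rule prod_eqI)
  next
    fix v :: "'i + 'j \<Rightarrow> 'k poly3"
    show "\<exists>x\<in>carrier (N \<oplus>\<^sub>g P). \<forall>i\<in>Sum_Type.Plus I J. case_sum (c (fst x)) (c' (snd x)) i = v i"
      by (rule bexI[of _ "(N.elt (v \<circ> Inl), P.elt (v \<circ> Inr))"]) (auto simp: N.closed P.closed N.coords P.coords)
  next
    show "hcomp (N \<oplus>\<^sub>g P) n = {x \<in> carrier (N \<oplus>\<^sub>g P). \<forall>i\<in>Sum_Type.Plus I J. case_sum (c (fst x)) (c' (snd x)) i \<in> homog (n + case_sum a b i)}" for n
    proof -
      have Plus_iff: "(\<forall>i\<in>Sum_Type.Plus I J. Q i) \<longleftrightarrow> (\<forall>i\<in>I. Q (Inl i)) \<and> (\<forall>j\<in>J. Q (Inr j))" for Q by auto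
      show ?thesis unfolding Plus_iff by (auto simp: N.hcomp_eq P.hcomp_eq)
    qed
  qed (auto simp: N.closed P.closed N.coords P.coords)
qed

lemma graded_coords_twist:
  assumes "graded_coords N I a c" shows "graded_coords (twist N s) I (\<lambda>i. a i + s) c"
proof -
  interpret N: graded_coords N I a c by fact
  show ?thesis
    by (rule graded_coords.intro)
      (auto simp: N.closed N.coords N.finite_I N.coords_inj N.coords_surj N.hcomp_eq ac_simps)
qed

context graded_coords
begin

lemma dual_expand:
  assumes "h \<in> S_linear N S_mod" "x \<in> carrier N"
  shows "h x = (\<Sum>i\<in>I. c x i * h (basis i))"
  by (rule linear_expand) (use S_linearD[OF assms(1)] assms(2) in simp_all)

text \<open>Coordinates in the dual basis are the values on the basis, and degrees change
  sign.\<close>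

lemma graded_coords_dual: "graded_coords (dual N) I (\<lambda>i. - a i) (\<lambda>h i. h (basis i))"
proof (rule graded_coords.intro)
  fix g h assume gh: "g \<in> carrier (dual N)" "h \<in> carrier (dual N)" and eq: "\<And>i. i \<in> I \<Longrightarrow> g (basis i) = h (basis i)"
  show "g = h"
  proof (rule extensionalityI[of _ "carrier N"])
    show "g x = h x" if "x \<in> carrier N" for x
      using gh eq that dual_expand[of g x] dual_expand[of h x] by simp
  qed (use gh in auto)
next
  fix v :: "'i \<Rightarrow> 'k poly3"
  let ?h = "\<lambda>x\<in>carrier N. \<Sum>i\<in>I. c x i * v i"
  have "?h \<in> S_linear N S_mod"
    by (rule S_linearI)
      (auto simp: closed coords sum.distrib sum_distrib_left distrib_right mult.assoc intro!: sum.cong)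
  moreover have "?h (basis i) = v i" if i: "i \<in> I" for i
  proof -
    have "?h (basis i) = (\<Sum>j\<in>I. (if j = i then 1 else 0) * v j)"
      by (simp add: basis_closed coords_basis)
    also have "\<dots> = (\<Sum>j\<in>I. if j = i then v j else 0)" by (rule sum.cong) auto
    also have "\<dots> = v i" using i finite_I by simp
    finally show ?thesis .
  qed
  ultimately show "\<exists>h\<in>carrier (dual N). \<forall>i\<in>I. h (basis i) = v i"
    by (intro bexI[of _ ?h]) auto
next
  fix n
  show "hcomp (dual N) n = {h \<in> carrier (dual N). \<forall>i\<in>I. h (basis i) \<in> homog (n + - a i)}"
  proof (rule equalityI; rule subsetI)
    fix h assume h: "h \<in> hcomp (dual N) n"
    have "h ` hcomp N (- a i) \<subseteq> homog (- a i + n)" for i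
      using h unfolding dual_simps mem_Collect_eq by blast
    then have "h (basis i) \<in> homog (- a i + n)" for i using basis_hcomp[of i] by blast
    then show "h \<in> {h \<in> carrier (dual N). \<forall>i\<in>I. h (basis i) \<in> homog (n + - a i)}"
      using h by (simp add: add.commute)
  next
    fix h assume h: "h \<in> {h \<in> carrier (dual N). \<forall>i\<in>I. h (basis i) \<in> homog (n + - a i)}"
    have "h x \<in> homog (j + n)" if x: "x \<in> hcomp N j" for x j
    proof -
      have xc: "x \<in> carrier N" "\<And>i. i \<in> I \<Longrightarrow> c x i \<in> homog (j + a i)" using x by (auto simp: hcomp_eq)
      have hl: "h \<in> S_linear N S_mod" "\<And>i. i \<in> I \<Longrightarrow> h (basis i) \<in> homog (n + - a i)" using h by auto
      show ?thesis
        unfolding dual_expand[OF hl(1) xc(1)]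
        by (intro homog_sum homog_mult'[OF xc(2) hl(2)]) auto
    qed
    then show "h \<in> hcomp (dual N) n" using h by auto
  qed
next
  fix g h assume gh: "g \<in> carrier (dual N)" "h \<in> carrier (dual N)"
  show "g \<oplus>\<^bsub>dual N\<^esub> h \<in> carrier (dual N)"
    using gh by (auto intro!: S_linearI simp: closed S_linearD[where P = S_mod, simplified] algebra_simps)
  fix i
  show "(g \<oplus>\<^bsub>dual N\<^esub> h) (basis i) = g (basis i) + h (basis i)" by (simp add: basis_closed)
next
  fix p h assume h: "h \<in> carrier (dual N)"
  show "p \<odot>\<^bsub>dual N\<^esub> h \<in> carrier (dual N)"
    using h by (auto intro!: S_linearI simp: closed S_linearD[where P = S_mod, simplified] algebra_simps)
  fix i
  show "(p \<odot>\<^bsub>dual N\<^esub> h) (basis i) = p * h (basis i)" by (simp add: basis_closed)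
next
  show "\<zero>\<^bsub>dual N\<^esub> \<in> carrier (dual N)" by (auto intro!: S_linearI simp: closed)
  show "\<zero>\<^bsub>dual N\<^esub> (basis i) = 0" for i by (simp add: basis_closed)
qed (rule finite_I)

end

text \<open>The isomorphism is only known to map components into components. That it reflects
  homogeneity follows by decomposing an element and comparing degrees in each coordinate.\<close>

lemma graded_free_coords:
  fixes N :: "('k::field poly3, 'm) gmodule"
  assumes "graded_free N" obtains r a and c :: "'m \<Rightarrow> nat \<Rightarrow> 'k poly3" where "graded_coords N {..<r} a c"
proof -
  from assms obtain r a h where N: "graded_module N" and h: "h \<in> graded_hom N (gdirect_sum r (\<lambda>i. twist S_mod (a i)))"
    and bij: "bij_betw h (carrier N) (carrier (gdirect_sum r (\<lambda>i. twist S_mod (a i))))"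
    unfolding graded_free_def graded_iso_def by blast
  interpret m: module S_ring N using N unfolding graded_module_def by blast
  let ?P = "gdirect_sum r (\<lambda>i. twist S_mod (a i)) :: ('k poly3, nat \<Rightarrow> 'k poly3) gmodule"
  have hl: "h \<in> S_linear N ?P" using h by (simp add: graded_hom_def)
  have hadd: "h (x \<oplus>\<^bsub>N\<^esub> y) i = h x i + h y i" if "x \<in> carrier N" "y \<in> carrier N" "i < r" for x y i
    using S_linearD(2)[OF hl that(1,2)] that(3) by (simp add: gdirect_sum_simps)
  have hsm: "h (p \<odot>\<^bsub>N\<^esub> x) i = p * h x i" if "x \<in> carrier N" "i < r" for p x i
    using S_linearD(3)[OF hl that(1)] that(2) by (simp add: gdirect_sum_simps)
  have h0: "h \<zero>\<^bsub>N\<^esub> i = 0" if "i < r" for i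
  proof -
    have "h \<zero>\<^bsub>N\<^esub> i = h \<zero>\<^bsub>N\<^esub> i + h \<zero>\<^bsub>N\<^esub> i"
      using hadd[OF m.M.zero_closed m.M.zero_closed that] unfolding m.M.l_zero[OF m.M.zero_closed] .
    then show ?thesis by (simp only: add_cancel_right_right)
  qed
  have inj: "x = y" if "x \<in> carrier N" "y \<in> carrier N" "\<And>i. i \<in> {..<r} \<Longrightarrow> h x i = h y i" for x y
  proof -
    have "h x \<in> carrier ?P" "h y \<in> carrier ?P" using bij that by (auto simp: bij_betw_def)
    then have "h x = h y" using that(3) unfolding gdirect_sum_simps by (auto intro: PiE_ext)
    then show ?thesis using bij that by (auto simp: bij_betw_def inj_on_def)
  qed
  have hhom: "h x i \<in> homog (n + a i)" if "x \<in> hcomp N n" "i < r" for x n i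
    using h that unfolding graded_hom_def gdirect_sum_simps by (auto simp: PiE_def Pi_def)
  have hsub: "hcomp N n \<subseteq> carrier N" for n
    using N additive_subgroup.a_subset unfolding graded_module_def by blast
  have hsum: "h (finsum N y D) i = (\<Sum>n\<in>D. h (y n) i)" if "finite D" "\<And>n. n \<in> D \<Longrightarrow> y n \<in> carrier N" "i < r" for y i and D :: "int set"
    using that(1,2)
  proof (induction D)
    case empty
    then show ?case using h0[OF that(3)] by simp
  next
    case (insert d D)
    then have "h (y d \<oplus>\<^bsub>N\<^esub> finsum N y D) i = h (y d) i + h (finsum N y D) i"
      by (intro hadd that(3) m.M.finsum_closed) auto
    then show ?case using insert by (simp add: Pi_def)
  qed
  have "graded_coords N {..<r} a h"
  proof (rule graded_coords.intro)
    fix v :: "nat \<Rightarrow> 'k poly3"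
    have "restrict v {..<r} \<in> carrier ?P" by (auto simp: gdirect_sum_simps)
    then have "restrict v {..<r} \<in> h ` carrier N" using bij by (simp add: bij_betw_def)
    then obtain x where x: "x \<in> carrier N" "restrict v {..<r} = h x" by blast
    show "\<exists>x\<in>carrier N. \<forall>i\<in>{..<r}. h x i = v i"
      by (rule bexI[OF _ x(1)]) (simp flip: x(2))
  next
    fix n
    show "hcomp N n = {x \<in> carrier N. \<forall>i\<in>{..<r}. h x i \<in> homog (n + a i)}"
    proof (rule equalityI; rule subsetI)
      fix x assume "x \<in> {x \<in> carrier N. \<forall>i\<in>{..<r}. h x i \<in> homog (n + a i)}"
      then have x: "x \<in> carrier N" "\<And>i. i < r \<Longrightarrow> h x i \<in> homog (n + a i)" by auto
      from N x(1) obtain y where y: "\<And>k. y k \<in> hcomp N k" "finite {k. y k \<noteq> \<zero>\<^bsub>N\<^esub>}"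
        "x = finsum N y {k. y k \<noteq> \<zero>\<^bsub>N\<^esub>}" unfolding graded_module_def by blast
      have yc: "y k \<in> carrier N" for k using y(1) hsub by blast
      let ?D = "{k. y k \<noteq> \<zero>\<^bsub>N\<^esub>}"
      have "h (y k) i = (if k = n then h x i else 0)" if i: "i < r" for k i
      proof -
        have "h x i = (\<Sum>j\<in>?D. h (y j) i)" using hsum[OF y(2) yc i] y(3) by simp
        then have "hproj (k + a i) (h x i) = (\<Sum>j\<in>?D. hproj (k + a i) (h (y j) i))" by (simp add: hproj_sum)
        also have "\<dots> = (\<Sum>j\<in>?D. if j = k then h (y k) i else 0)"
          using hproj_of_homog[OF hhom[OF y(1) i]] by (intro sum.cong) auto
        also have "\<dots> = h (y k) i" using y(2) h0[OF i] by (simp add: sum.delta)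
        finally show ?thesis using hproj_of_homog[OF x(2)[OF i], of "k + a i"] by simp
      qed
      then have "x = y n" using x(1) yc by (intro inj) auto
      then show "x \<in> hcomp N n" using y(1) by simp
    qed (use hsub hhom in auto)
  qed (use inj hadd hsm h0 in auto)
  then show thesis by (rule that)
qed

text \<open>The complement is the kernel of one coordinate, realised inside \<open>N\<close>. This
  turns the hypothesis on \<open>F\<close> into a restriction on the degrees of its basis.\<close>

lemma (in graded_coords) has_direct_summand:
  assumes s: "s \<in> I" shows "has_direct_summand N (twist S_mod (a s))"
proof -
  define P where "P = N\<lparr>carrier := {x \<in> carrier N. c x s = 0}, hcomp := \<lambda>n. {x \<in> hcomp N n. c x s = 0}\<rparr>"
  have P: "carrier P = {x \<in> carrier N. c x s = 0}" "\<zero>\<^bsub>P\<^esub> = \<zero>\<^bsub>N\<^esub>" "hcomp P n = {x \<in> hcomp N n. c x s = 0}"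
    "x \<oplus>\<^bsub>P\<^esub> y = x \<oplus>\<^bsub>N\<^esub> y" "p \<odot>\<^bsub>P\<^esub> x = p \<odot>\<^bsub>N\<^esub> x" for n p x y
    by (simp_all add: P_def)
  have "graded_coords P (I - {s}) a c"
  proof (rule graded_coords.intro)
    show "x = y" if "x \<in> carrier P" "y \<in> carrier P" "\<And>i. i \<in> I - {s} \<Longrightarrow> c x i = c y i" for x y
    proof (rule coords_inj)
      show "c x i = c y i" if "i \<in> I" for i
        using that \<open>\<And>i. i \<in> I - {s} \<Longrightarrow> c x i = c y i\<close> \<open>x \<in> carrier P\<close> \<open>y \<in> carrier P\<close>
        by (cases "i = s") (auto simp: P)
    qed (use that in \<open>auto simp: P\<close>)
    fix v :: "'i \<Rightarrow> 'k poly3"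
    show "\<exists>x\<in>carrier P. \<forall>i\<in>I - {s}. c x i = v i"
      by (rule bexI[of _ "elt (\<lambda>i. if i = s then 0 else v i)"]) (use s in \<open>auto simp: P closed coords\<close>)
  next
    show "hcomp P n = {x \<in> carrier P. \<forall>i\<in>I - {s}. c x i \<in> homog (n + a i)}" for n
      using homog_0 by (auto simp: P hcomp_eq)
  qed (use s in \<open>auto simp: P closed coords finite_I\<close>)
  then interpret P: graded_coords P "I - {s}" a c .
  define h where "h = (\<lambda>x. (c x s, elt (\<lambda>i. if i = s then 0 else c x i)))"
  have hP: "elt (\<lambda>i. if i = s then 0 else v i) \<in> carrier P" for v using s by (auto simp: P closed coords)
  have "h \<in> graded_hom N (twist S_mod (a s) \<oplus>\<^sub>g P)"
  proof (rule graded_homI[OF S_linearI])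
    show "h x \<in> carrier (twist S_mod (a s) \<oplus>\<^sub>g P)" for x by (simp add: h_def hP)
    show "h (x \<oplus>\<^bsub>N\<^esub> y) = h x \<oplus>\<^bsub>twist S_mod (a s) \<oplus>\<^sub>g P\<^esub> h y" if "x \<in> carrier N" "y \<in> carrier N" for x y
      using that s by (auto simp: h_def P coords closed intro!: elt_eqI)
    show "h (p \<odot>\<^bsub>N\<^esub> x) = p \<odot>\<^bsub>twist S_mod (a s) \<oplus>\<^sub>g P\<^esub> h x" if "x \<in> carrier N" for p x
      using that s by (auto simp: h_def P coords closed intro!: elt_eqI)
    show "h x \<in> hcomp (twist S_mod (a s) \<oplus>\<^sub>g P) n" if "x \<in> hcomp N n" for x n
      using that s by (auto simp: h_def P hcomp_eq coords closed)
  qed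
  moreover have "bij_betw h (carrier N) (carrier (twist S_mod (a s) \<oplus>\<^sub>g P))"
  proof (rule bij_betwI')
    fix x y assume xy: "x \<in> carrier N" "y \<in> carrier N"
    show "(h x = h y) = (x = y)"
    proof
      assume eq: "h x = h y"
      show "x = y"
      proof (rule coords_inj[OF xy])
        fix i assume i: "i \<in> I"
        have "elt (\<lambda>i. if i = s then 0 else c x i) = elt (\<lambda>i. if i = s then 0 else c y i)" "c x s = c y s"
          using eq by (simp_all add: h_def)
        then show "c x i = c y i"
          using coords_elt[OF i, of "\<lambda>i. if i = s then 0 else c x i"] coords_elt[OF i, of "\<lambda>i. if i = s then 0 else c y i"]
          by (cases "i = s") auto
      qed
    qed simp
  next
    show "h x \<in> carrier (twist S_mod (a s) \<oplus>\<^sub>g P)" for x by (simp add: h_def hP)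
    fix u assume u: "u \<in> carrier (twist S_mod (a s) \<oplus>\<^sub>g P)"
    obtain p z where pz: "u = (p, z)" by (rule prod.exhaust)
    let ?x = "elt (\<lambda>i. if i = s then p else c z i)"
    have z: "z \<in> carrier N" "c z s = 0" using u by (simp_all add: pz P)
    have "elt (\<lambda>i. if i = s then 0 else c ?x i) = z"
      by (rule elt_eqI) (use z in \<open>auto simp: coords\<close>)
    then have "u = h ?x" using s by (simp add: h_def pz coords)
    then show "\<exists>x\<in>carrier N. u = h x" using elt_closed by (rule bexI)
  qed
  ultimately show ?thesis
    unfolding has_direct_summand_def graded_iso_def using P.graded_module_N by blast
qed

text \<open>Steinitz exchange: \<open>\<Sum> v\<^sub>i \<eta>\<^sub>i\<close> replaces the generator \<open>\<eta>\<^sub>s\<close>.\<close>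

lemma (in graded_coords) exchange:
  fixes v :: "'i \<Rightarrow> 'k"
  assumes s: "s \<in> I" "v s \<noteq> 0" and v: "\<And>i. i \<in> I \<Longrightarrow> v i \<noteq> 0 \<Longrightarrow> a i = a s"
  defines "c' \<equiv> \<lambda>x i. if i = s then cst (1 / v s) * c x s else c x i - cst (v i / v s) * c x s"
  shows "graded_coords N I a c'"
    and "(\<Sum>i\<in>I. c' x i * (\<eta>(s := \<Sum>j\<in>I. cst (v j) * \<eta> j)) i) = (\<Sum>i\<in>I. c x i * \<eta> i)"
proof -
  have inv: "cst (v s) * cst (1 / v s) = 1" "cst (1 / v s) * cst (v s) = 1"
    using s(2) by (simp_all add: mult_single)
  have div: "cst (v i / v s) * cst (v s) = cst (v i)" "cst (v i / v s) = cst (1 / v s) * cst (v i)" for i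
    using s(2) by (simp_all add: mult_single)
  \<comment> \<open>The inverse base change, from the new coordinates back to the old ones.\<close>
  have cs: "c x s = cst (v s) * c' x s" for x
    unfolding c'_def by (simp add: inv flip: mult.assoc)
  have ci: "c x i = c' x i + cst (v i) * c' x s" if "i \<noteq> s" for x i
    unfolding c'_def using that by (simp add: div mult.left_commute mult.assoc)
  show "graded_coords N I a c'"
  proof (rule graded_coords.intro)
    fix x y assume xy: "x \<in> carrier N" "y \<in> carrier N" and eq: "\<And>i. i \<in> I \<Longrightarrow> c' x i = c' y i"
    show "x = y"
    proof (rule coords_inj[OF xy])
      show "c x i = c y i" if "i \<in> I" for i
        using eq[OF that] eq[OF s(1)] by (cases "i = s") (simp_all add: cs ci)
    qed
  next
    fix w :: "'i \<Rightarrow> 'k poly3"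
    show "\<exists>x\<in>carrier N. \<forall>i\<in>I. c' x i = w i"
      by (rule bexI[of _ "elt (\<lambda>i. if i = s then cst (v s) * w s else w i + cst (v i) * w s)"])
        (auto simp: c'_def closed coords s(1) inv div simp flip: mult.assoc)
  next
    fix n
    show "hcomp N n = {x \<in> carrier N. \<forall>i\<in>I. c' x i \<in> homog (n + a i)}"
    proof (rule equalityI; rule subsetI)
      fix x assume "x \<in> hcomp N n"
      then have x: "x \<in> carrier N" "\<And>i. i \<in> I \<Longrightarrow> c x i \<in> homog (n + a i)" by (auto simp: hcomp_eq)
      \<comment> \<open>Only generators of the same degree as the one with index \<open>s\<close>
        are mixed, so degrees are preserved.\<close>
      have "c' x i \<in> homog (n + a i)" if i: "i \<in> I" for i
      proof (cases "i = s \<or> v i = 0")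
        case True
        then show ?thesis using x(2)[OF i] homog_mult'[OF homog_cst x(2)[OF i]] by (auto simp: c'_def)
      next
        case False
        then have "a i = a s" using v[OF i] by blast
        moreover have "cst (v i / v s) * c x s \<in> homog (n + a s)"
          using homog_mult'[OF homog_cst x(2)[OF s(1)]] by simp
        ultimately show ?thesis using False homog_diff[OF x(2)[OF i]] by (simp add: c'_def)
      qed
      then show "x \<in> {x \<in> carrier N. \<forall>i\<in>I. c' x i \<in> homog (n + a i)}" using x by simp
    next
      fix x assume "x \<in> {x \<in> carrier N. \<forall>i\<in>I. c' x i \<in> homog (n + a i)}"
      then have x: "x \<in> carrier N" "\<And>i. i \<in> I \<Longrightarrow> c' x i \<in> homog (n + a i)" by auto
      have "c x i \<in> homog (n + a i)" if i: "i \<in> I" for i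
      proof (cases "i = s")
        case True
        then show ?thesis unfolding True cs using homog_mult'[OF homog_cst x(2)[OF s(1)]] by simp
      next
        case False
        show ?thesis
        proof (cases "v i = 0")
          case True
          then show ?thesis using ci[OF False, of x] x(2)[OF i] by simp
        next
          case v0: False
          have "cst (v i) * c' x s \<in> homog (n + a i)"
            using homog_mult'[OF homog_cst x(2)[OF s(1)]] v[OF i v0] by simp
          then show ?thesis unfolding ci[OF False] by (rule homog_add[OF x(2)[OF i]])
        qed
      qed
      then show "x \<in> hcomp N n" using x(1) by (simp add: hcomp_eq)
    qed
  qed (auto simp: c'_def closed coords s(1) finite_I algebra_simps)
  have split: "(\<Sum>i\<in>I. g i) = g s + (\<Sum>i\<in>I - {s}. g i)" for g :: "'i \<Rightarrow> 'k poly3"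
    using s(1) finite_I by (rule sum.remove[rotated])
  have "(\<Sum>i\<in>I. c x i * \<eta> i) = cst (v s) * c' x s * \<eta> s + (\<Sum>i\<in>I - {s}. (c' x i + cst (v i) * c' x s) * \<eta> i)"
    unfolding split cs[symmetric] by (intro arg_cong2[of _ _ _ _ "(+)"] sum.cong refl) (auto simp: ci)
  also have "\<dots> = c' x s * (cst (v s) * \<eta> s + (\<Sum>j\<in>I - {s}. cst (v j) * \<eta> j)) + (\<Sum>i\<in>I - {s}. c' x i * \<eta> i)"
    by (simp add: distrib_left distrib_right sum.distrib sum_distrib_left ac_simps)
  also have "cst (v s) * \<eta> s + (\<Sum>j\<in>I - {s}. cst (v j) * \<eta> j) = (\<Sum>j\<in>I. cst (v j) * \<eta> j)"
    by (simp only: split[of "\<lambda>j. cst (v j) * \<eta> j"])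
  also have "(\<Sum>i\<in>I - {s}. c' x i * \<eta> i) = (\<Sum>i\<in>I - {s}. c' x i * (\<eta>(s := \<Sum>j\<in>I. cst (v j) * \<eta> j)) i)"
    by (rule sum.cong) auto
  also have "c' x s * (\<Sum>j\<in>I. cst (v j) * \<eta> j) + \<dots> = (\<Sum>i\<in>I. c' x i * (\<eta>(s := \<Sum>j\<in>I. cst (v j) * \<eta> j)) i)"
    using split[of "\<lambda>i. c' x i * (\<eta>(s := \<Sum>j\<in>I. cst (v j) * \<eta> j)) i"] by simp
  finally show "(\<Sum>i\<in>I. c' x i * (\<eta>(s := \<Sum>j\<in>I. cst (v j) * \<eta> j)) i) = (\<Sum>i\<in>I. c x i * \<eta> i)" by simp
qed


section \<open>Homogeneous ideals and their quotients\<close>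

definition homog_ideal :: "'k::field poly3 set \<Rightarrow> bool" where
  "homog_ideal I \<longleftrightarrow> 0 \<in> I \<and> (\<forall>x\<in>I. \<forall>y\<in>I. x + y \<in> I) \<and> (\<forall>p. \<forall>x\<in>I. p * x \<in> I) \<and> (\<forall>x\<in>I. \<forall>n. hproj n x \<in> I)"

lemma homog_idealD:
  assumes "homog_ideal I"
  shows "0 \<in> I" "x \<in> I \<Longrightarrow> y \<in> I \<Longrightarrow> x + y \<in> I" "x \<in> I \<Longrightarrow> p * x \<in> I" "x \<in> I \<Longrightarrow> hproj n x \<in> I"
    "x \<in> I \<Longrightarrow> - x \<in> I" "x \<in> I \<Longrightarrow> y \<in> I \<Longrightarrow> x - y \<in> I" "(\<And>z. z \<in> Y \<Longrightarrow> g z \<in> I) \<Longrightarrow> sum g Y \<in> I"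
proof -
  have *: "0 \<in> I" "\<And>x y. x \<in> I \<Longrightarrow> y \<in> I \<Longrightarrow> x + y \<in> I" "\<And>x p. x \<in> I \<Longrightarrow> p * x \<in> I" "\<And>x n. x \<in> I \<Longrightarrow> hproj n x \<in> I"
    using assms by (auto simp: homog_ideal_def)
  show "0 \<in> I" "x \<in> I \<Longrightarrow> y \<in> I \<Longrightarrow> x + y \<in> I" "x \<in> I \<Longrightarrow> p * x \<in> I" "x \<in> I \<Longrightarrow> hproj n x \<in> I" by (fact *)+
  have neg: "- x \<in> I" if "x \<in> I" for x using *(3)[OF that, of "-1"] by simp
  then show "x \<in> I \<Longrightarrow> - x \<in> I" .
  show "x \<in> I \<Longrightarrow> y \<in> I \<Longrightarrow> x - y \<in> I" using *(2)[of x "- y"] neg[of y] by simp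
  show "(\<And>z. z \<in> Y \<Longrightarrow> g z \<in> I) \<Longrightarrow> sum g Y \<in> I"
    by (induction Y rule: infinite_finite_induct) (auto simp: *)
qed

lemma abelian_group_ideal:
  assumes "homog_ideal I" shows "abelian_group (ideal_gmodule I)"
proof (rule abelian_groupI)
  show "\<exists>y\<in>carrier (ideal_gmodule I). y \<oplus>\<^bsub>ideal_gmodule I\<^esub> x = \<zero>\<^bsub>ideal_gmodule I\<^esub>"
    if "x \<in> carrier (ideal_gmodule I)" for x
    using that homog_idealD[OF assms] by (intro bexI[of _ "- x"]) auto
qed (use homog_idealD[OF assms] in \<open>auto simp: ac_simps\<close>)

lemma module_ideal:
  assumes "homog_ideal I" shows "module S_ring (ideal_gmodule I)"
  by (rule moduleI[OF cring_S abelian_group_ideal[OF assms]])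
    (use homog_idealD[OF assms] in \<open>auto simp: distrib_left distrib_right mult.assoc\<close>)

lemma finsum_ideal:
  assumes "homog_ideal I" "finite D" "\<And>n. n \<in> D \<Longrightarrow> y n \<in> I"
  shows "finsum (ideal_gmodule I) y D = sum y D"
proof -
  interpret abelian_group "ideal_gmodule I" by (rule abelian_group_ideal[OF assms(1)])
  from assms(2,3) show ?thesis by (induction D) (simp_all add: Pi_def)
qed

locale quotient_ideal =
  fixes I J :: "'k::field poly3 set"
  assumes I: "homog_ideal I" and J: "homog_ideal J" and sub: "J \<subseteq> I"
begin

abbreviation "Q \<equiv> gquot (ideal_gmodule I) J"

definition cl :: "'k poly3 \<Rightarrow> 'k poly3 set" where
  "cl x = (\<lambda>j. j + x) ` J"

lemma a_r_coset_cl: "J +>\<^bsub>ideal_gmodule I\<^esub> x = cl x"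
  by (auto simp: a_r_coset_def r_coset_def cl_def)

lemma mem_cl: "z \<in> cl x \<longleftrightarrow> z - x \<in> J"
  unfolding cl_def by (auto simp: image_iff intro: bexI[of _ "z - x"])

lemma cl_eq_iff: "cl x = cl y \<longleftrightarrow> x - y \<in> J"
proof
  assume "cl x = cl y"
  moreover have "x \<in> cl x" using homog_idealD(1)[OF J] by (simp add: mem_cl)
  ultimately show "x - y \<in> J" by (simp add: mem_cl)
next
  assume xy: "x - y \<in> J"
  have "z - x \<in> J \<longleftrightarrow> z - y \<in> J" for z
  proof
    assume "z - x \<in> J"
    then have "(z - x) + (x - y) \<in> J" using homog_idealD(2)[OF J] xy by blast
    then show "z - y \<in> J" by simp
  next
    assume "z - y \<in> J"
    then have "(z - y) - (x - y) \<in> J" using homog_idealD(6)[OF J] xy by blast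
    then show "z - x \<in> J" by simp
  qed
  then show "cl x = cl y" by (auto simp: mem_cl)
qed

lemma cl_0: "cl 0 = J"
  by (auto simp: cl_def)

lemma cl_eq_J_iff: "cl x = J \<longleftrightarrow> x \<in> J"
  using cl_eq_iff[of x 0] by (simp add: cl_0)

lemma Q_carrier: "carrier Q = cl ` I"
  by (auto simp: gquot_def A_RCOSETS_def RCOSETS_def cl_def r_coset_def)

lemma Q_zero: "\<zero>\<^bsub>Q\<^esub> = cl 0"
  by (simp add: gquot_def cl_0)

lemma Q_add: "cl x \<oplus>\<^bsub>Q\<^esub> cl y = cl (x + y)"
proof -
  have "cl x <+>\<^bsub>ideal_gmodule I\<^esub> cl y = cl (x + y)"
  proof
    show "cl x <+>\<^bsub>ideal_gmodule I\<^esub> cl y \<subseteq> cl (x + y)"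
    proof
      fix z assume "z \<in> cl x <+>\<^bsub>ideal_gmodule I\<^esub> cl y"
      then obtain u v where "u \<in> cl x" "v \<in> cl y" "z = u + v" by (auto simp: set_add_def set_mult_def)
      then have "(u - x) + (v - y) \<in> J" using homog_idealD(2)[OF J] by (simp add: mem_cl)
      then show "z \<in> cl (x + y)" using \<open>z = u + v\<close> by (simp add: mem_cl algebra_simps)
    qed
    show "cl (x + y) \<subseteq> cl x <+>\<^bsub>ideal_gmodule I\<^esub> cl y"
    proof
      fix z assume "z \<in> cl (x + y)"
      then have "z - y \<in> cl x" by (simp add: mem_cl algebra_simps)
      moreover have "y \<in> cl y" using homog_idealD(1)[OF J] by (simp add: mem_cl)
      ultimately have "\<exists>u\<in>cl x. \<exists>v\<in>cl y. z = u + v"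
        by (intro bexI[of _ "z - y"] bexI[of _ y]) auto
      then show "z \<in> cl x <+>\<^bsub>ideal_gmodule I\<^esub> cl y" by (auto simp: set_add_def set_mult_def)
    qed
  qed
  then show ?thesis by (simp add: gquot_def)
qed

lemma Q_smult: "p \<odot>\<^bsub>Q\<^esub> cl x = cl (p * x)"
proof -
  have "cl (p * z) = cl (p * x)" if "z \<in> cl x" for z
    using that homog_idealD(3)[OF J, of "z - x" p] by (simp add: cl_eq_iff mem_cl right_diff_distrib)
  moreover have "x \<in> cl x" using homog_idealD(1)[OF J] by (simp add: mem_cl)
  ultimately have "(\<Union>z\<in>cl x. cl (p * z)) = cl (p * x)" by blast
  then show ?thesis by (simp add: gquot_def a_r_coset_cl)
qed

lemma Q_hcomp: "hcomp Q n = cl ` (I \<inter> homog n)"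
  by (simp add: gquot_def a_r_coset_cl)

lemma abelian_group_Q: "abelian_group Q"
proof (rule abelian_groupI)
  fix C assume "C \<in> carrier Q"
  then obtain x where x: "x \<in> I" "C = cl x" by (auto simp: Q_carrier)
  show "\<zero>\<^bsub>Q\<^esub> \<oplus>\<^bsub>Q\<^esub> C = C" by (simp add: x Q_zero Q_add)
  show "\<exists>D\<in>carrier Q. D \<oplus>\<^bsub>Q\<^esub> C = \<zero>\<^bsub>Q\<^esub>"
    using homog_idealD(5)[OF I x(1)] by (intro bexI[of _ "cl (- x)"]) (auto simp: x Q_add Q_zero Q_carrier)
  fix D assume "D \<in> carrier Q"
  then obtain y where y: "y \<in> I" "D = cl y" by (auto simp: Q_carrier)
  show "C \<oplus>\<^bsub>Q\<^esub> D \<in> carrier Q" using homog_idealD(2)[OF I] x y by (auto simp: Q_add Q_carrier)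
  show "C \<oplus>\<^bsub>Q\<^esub> D = D \<oplus>\<^bsub>Q\<^esub> C" by (simp add: x y Q_add add.commute)
  fix E assume "E \<in> carrier Q"
  then obtain z where z: "z \<in> I" "E = cl z" by (auto simp: Q_carrier)
  show "C \<oplus>\<^bsub>Q\<^esub> D \<oplus>\<^bsub>Q\<^esub> E = C \<oplus>\<^bsub>Q\<^esub> (D \<oplus>\<^bsub>Q\<^esub> E)" by (simp add: x y z Q_add add.assoc)
next
  show "\<zero>\<^bsub>Q\<^esub> \<in> carrier Q" using homog_idealD(1)[OF I] by (auto simp: Q_zero Q_carrier)
qed

lemma module_Q: "module S_ring Q"
proof (rule moduleI[OF cring_S abelian_group_Q])
  fix p q and C assume "C \<in> carrier Q"
  then obtain x where x: "x \<in> I" "C = cl x" by (auto simp: Q_carrier)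
  show "p \<odot>\<^bsub>Q\<^esub> C \<in> carrier Q" using homog_idealD(3)[OF I x(1)] by (auto simp: x Q_smult Q_carrier)
  show "(p \<oplus>\<^bsub>S_ring\<^esub> q) \<odot>\<^bsub>Q\<^esub> C = p \<odot>\<^bsub>Q\<^esub> C \<oplus>\<^bsub>Q\<^esub> q \<odot>\<^bsub>Q\<^esub> C" by (simp add: x Q_smult Q_add distrib_right)
  show "(p \<otimes>\<^bsub>S_ring\<^esub> q) \<odot>\<^bsub>Q\<^esub> C = p \<odot>\<^bsub>Q\<^esub> (q \<odot>\<^bsub>Q\<^esub> C)" by (simp add: x Q_smult mult.assoc)
  show "\<one>\<^bsub>S_ring\<^esub> \<odot>\<^bsub>Q\<^esub> C = C" by (simp add: x Q_smult)
  fix D assume "D \<in> carrier Q"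
  then obtain y where y: "y \<in> I" "D = cl y" by (auto simp: Q_carrier)
  show "p \<odot>\<^bsub>Q\<^esub> (C \<oplus>\<^bsub>Q\<^esub> D) = p \<odot>\<^bsub>Q\<^esub> C \<oplus>\<^bsub>Q\<^esub> p \<odot>\<^bsub>Q\<^esub> D" by (simp add: x y Q_smult Q_add distrib_left)
qed

lemma finsum_Q:
  assumes "finite D" "\<And>n. n \<in> D \<Longrightarrow> w n \<in> I"
  shows "finsum Q (\<lambda>n. cl (w n)) D = cl (sum w D)"
proof -
  interpret abelian_group Q by (rule abelian_group_Q)
  from assms show ?thesis
  proof (induction D)
    case empty
    then show ?case by (simp add: Q_zero)
  next
    case (insert d D)
    then have "finsum Q (\<lambda>n. cl (w n)) (insert d D) = cl (w d) \<oplus>\<^bsub>Q\<^esub> finsum Q (\<lambda>n. cl (w n)) D"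
      by (intro finsum_insert) (auto simp: Q_carrier)
    then show ?case using insert by (simp add: Q_add)
  qed
qed

definition Q_proj :: "int \<Rightarrow> 'k poly3 set \<Rightarrow> 'k poly3 set" where
  "Q_proj n C = cl (hproj n (SOME x. cl x = C))"

text \<open>Independent of the representative because \<open>J\<close> contains the components of
  its elements.\<close>

lemma Q_proj_cl: "Q_proj n (cl x) = cl (hproj n x)"
proof -
  have "cl (SOME z. cl z = cl x) = cl x" by (rule someI[of "\<lambda>z. cl z = cl x"]) simp
  then have "hproj n ((SOME z. cl z = cl x) - x) \<in> J" by (intro homog_idealD(4)[OF J]) (simp add: cl_eq_iff)
  then show ?thesis by (simp add: Q_proj_def cl_eq_iff hproj_diff)
qed

lemma graded_module_Q: "graded_module Q"
proof (rule graded_moduleI[OF module_Q])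
  show "C \<oplus>\<^bsub>Q\<^esub> D \<in> hcomp Q n" if "C \<in> hcomp Q n" "D \<in> hcomp Q n" for n C D
    using that homog_idealD(2)[OF I] by (auto simp: Q_hcomp Q_add homog_add intro!: imageI)
  show "p \<odot>\<^bsub>Q\<^esub> C \<in> hcomp Q (i + j)" if "p \<in> homog i" "C \<in> hcomp Q j" for i j p C
    using that homog_idealD(3)[OF I] by (auto simp: Q_hcomp Q_smult homog_mult intro!: imageI)
  show "\<zero>\<^bsub>Q\<^esub> \<in> hcomp Q n" for n
    using homog_idealD(1)[OF I] by (auto simp: Q_hcomp Q_zero intro!: imageI)
  show "hcomp Q n \<subseteq> carrier Q" for n by (auto simp: Q_hcomp Q_carrier)
  show "Q_proj n (C \<oplus>\<^bsub>Q\<^esub> D) = Q_proj n C \<oplus>\<^bsub>Q\<^esub> Q_proj n D" if "C \<in> carrier Q" "D \<in> carrier Q" for n C D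
    using that by (auto simp: Q_carrier Q_add Q_proj_cl hproj_add)
  show "Q_proj n C = (if n = m then C else \<zero>\<^bsub>Q\<^esub>)" if "C \<in> hcomp Q m" for n m C
    using that by (auto simp: Q_hcomp Q_proj_cl Q_zero hproj_of_homog)
  fix C assume "C \<in> carrier Q"
  then obtain x where x: "x \<in> I" "C = cl x" by (auto simp: Q_carrier)
  have hI: "hproj n x \<in> I" for n by (rule homog_idealD(4)[OF I x(1)])
  show "Q_proj n C \<in> hcomp Q n" for n
    using hI by (auto simp: x(2) Q_proj_cl Q_hcomp hproj_homog intro!: imageI)
  define D where "D = {n. Q_proj n C \<noteq> \<zero>\<^bsub>Q\<^esub>}"
  have D: "n \<in> D \<longleftrightarrow> hproj n x \<notin> J" for n by (simp add: D_def x(2) Q_proj_cl Q_zero cl_0 cl_eq_J_iff)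
  have sub': "D \<subseteq> degs x"
  proof
    fix n assume "n \<in> D"
    then have "hproj n x \<notin> J" by (simp add: D)
    then have "hproj n x \<noteq> 0" using homog_idealD(1)[OF J] by metis
    then show "n \<in> degs x" using hproj_notin_degs by blast
  qed
  have fin: "finite D" by (rule finite_subset[OF sub' finite_degs])
  show "finite {n. Q_proj n C \<noteq> \<zero>\<^bsub>Q\<^esub>}" using fin by (simp add: D_def)
  show "C = finsum Q (\<lambda>n. Q_proj n C) {n. Q_proj n C \<noteq> \<zero>\<^bsub>Q\<^esub>}"
    unfolding D_def[symmetric]
  proof -
    \<comment> \<open>Components lying in \<open>J\<close> vanish in the quotient, so
      \<open>x\<close> may be replaced by the sum of the others.\<close>
    have "x = (\<Sum>n\<in>degs x. hproj n x)" by (rule hproj_decomp) auto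
    also have "\<dots> = (\<Sum>n\<in>D. hproj n x) + (\<Sum>n\<in>degs x - D. hproj n x)"
      using sum.subset_diff[OF sub' finite_degs] by (simp add: add.commute)
    finally have "x - (\<Sum>n\<in>D. hproj n x) = (\<Sum>n\<in>degs x - D. hproj n x)" by (simp add: diff_eq_eq add.commute)
    moreover have "(\<Sum>n\<in>degs x - D. hproj n x) \<in> J" by (rule homog_idealD(7)[OF J]) (simp add: D)
    ultimately have "cl x = cl (\<Sum>n\<in>D. hproj n x)" by (simp add: cl_eq_iff)
    also have "\<dots> = finsum Q (\<lambda>n. cl (hproj n x)) D" by (rule finsum_Q[symmetric, OF fin hI])
    finally show "C = finsum Q (\<lambda>n. Q_proj n C) D" unfolding x(2) Q_proj_cl .
  qed
qed

end

lemma graded_module_ideal: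
  assumes I: "homog_ideal I" shows "graded_module (ideal_gmodule I)"
proof (rule graded_moduleI[of _ hproj, OF module_ideal[OF I]])
  fix x assume "x \<in> carrier (ideal_gmodule I)"
  then have x: "x \<in> I" by simp
  have hI: "hproj n x \<in> I" for n by (rule homog_idealD(4)[OF I x])
  then show "hproj n x \<in> hcomp (ideal_gmodule I) n" for n by (simp add: hproj_homog)
  have sub: "{n. hproj n x \<noteq> 0} \<subseteq> degs x" by (auto intro: ccontr simp: hproj_notin_degs)
  have fin: "finite {n. hproj n x \<noteq> 0}" by (rule finite_subset[OF sub finite_degs])
  show "finite {n. hproj n x \<noteq> \<zero>\<^bsub>ideal_gmodule I\<^esub>}" using fin by simp
  have "finsum (ideal_gmodule I) (\<lambda>n. hproj n x) {n. hproj n x \<noteq> 0} = (\<Sum>n\<in>{n. hproj n x \<noteq> 0}. hproj n x)"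
    by (rule finsum_ideal[OF I fin hI])
  also have "\<dots> = (\<Sum>n\<in>degs x. hproj n x)" by (rule sum.mono_neutral_left[OF finite_degs sub]) auto
  also have "\<dots> = x" by (rule hproj_decomp[symmetric]) auto
  finally show "x = finsum (ideal_gmodule I) (\<lambda>n. hproj n x) {n. hproj n x \<noteq> \<zero>\<^bsub>ideal_gmodule I\<^esub>}" by simp
qed (use homog_idealD(1-3)[OF I] in \<open>auto simp: homog_add homog_mult hproj_add hproj_of_homog\<close>)

section \<open>The resolutions in coordinates\<close>

text \<open>A graded functional commutes with projection to a degree, as the expansion in a
  homogeneous basis shows. This lets homogeneity of a relation be read off from its
  coefficients.\<close>

lemma (in graded_coords) component:
  assumes add: "\<And>x y. x \<in> carrier N \<Longrightarrow> y \<in> carrier N \<Longrightarrow> L (x \<oplus>\<^bsub>N\<^esub> y) = L x + L y"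
    and smult: "\<And>p x. x \<in> carrier N \<Longrightarrow> L (p \<odot>\<^bsub>N\<^esub> x) = p * L x"
    and graded: "\<And>n x. x \<in> hcomp N n \<Longrightarrow> L x \<in> homog (n + s)"
    and x: "x \<in> carrier N"
  shows "L (elt (\<lambda>i. hproj (n + a i) (c x i))) = hproj (n + s) (L x)"
proof -
  have "L (elt (\<lambda>i. hproj (n + a i) (c x i))) = (\<Sum>i\<in>I. hproj (n + a i) (c x i) * L (basis i))"
    by (subst linear_expand[of L, OF add smult elt_closed]) (simp_all add: coords_elt)
  also have "\<dots> = (\<Sum>i\<in>I. hproj (n + s) (c x i * L (basis i)))"
  proof (rule sum.cong[OF refl])
    fix i
    have "hproj (n + s) (L (basis i) * c x i) = L (basis i) * hproj (n + s - (- a i + s)) (c x i)"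
      by (rule hproj_mult[OF graded[OF basis_hcomp]])
    then show "hproj (n + a i) (c x i) * L (basis i) = hproj (n + s) (c x i * L (basis i))"
      by (simp add: mult.commute)
  qed
  also have "\<dots> = hproj (n + s) (L x)"
    by (simp only: linear_expand[of L, OF add smult x] hproj_sum)
  finally show ?thesis .
qed

locale nonfree_lines = distinct_lines A l f fd
  for A :: "'x set" and l :: "'x \<Rightarrow> 'k::field_char_0 poly3" and f fd +
  assumes not_saturated: "\<exists>g\<in>saturation (Jac f). g \<notin> Jac f"
begin

abbreviation "n0 \<equiv> int (card A) - 1"

lemma no_unit:
  assumes "dot e fd = 0" "dot e' fd = 0" shows "\<not> om e e' dvd 1"
proof
  assume u: "om e e' dvd 1"
  obtain g where g: "g \<in> saturation (Jac f)" "g \<notin> Jac f" using not_saturated by blast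
  obtain k where "\<And>i. var i ^ k * g \<in> Jac f" using saturation_var_power[OF g(1)] by blast
  then have "\<exists>a. var i ^ k * g = dot a fd" for i unfolding Jac_eq_dot by blast
  from om_unit_saturated[OF assms u regular_triple_var_power this] g(2) show False
    unfolding Jac_eq_dot by blast
qed

text \<open>The partial derivatives all have degree d - 1, so the constant terms of a syzygy form a
  syzygy themselves, and a nonzero constant one would make the Jacobian ideal saturated. This gives
  both the independence of the partial derivatives and minimality at the free module of rank
  3.\<close>

lemma syzygy_lookup_0:
  assumes e: "dot e fd = 0" shows "lookup (e i) 0 = 0"
proof (rule ccontr)
  assume nz: "lookup (e i) 0 \<noteq> 0"
  define c where "c = (\<lambda>j. hproj 0 (e j))"
  have c: "c j = cst (lookup (e j) 0)" for j
  proof -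
    have "c j = cst (lookup (c j) 0)" unfolding c_def by (rule homog_0_cst[OF hproj_homog])
    then show ?thesis by (simp add: c_def lookup_hproj mon_degree_def)
  qed
  have "hproj n0 (fd j * e j) = fd j * hproj 0 (e j)" for j
    using hproj_mult[OF fd_homog, of n0 j "e j"] by simp
  then have "dot c fd = hproj n0 (dot e fd)"
    unfolding dot_def c_def by (simp add: hproj_add mult.commute)
  then have d: "dot c fd = 0" using e by simp
  \<comment> \<open>A vector with \<open>dot n c = 1\<close>: the inverse of the nonzero constant
    entry, placed at its index.\<close>
  define n where "n = (\<lambda>j. if j = i then cst (1 / lookup (e i) 0) else 0)"
  have "n i * c i = 1" using nz by (simp add: n_def c mult_single)
  moreover have "\<forall>i. n i * c i = 1 \<longrightarrow> (\<forall>j. j \<noteq> i \<longrightarrow> n j = 0) \<longrightarrow> dot n c = 1"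
    unfolding forall3 dot_def by simp
  moreover have "\<forall>j. j \<noteq> i \<longrightarrow> n j = 0" by (simp add: n_def)
  ultimately have n: "dot n c = 1" by blast
  obtain g where g: "g \<in> saturation (Jac f)" "g \<notin> Jac f" using not_saturated by blast
  obtain k where "\<And>i. var i ^ k * g \<in> Jac f" using saturation_var_power[OF g(1)] by blast
  then have "\<exists>a. var i ^ k * g = dot a fd" for i unfolding Jac_eq_dot by blast
  from constant_syzygy_saturated[OF d n regular_triple_var_power this] g(2) show False
    unfolding Jac_eq_dot by blast
qed

end

text \<open>\<open>G\<close> is identified with the relations between the partial derivatives and further generators
  \<open>h t\<close> of the saturation, \<open>t \<in> T\<close>: a relation \<open>g\<close> has coefficients \<open>qq g\<close> and \<open>cc g\<close>.\<close>

locale saturation_relations = nonfree_lines A l f fd +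
  G: graded_coords G IG aG cG + P: graded_coords P T aP cP
  for A :: "'x set" and l :: "'x \<Rightarrow> 'k::field_char_0 poly3" and f fd
    and G :: "('k poly3, 'g) gmodule" and IG :: "'i set" and aG cG
    and P :: "('k poly3, 'p) gmodule" and T :: "'t set" and aP cP +
  fixes qq :: "'g \<Rightarrow> 3 \<Rightarrow> 'k poly3" and cc :: "'g \<Rightarrow> 't \<Rightarrow> 'k poly3" and h :: "'t \<Rightarrow> 'k poly3"
  assumes qq_add: "g \<in> carrier G \<Longrightarrow> g' \<in> carrier G \<Longrightarrow> qq (g \<oplus>\<^bsub>G\<^esub> g') i = qq g i + qq g' i"
    and qq_smult: "g \<in> carrier G \<Longrightarrow> qq (p \<odot>\<^bsub>G\<^esub> g) i = p * qq g i"
    and cc_add: "g \<in> carrier G \<Longrightarrow> g' \<in> carrier G \<Longrightarrow> t \<in> T \<Longrightarrow> cc (g \<oplus>\<^bsub>G\<^esub> g') t = cc g t + cc g' t"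
    and cc_smult: "g \<in> carrier G \<Longrightarrow> t \<in> T \<Longrightarrow> cc (p \<odot>\<^bsub>G\<^esub> g) t = p * cc g t"
    and relation: "g \<in> carrier G \<Longrightarrow> dot (qq g) fd + (\<Sum>t\<in>T. cc g t * h t) = 0"
    and relation_ex: "dot q fd + (\<Sum>t\<in>T. c t * h t) = 0 \<Longrightarrow>
      \<exists>g\<in>carrier G. (\<forall>i. qq g i = q i) \<and> (\<forall>t\<in>T. cc g t = c t)"
    and relation_inj: "g \<in> carrier G \<Longrightarrow> g' \<in> carrier G \<Longrightarrow> (\<And>i. qq g i = qq g' i) \<Longrightarrow>
      (\<And>t. t \<in> T \<Longrightarrow> cc g t = cc g' t) \<Longrightarrow> g = g'"
    and qq_homog: "g \<in> hcomp G n \<Longrightarrow> qq g i \<in> homog (n - (int (card A) - 1))"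
    and cc_homog: "g \<in> hcomp G n \<Longrightarrow> t \<in> T \<Longrightarrow> cc g t \<in> homog (n + aP t)"
    and h_homog: "t \<in> T \<Longrightarrow> h t \<in> homog (- aP t)"
    and cc_lookup_0: "g \<in> carrier G \<Longrightarrow> t \<in> T \<Longrightarrow> lookup (cc g t) 0 = 0"
    and saturation_eq: "saturation (Jac f) = {dot q fd + (\<Sum>t\<in>T. c t * h t) | q c. True}"
begin

lemma h_saturation: "t \<in> T \<Longrightarrow> h t \<in> saturation (Jac f)"
proof -
  assume t: "t \<in> T"
  have "(\<Sum>s\<in>T. (if s = t then 1 else 0) * h s) = (\<Sum>s\<in>T. if s = t then h s else 0)"
    by (rule sum.cong) auto
  also have "\<dots> = h t" using t P.finite_I by simp
  finally have "h t = dot (\<lambda>_. 0) fd + (\<Sum>s\<in>T. (if s = t then 1 else 0) * h s)"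
    by (simp add: dot_def)
  then show ?thesis
    unfolding saturation_eq by (intro CollectI exI[of _ "\<lambda>_. 0"] exI[of _ "\<lambda>s. if s = t then 1 else 0"] conjI TrueI)
qed

lemma homog_ideal_saturation: "homog_ideal (saturation (Jac f))"
  unfolding homog_ideal_def
proof (intro conjI ballI allI)
  have mem: "dot q fd + (\<Sum>t\<in>T. c t * h t) \<in> saturation (Jac f)" for q c
    unfolding saturation_eq by blast
  show "0 \<in> saturation (Jac f)" using mem[of "\<lambda>_. 0" "\<lambda>_. 0"] by (simp add: dot_def)
  fix x assume "x \<in> saturation (Jac f)"
  then obtain q c where x: "x = dot q fd + (\<Sum>t\<in>T. c t * h t)" unfolding saturation_eq by blast
  have "p * x = dot (\<lambda>i. p * q i) fd + (\<Sum>t\<in>T. (p * c t) * h t)" for p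
    unfolding x dot_def by (simp add: distrib_left sum_distrib_left mult.assoc)
  then show "p * x \<in> saturation (Jac f)" for p using mem by simp
  have "hproj n x = dot (\<lambda>i. hproj (n - n0) (q i)) fd + (\<Sum>t\<in>T. hproj (n + aP t) (c t) * h t)" for n
  proof -
    have "hproj n (q i * fd i) = hproj (n - n0) (q i) * fd i" for i
      using hproj_mult[OF fd_homog, of n i "q i"] by (simp add: mult.commute)
    moreover have "hproj n (c t * h t) = hproj (n + aP t) (c t) * h t" if "t \<in> T" for t
      using hproj_mult[OF h_homog[OF that], of n "c t"] by (simp add: mult.commute)
    ultimately show ?thesis unfolding x dot_def hproj_add hproj_sum by simp
  qed
  then show "hproj n x \<in> saturation (Jac f)" for n using mem by simp
  fix y assume "y \<in> saturation (Jac f)"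
  then obtain q' c' where y: "y = dot q' fd + (\<Sum>t\<in>T. c' t * h t)" unfolding saturation_eq by blast
  have "x + y = dot (\<lambda>i. q i + q' i) fd + (\<Sum>t\<in>T. (c t + c' t) * h t)"
    unfolding x y dot_def by (simp add: distrib_right sum.distrib)
  then show "x + y \<in> saturation (Jac f)" using mem by simp
qed

lemma homog_ideal_Jac: "homog_ideal (Jac f)"
  unfolding homog_ideal_def
proof (intro conjI ballI allI)
  have mem: "dot q fd \<in> Jac f" for q unfolding Jac_eq_dot by blast
  show "0 \<in> Jac f" using mem[of "\<lambda>_. 0"] by (simp add: dot_def)
  fix x assume "x \<in> Jac f"
  then obtain q where x: "x = dot q fd" unfolding Jac_eq_dot by blast
  have "p * x = dot (\<lambda>i. p * q i) fd" for p
    unfolding x dot_def by (simp add: distrib_left mult.assoc)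
  then show "p * x \<in> Jac f" for p using mem by simp
  have "hproj n x = dot (\<lambda>i. hproj (n - n0) (q i)) fd" for n
  proof -
    have "hproj n (q i * fd i) = hproj (n - n0) (q i) * fd i" for i
      using hproj_mult[OF fd_homog, of n i "q i"] by (simp add: mult.commute)
    then show ?thesis unfolding x dot_def hproj_add by simp
  qed
  then show "hproj n x \<in> Jac f" for n using mem by simp
  fix y assume "y \<in> Jac f"
  then obtain q' where y: "y = dot q' fd" unfolding Jac_eq_dot by blast
  have "x + y = dot (\<lambda>i. q i + q' i) fd" unfolding x y dot_def by (simp add: algebra_simps)
  then show "x + y \<in> Jac f" using mem by simp
qed

text \<open>The converse of \<open>qq_homog\<close> and \<open>cc_homog\<close>: projecting
  \<open>g\<close> to degree \<open>n\<close> leaves its coefficients unchanged, and a relation is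
  determined by them.\<close>

lemma hcomp_G_I:
  assumes g: "g \<in> carrier G" and q: "\<And>i. qq g i \<in> homog (n - n0)" and c: "\<And>t. t \<in> T \<Longrightarrow> cc g t \<in> homog (n + aP t)"
  shows "g \<in> hcomp G n"
proof -
  let ?g = "G.elt (\<lambda>i. hproj (n + aG i) (cG g i))"
  have "?g = g"
  proof (rule relation_inj[OF G.elt_closed g])
    show "qq ?g i = qq g i" for i
    proof -
      have "qq ?g i = hproj (n + - n0) (qq g i)"
      proof (rule G.component[of "\<lambda>g. qq g i" "- n0", OF qq_add qq_smult _ g])
        show "qq x i \<in> homog (m + - n0)" if "x \<in> hcomp G m" for m x
          unfolding diff_conv_add_uminus[symmetric] by (rule qq_homog[OF that])
      qed
      also have "\<dots> = qq g i"
        unfolding diff_conv_add_uminus[symmetric] using hproj_of_homog[OF q, of "n - n0" i] by simp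
      finally show ?thesis .
    qed
    show "cc ?g t = cc g t" if t: "t \<in> T" for t
      using G.component[of "\<lambda>g. cc g t" "aP t", OF cc_add[OF _ _ t] cc_smult[OF _ t] cc_homog[OF _ t] g, of n]
        hproj_of_homog[OF c[OF t], of "n + aP t"] by simp
  qed
  moreover have "?g \<in> hcomp G n" by (simp add: G.hcomp_eq G.elt_closed G.coords_elt hproj_homog)
  ultimately show ?thesis by simp
qed

text \<open>The embedding of the syzygies into \<open>G\<close>: a syzygy is a relation that does
  not involve the generators \<open>h t\<close>.\<close>

definition iota :: "(3 \<Rightarrow> 'k poly3) \<Rightarrow> 'g" where
  "iota e = (SOME g. g \<in> carrier G \<and> (\<forall>i. qq g i = e i) \<and> (\<forall>t\<in>T. cc g t = 0))"

lemma iota: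
  assumes "dot e fd = 0"
  shows "iota e \<in> carrier G" "qq (iota e) i = e i" "t \<in> T \<Longrightarrow> cc (iota e) t = 0"
proof -
  have "\<exists>g. g \<in> carrier G \<and> (\<forall>i. qq g i = e i) \<and> (\<forall>t\<in>T. cc g t = 0)"
    using relation_ex[of e "\<lambda>_. 0"] assms by auto
  from someI_ex[OF this] show "iota e \<in> carrier G" "qq (iota e) i = e i" "t \<in> T \<Longrightarrow> cc (iota e) t = 0"
    unfolding iota_def by auto
qed

lemma iota_eqI: "g \<in> carrier G \<Longrightarrow> (\<And>t. t \<in> T \<Longrightarrow> cc g t = 0) \<Longrightarrow> (\<And>i. e i = qq g i) \<Longrightarrow> iota e = g"
  and syzygy_qq: "g \<in> carrier G \<Longrightarrow> (\<And>t. t \<in> T \<Longrightarrow> cc g t = 0) \<Longrightarrow> dot (qq g) fd = 0"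
proof -
  show *: "dot (qq g) fd = 0" if "g \<in> carrier G" "\<And>t. t \<in> T \<Longrightarrow> cc g t = 0" for g
    using relation[OF that(1)] that(2) by simp
  assume g: "g \<in> carrier G" "\<And>t. t \<in> T \<Longrightarrow> cc g t = 0" and e: "\<And>i. e i = qq g i"
  have "dot e fd = 0" using *[OF g] by (simp add: dot_def e)
  note i = iota[OF this]
  show "iota e = g" by (rule relation_inj[OF i(1) g(1)]) (simp_all add: i g e)
qed

lemma iota_add:
  assumes "dot x fd = 0" "dot x' fd = 0"
  shows "iota (\<lambda>i. x i + x' i) = iota x \<oplus>\<^bsub>G\<^esub> iota x'"
  by (rule iota_eqI) (simp_all add: iota[OF assms(1)] iota[OF assms(2)] G.closed cc_add qq_add)

lemma iota_smult:
  assumes "dot x fd = 0"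
  shows "iota (\<lambda>i. p * x i) = p \<odot>\<^bsub>G\<^esub> iota x"
  by (rule iota_eqI) (simp_all add: iota[OF assms] G.closed cc_smult qq_smult)

definition kappa :: "3 \<Rightarrow> 'g" where "kappa i = iota (cross (unit3 i) fd)"

lemma kappa_closed: "kappa i \<in> carrier G"
  unfolding kappa_def by (rule iota(1)[OF dot_koszul])

text \<open>The entries are partial derivatives up to sign, of degree d - 1, and they are
  coefficients of generators of degree d - 1.\<close>

lemma kappa_hcomp: "kappa i \<in> hcomp G (2 * n0)"
proof (rule hcomp_G_I[OF kappa_closed])
  have u: "unit3 i j \<in> homog 0" for i j by (simp add: unit3_def homog_1)
  have "unit3 i j * fd k \<in> homog n0" for j k by (rule homog_mult'[OF u fd_homog]) simp
  then have "cross (unit3 i) fd j \<in> homog n0" for j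
    unfolding cross_def by (auto intro!: homog_diff)
  then show "qq (kappa i) j \<in> homog (2 * n0 - n0)" for j
    unfolding kappa_def iota(2)[OF dot_koszul] by simp
  show "t \<in> T \<Longrightarrow> cc (kappa i) t \<in> homog (2 * n0 + aP t)" for t
    unfolding kappa_def using iota(3)[OF dot_koszul] by simp
qed

text \<open>The syzygy that represents the restriction of \<open>L\<close> to the syzygies with respect to \<open>om\<close>.\<close>

definition ev :: "('g \<Rightarrow> 'k poly3) \<Rightarrow> 3 \<Rightarrow> 'k poly3" where
  "ev L i = - L (kappa i)"

lemma S_linear_G:
  assumes "L \<in> S_linear G S_mod"
  shows "g \<in> carrier G \<Longrightarrow> g' \<in> carrier G \<Longrightarrow> L (g \<oplus>\<^bsub>G\<^esub> g') = L g + L g'"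
    "g \<in> carrier G \<Longrightarrow> L (p \<odot>\<^bsub>G\<^esub> g) = p * L g"
  using S_linearD[OF assms] by simp_all

lemma functional_ev:
  assumes L: "L \<in> S_linear G S_mod"
  shows "dot (ev L) fd = 0" "dot x fd = 0 \<Longrightarrow> L (iota x) = om (ev L) x"
proof -
  note F = functional_om[of "\<lambda>x. L (iota x)" "ev L"]
  have add: "L (iota (\<lambda>i. x i + x' i)) = L (iota x) + L (iota x')" if "dot x fd = 0" "dot x' fd = 0" for x x'
    using that by (simp add: iota_add S_linear_G[OF L] iota)
  have smult: "L (iota (\<lambda>i. p * x i)) = p * L (iota x)" if "dot x fd = 0" for p x
    using that by (simp add: iota_smult S_linear_G[OF L] iota)
  have e: "ev L = (\<lambda>i. - L (iota (cross (unit3 i) fd)))" by (simp add: ev_def kappa_def fun_eq_iff)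
  show "dot (ev L) fd = 0" by (rule F(1)[OF add smult e])
  show "dot x fd = 0 \<Longrightarrow> L (iota x) = om (ev L) x" by (rule F(2)[OF add smult e])
qed

lemma ev_homog:
  assumes "\<And>j. L ` hcomp G j \<subseteq> homog (j + m)"
  shows "ev L i \<in> homog (2 * n0 + m)"
  unfolding ev_def using assms[of "2 * n0"] kappa_hcomp[of i] by (auto intro!: homog_uminus)

lemma iota_hcomp:
  assumes "dot e fd = 0" "\<And>i. e i \<in> homog (n - n0)" shows "iota e \<in> hcomp G n"
  by (rule hcomp_G_I[OF iota(1)[OF assms(1)]]) (simp_all add: iota[OF assms(1)] assms(2))

text \<open>Surjectivity of restriction from functionals on \<open>G\<close> to functionals on the
  syzygies, the place where Ext^2(M, S) = 0 enters: \<open>om e\<close> extends, and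
  \<open>om_koszul\<close> recovers \<open>e\<close> from the extension.\<close>

lemma ev_surj:
  assumes e: "dot e fd = 0"
  shows "\<exists>L\<in>carrier (dual G). \<forall>i. ev L i = e i"
proof -
  obtain K where K: "\<And>t i. t \<in> T \<Longrightarrow> var i ^ K * h t \<in> Jac f"
    using saturation_common_power[of T h f, OF P.finite_I h_saturation] by blast
  then have h: "\<exists>a. var i ^ K * h t = dot a fd" if "t \<in> T" for i t
    using that unfolding Jac_eq_dot by blast
  obtain L :: "(3 \<Rightarrow> 'k poly3) \<Rightarrow> ('t \<Rightarrow> 'k poly3) \<Rightarrow> 'k poly3" where
    L_add: "\<And>q q' q'' c c' c''. dot q fd + (\<Sum>t\<in>T. c t * h t) = 0 \<Longrightarrow> dot q' fd + (\<Sum>t\<in>T. c' t * h t) = 0 \<Longrightarrow>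
      (\<And>s. q'' s = q s + q' s) \<Longrightarrow> (\<And>t. t \<in> T \<Longrightarrow> c'' t = c t + c' t) \<Longrightarrow> L q'' c'' = L q c + L q' c'"
    and L_smult: "\<And>p q q' c c'. dot q fd + (\<Sum>t\<in>T. c t * h t) = 0 \<Longrightarrow> (\<And>s. q' s = p * q s) \<Longrightarrow>
      (\<And>t. t \<in> T \<Longrightarrow> c' t = p * c t) \<Longrightarrow> L q' c' = p * L q c"
    and L_om: "\<And>q c. dot q fd = 0 \<Longrightarrow> (\<And>t. t \<in> T \<Longrightarrow> c t = 0) \<Longrightarrow> L q c = om e q"
    using om_extends[where h = h and T = T and e = e, OF P.finite_I e regular_triple_var_power h] by blast
  define M where "M = restrict (\<lambda>g. L (qq g) (cc g)) (carrier G)"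
  have "M \<in> S_linear G S_mod"
  proof (rule S_linearI)
    show "M (g \<oplus>\<^bsub>G\<^esub> g') = M g \<oplus>\<^bsub>S_mod\<^esub> M g'" if "g \<in> carrier G" "g' \<in> carrier G" for g g'
      using L_add[OF relation[OF that(1)] relation[OF that(2)] qq_add[OF that] cc_add[OF that]] that
      by (simp add: M_def G.closed)
    show "M (p \<odot>\<^bsub>G\<^esub> g) = p \<odot>\<^bsub>S_mod\<^esub> M g" if "g \<in> carrier G" for p g
      using L_smult[OF relation[OF that] qq_smult[OF that] cc_smult[OF that]] that
      by (simp add: M_def G.closed)
  qed simp
  then have "M \<in> carrier (dual G)" by (simp add: M_def)
  moreover have "ev M i = e i" for i
  proof -
    have "qq (kappa i) = cross (unit3 i) fd" unfolding kappa_def by (rule ext) (rule iota(2)[OF dot_koszul])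
    then have "M (kappa i) = om e (cross (unit3 i) fd)"
      using L_om[OF dot_koszul, of "cc (kappa i)" i] iota(3)[OF dot_koszul, of _ i]
      by (simp add: M_def kappa_closed) (simp add: kappa_def)
    then show ?thesis by (simp add: ev_def om_koszul[OF e])
  qed
  ultimately show ?thesis by blast
qed

lemma additive_finsum_G:
  assumes "\<And>g g'. g \<in> carrier G \<Longrightarrow> g' \<in> carrier G \<Longrightarrow> (L (g \<oplus>\<^bsub>G\<^esub> g') :: 'k poly3) = L g + L g'"
    and "finite D" "\<And>d. d \<in> D \<Longrightarrow> y d \<in> carrier G"
  shows "L (finsum G y D) = (\<Sum>d\<in>D. L (y d))"
proof -
  interpret ab: abelian_group G by (rule G.abelian_group_N)
  have L0: "L \<zero>\<^bsub>G\<^esub> = 0"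
  proof -
    have "L \<zero>\<^bsub>G\<^esub> = L \<zero>\<^bsub>G\<^esub> + L \<zero>\<^bsub>G\<^esub>"
      using assms(1)[OF ab.zero_closed ab.zero_closed] unfolding ab.l_zero[OF ab.zero_closed] .
    then show ?thesis by (simp only: add_cancel_right_right)
  qed
  from assms(2,3) show ?thesis
  proof (induction D)
    case empty
    then show ?case by (simp add: L0)
  next
    case (insert d D)
    have "L (y d \<oplus>\<^bsub>G\<^esub> finsum G y D) = L (y d) + L (finsum G y D)"
      using insert.prems insert.hyps by (intro assms(1) G.finsum_in_carrier) auto
    then show ?case using insert by (simp add: Pi_def)
  qed
qed

text \<open>The relation which says that \<open>var i ^ K * h t\<close> lies in the Jacobian ideal.
  On the coefficients \<open>cc\<close> it inverts the projection of \<open>G\<close> to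
  \<open>P\<close> up to a power of a variable.\<close>

definition lift_rel :: "nat \<Rightarrow> 3 \<Rightarrow> 't \<Rightarrow> 'g" where
  "lift_rel K i t = (SOME g. g \<in> carrier G \<and> (\<forall>s\<in>T. cc g s = (if s = t then var i ^ K else 0)))"

lemma lift_rel_ex: "\<exists>K. \<forall>t\<in>T. \<forall>i. lift_rel K i t \<in> carrier G \<and> (\<forall>s\<in>T. cc (lift_rel K i t) s = (if s = t then var i ^ K else 0))"
proof -
  obtain K where K: "\<And>t i. t \<in> T \<Longrightarrow> var i ^ K * h t \<in> Jac f"
    using saturation_common_power[of T h f, OF P.finite_I h_saturation] by blast
  have ex: "\<exists>g. g \<in> carrier G \<and> (\<forall>s\<in>T. cc g s = (if s = t then var i ^ K else 0))" if t: "t \<in> T" for i t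
  proof -
    obtain a where a: "var i ^ K * h t = dot a fd" using K[OF t] unfolding Jac_eq_dot by blast
    let ?c = "\<lambda>s. if s = t then var i ^ K else 0"
    have "(\<Sum>s\<in>T. ?c s * h s) = (\<Sum>s\<in>T. if s = t then var i ^ K * h t else 0)"
      by (rule sum.cong) auto
    also have "\<dots> = dot a fd" using t P.finite_I a by simp
    finally have "dot (\<lambda>i. - a i) fd + (\<Sum>s\<in>T. ?c s * h s) = 0" by (simp add: dot_def)
    from relation_ex[OF this] show ?thesis by blast
  qed
  have "lift_rel K i t \<in> carrier G \<and> (\<forall>s\<in>T. cc (lift_rel K i t) s = (if s = t then var i ^ K else 0))"
    if "t \<in> T" for i t
    unfolding lift_rel_def by (rule someI_ex[OF ex[OF that]])
  then show ?thesis by blast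
qed

text \<open>Exactness of the dual sequence in the middle, that is, Ext^1(M, S) = 0: a functional
  vanishing on the syzygies depends on \<open>cc\<close> alone, and its coefficients are found by
  division by powers of the variables.\<close>

lemma functional_factors:
  assumes L: "L \<in> S_linear G S_mod" and 0: "\<And>i. ev L i = 0"
  shows "\<exists>\<psi>. \<forall>g\<in>carrier G. L g = (\<Sum>t\<in>T. cc g t * \<psi> t)"
proof -
  obtain K where K: "\<And>t i. t \<in> T \<Longrightarrow> lift_rel K i t \<in> carrier G"
    "\<And>t i s. t \<in> T \<Longrightarrow> s \<in> T \<Longrightarrow> cc (lift_rel K i t) s = (if s = t then var i ^ K else 0)"
    using lift_rel_ex by metis
  have L0: "L g = 0" if g: "g \<in> carrier G" "\<And>t. t \<in> T \<Longrightarrow> cc g t = 0" for g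
  proof -
    have s: "dot (qq g) fd = 0" by (rule syzygy_qq[OF g])
    have "L g = L (iota (qq g))" using iota_eqI[OF g, of "qq g"] by simp
    also have "\<dots> = om (ev L) (qq g)" by (rule functional_ev(2)[OF L s])
    also have "\<dots> = 0"
      by (rule om_eqI[OF functional_ev(1)[OF L] s]) (simp add: cross_def 0)
    finally show ?thesis .
  qed
  have Leq: "L g = L g'" if g: "g \<in> carrier G" "g' \<in> carrier G" "\<And>t. t \<in> T \<Longrightarrow> cc g t = cc g' t" for g g'
  proof -
    have "L (g \<oplus>\<^bsub>G\<^esub> (-1) \<odot>\<^bsub>G\<^esub> g') = 0"
      by (rule L0) (use g in \<open>simp_all add: G.closed cc_add cc_smult\<close>)
    then show ?thesis using g by (simp add: S_linear_G[OF L] G.closed)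
  qed
  \<comment> \<open>The lifts for different variables become equal on \<open>cc\<close> after cross
    multiplication, so by Koszul exactness their values have a common quotient.\<close>
  have "\<exists>p. \<forall>i. L (lift_rel K i t) = var i ^ K * p" if t: "t \<in> T" for t
  proof (rule koszul_exact_1[OF regular_triple_var_power])
    fix i j
    have "L (var j ^ K \<odot>\<^bsub>G\<^esub> lift_rel K i t) = L (var i ^ K \<odot>\<^bsub>G\<^esub> lift_rel K j t)"
      by (rule Leq) (simp_all add: G.closed K t cc_smult)
    then show "var j ^ K * L (lift_rel K i t) = var i ^ K * L (lift_rel K j t)"
      by (simp add: S_linear_G[OF L] K t)
  qed
  then obtain \<psi> where \<psi>: "\<And>t i. t \<in> T \<Longrightarrow> L (lift_rel K i t) = var i ^ K * \<psi> t" by metis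
  have "L g = (\<Sum>t\<in>T. cc g t * \<psi> t)" if g: "g \<in> carrier G" for g
  proof -
    let ?y = "\<lambda>t. cc g t \<odot>\<^bsub>G\<^esub> lift_rel K 0 t"
    have y: "?y t \<in> carrier G" if "t \<in> T" for t using that by (simp add: G.closed K)
    have ccy: "cc (?y t) s = (if t = s then var 0 ^ K * cc g s else 0)" if "t \<in> T" "s \<in> T" for t s
      using that by (simp add: cc_smult K mult.commute)
    \<comment> \<open>After multiplication by a power of one variable, \<open>g\<close> has the same
      \<open>cc\<close> as a combination of lifts; the power is cancelled at the end.\<close>
    have "L (var 0 ^ K \<odot>\<^bsub>G\<^esub> g) = L (finsum G ?y T)"
    proof (rule Leq)
      show "finsum G ?y T \<in> carrier G" by (rule G.finsum_in_carrier[OF P.finite_I y])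
      fix s assume s: "s \<in> T"
      have "cc (finsum G ?y T) s = (\<Sum>t\<in>T. cc (?y t) s)"
        by (rule additive_finsum_G[of "\<lambda>g. cc g s", OF cc_add[OF _ _ s] P.finite_I y])
      also have "\<dots> = (\<Sum>t\<in>T. if t = s then var 0 ^ K * cc g s else 0)"
        by (rule sum.cong[OF refl ccy[OF _ s]])
      also have "\<dots> = cc (var 0 ^ K \<odot>\<^bsub>G\<^esub> g) s" using s P.finite_I g by (simp add: cc_smult)
      finally show "cc (var 0 ^ K \<odot>\<^bsub>G\<^esub> g) s = cc (finsum G ?y T) s" ..
    qed (simp add: g G.closed)
    also have "\<dots> = (\<Sum>t\<in>T. L (?y t))"
      by (rule additive_finsum_G[of L, OF S_linear_G(1)[OF L] P.finite_I y])
    also have "\<dots> = (\<Sum>t\<in>T. var 0 ^ K * (cc g t * \<psi> t))"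
      by (rule sum.cong) (simp_all add: S_linear_G[OF L] K \<psi> mult.left_commute)
    finally have "var 0 ^ K * L g = var 0 ^ K * (\<Sum>t\<in>T. cc g t * \<psi> t)"
      by (simp add: S_linear_G[OF L] g sum_distrib_left)
    then show ?thesis by (simp add: var_nonzero)
  qed
  then show ?thesis by blast
qed

text \<open>The entries of the matrix of \<open>G\<^sup>* \<rightarrow> G\<close> are homogeneous values of \<open>om\<close>, so they cannot be units.\<close>

lemma iota_ev_minimal:
  assumes L: "L \<in> S_linear G S_mod" and i: "i \<in> IG"
  shows "lookup (cG (iota (ev L)) i) 0 = 0"
proof -
  define C where "C = (\<lambda>j g. cG g j)"
  have C: "C j \<in> S_linear G S_mod" if "j \<in> IG" for j
    unfolding C_def by (rule S_linearI) (use that in \<open>simp_all add: G.coords\<close>)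
  have Chom: "C j ` hcomp G n \<subseteq> homog (n + aG j)" if "j \<in> IG" for j n
    using that by (auto simp: C_def G.hcomp_eq)
  have unit: "lookup (om (ev (C i)) (ev (C j))) 0 = 0" if j: "j \<in> IG" for j
  proof (rule ccontr)
    assume nz: "lookup (om (ev (C i)) (ev (C j))) 0 \<noteq> 0"
    have ej: "dot (ev (C j)) fd = 0" by (rule functional_ev(1)[OF C[OF j]])
    \<comment> \<open>The degree is needed to see that the value of \<open>om\<close> is
      homogeneous: with a nonzero constant term it is then a constant, hence a unit.\<close>
    have "iota (ev (C j)) \<in> hcomp G (3 * n0 + aG j)"
    proof (rule iota_hcomp[OF ej])
      have "2 * n0 + aG j = 3 * n0 + aG j - n0" by simp
      then show "ev (C j) s \<in> homog (3 * n0 + aG j - n0)" for s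
        using ev_homog[of "C j" "aG j" s, OF Chom[OF j]] by (simp only:)
    qed
    then have "C i (iota (ev (C j))) \<in> homog (3 * n0 + aG j + aG i)"
      using Chom[OF i] by blast
    then have hom: "om (ev (C i)) (ev (C j)) \<in> homog (3 * n0 + aG j + aG i)"
      by (simp add: functional_ev(2)[OF C[OF i] ej])
    then have "3 * n0 + aG j + aG i = 0" using homog_lookup_0 nz by blast
    then have "om (ev (C i)) (ev (C j)) = cst (lookup (om (ev (C i)) (ev (C j))) 0)"
      using homog_0_cst hom by simp
    moreover have "cst u dvd 1" if "u \<noteq> 0" for u :: 'k
      by (rule dvdI[of _ _ "cst (1 / u)"]) (use that in \<open>simp add: mult_single\<close>)
    ultimately have "om (ev (C i)) (ev (C j)) dvd 1" using nz by metis
    then show False using no_unit[OF functional_ev(1)[OF C[OF i]] ej] by blast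
  qed
  have eL: "dot (ev L) fd = 0" by (rule functional_ev(1)[OF L])
  have z: "dot (\<lambda>_. 0) fd = 0" by (simp add: dot_def)
  \<comment> \<open>Reduction to the coordinate functionals: \<open>ev L\<close> is a combination of
    the syzygies \<open>ev (C j)\<close>.\<close>
  have ev: "ev L s = 0 * 0 + (\<Sum>j\<in>IG. L (G.basis j) * ev (C j) s)" for s
    unfolding ev_def G.dual_expand[OF L kappa_closed, of s]
    by (simp add: C_def sum_negf mult.commute)
  have "cG (iota (ev L)) i = om (ev (C i)) (ev L)"
    using functional_ev(2)[OF C[OF i] eL] by (simp add: C_def)
  also have "\<dots> = 0 * om (ev (C i)) (\<lambda>_. 0) + (\<Sum>j\<in>IG. L (G.basis j) * om (ev (C i)) (ev (C j)))"
    by (rule om_linear[OF G.finite_I functional_ev(1)[OF C[OF i]] z functional_ev(1)[OF C] ev])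
  finally show ?thesis using unit by (simp add: lookup_sum lookup_mult_0)
qed

lemma sum_lookup_0:
  fixes b c :: "'t \<Rightarrow> 'k poly3"
  assumes "\<And>t. t \<in> T \<Longrightarrow> lookup (c t) 0 = 0"
  shows "lookup (\<Sum>t\<in>T. b t * c t) 0 = 0"
  unfolding lookup_sum by (intro sum.neutral) (simp add: lookup_mult_0 assms)

end


lemma a_kernel_iff: "x \<in> a_kernel M R h \<longleftrightarrow> x \<in> carrier M \<and> h x = \<zero>\<^bsub>R\<^esub>"
  by (simp add: a_kernel_def kernel_def)

text \<open>Partial derivatives are indexed by the type \<open>3\<close>, the summands of
  \<open>S_pow\<close> by natural numbers.\<close>

definition idx3 :: "3 \<Rightarrow> nat" where
  "idx3 i = (if i = 0 then 0 else if i = 1 then 1 else 2)"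

lemma idx3_less: "idx3 i < 3"
  by (simp add: idx3_def)

lemma of_nat_idx3 [simp]: "of_nat (idx3 i) = i"
proof -
  have "\<forall>i. of_nat (idx3 i) = i" unfolding forall3 idx3_def by simp
  then show ?thesis by blast
qed

lemma idx3_of_nat [simp]: "j < 3 \<Longrightarrow> idx3 (of_nat j) = j"
proof -
  assume "j < 3"
  then have "j = 0 \<or> j = 1 \<or> j = 2" by auto
  then show ?thesis by (auto simp: idx3_def)
qed

section \<open>The differentials and their exactness\<close>

context saturation_relations
begin

sublocale Qt: quotient_ideal "saturation (Jac f)" "Jac f"
  by unfold_locales (simp_all add: homog_ideal_saturation homog_ideal_Jac Jac_subset_saturation)

abbreviation "G' \<equiv> twist (dual G) (- 3 * n0)"

definition d1 :: "'g \<Rightarrow> 'p" where "d1 g = P.elt (cc g)"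
text \<open>The splice: a functional is restricted to the syzygies, the restriction is represented
  by the syzygy \<open>ev L\<close>, and this is embedded into \<open>G\<close>.\<close>

definition d2 :: "('g \<Rightarrow> 'k poly3) \<Rightarrow> 'g" where "d2 L = iota (ev L)"
text \<open>The transpose of \<open>d1\<close>. It is written in coordinates \<open>c'\<close> of an
  arbitrary module, because the theorem asks for a power of S plus a twisted dual of
  \<open>F\<close>, which is only isomorphic to a twisted dual of \<open>P\<close>.\<close>

definition d3 :: "('q \<Rightarrow> 't \<Rightarrow> 'k poly3) \<Rightarrow> 'q \<Rightarrow> 'g \<Rightarrow> 'k poly3" where
  "d3 c' u = restrict (\<lambda>g. \<Sum>t\<in>T. c' u t * cc g t) (carrier G)"
definition aug :: "'p \<Rightarrow> 'k poly3 set" where "aug p = Qt.cl (\<Sum>t\<in>T. cP p t * h t)"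

text \<open>The same syzygy as in \<open>d2\<close>, now as an element of the free module on the
  partial derivatives.\<close>

definition J1 :: "('g \<Rightarrow> 'k poly3) \<Rightarrow> nat \<Rightarrow> 'k poly3" where
  "J1 L = restrict (\<lambda>j. ev L (of_nat j)) {..<3}"
definition Jaug :: "(nat \<Rightarrow> 'k poly3) \<Rightarrow> 'k poly3" where
  "Jaug u = dot (\<lambda>i. u (idx3 i)) fd"

lemma coords_G': "graded_coords G' IG (\<lambda>i. - aG i + (- 3 * n0)) (\<lambda>L i. L (G.basis i))"
  by (rule graded_coords_twist[OF G.graded_coords_dual])

lemma ev_add:
  assumes "L \<in> carrier G'" "M \<in> carrier G'" shows "ev (L \<oplus>\<^bsub>G'\<^esub> M) i = ev L i + ev M i"
  by (simp add: ev_def kappa_closed)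

lemma ev_smult: "ev (p \<odot>\<^bsub>G'\<^esub> L) i = p * ev L i"
  by (simp add: ev_def kappa_closed)

lemma ev_graded:
  assumes "L \<in> hcomp G' n" shows "ev L i \<in> homog (n - n0)"
proof -
  have "L ` hcomp G j \<subseteq> homog (j + (n - 3 * n0))" for j using assms by (simp add: algebra_simps)
  then have "ev L i \<in> homog (2 * n0 + (n - 3 * n0))" by (rule ev_homog)
  moreover have "2 * n0 + (n - 3 * n0) = n - n0" by simp
  ultimately show ?thesis by (simp only:)
qed

lemma d1_graded_hom: "d1 \<in> graded_hom G P"
proof (rule graded_homI[OF S_linearI])
  show "d1 g \<in> carrier P" for g by (simp add: d1_def P.closed)
  show "d1 (g \<oplus>\<^bsub>G\<^esub> g') = d1 g \<oplus>\<^bsub>P\<^esub> d1 g'" if "g \<in> carrier G" "g' \<in> carrier G" for g g'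
    unfolding d1_def by (rule P.elt_eqI) (use that in \<open>simp_all add: P.closed P.coords cc_add\<close>)
  show "d1 (p \<odot>\<^bsub>G\<^esub> g) = p \<odot>\<^bsub>P\<^esub> d1 g" if "g \<in> carrier G" for p g
    unfolding d1_def by (rule P.elt_eqI) (use that in \<open>simp_all add: P.closed P.coords cc_smult\<close>)
  show "d1 g \<in> hcomp P n" if "g \<in> hcomp G n" for g n
    using cc_homog[OF that] by (simp add: d1_def P.hcomp_eq P.closed P.coords)
qed

lemma d1_minimal: "minimal_differential G d1 P"
  unfolding minimal_differential_def
proof (intro conjI d1_graded_hom)
  show "d1 ` carrier G \<subseteq> irrelevant_mult P"
    using cc_lookup_0 by (auto simp: P.irrelevant_mult_eq d1_def P.closed P.coords)
qed

lemma d1_zero_iff: "d1 g = \<zero>\<^bsub>P\<^esub> \<longleftrightarrow> (\<forall>t\<in>T. cc g t = 0)"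
proof
  assume "d1 g = \<zero>\<^bsub>P\<^esub>"
  then show "\<forall>t\<in>T. cc g t = 0" unfolding d1_def using P.coords_elt P.coords_zero by metis
next
  assume "\<forall>t\<in>T. cc g t = 0"
  then show "d1 g = \<zero>\<^bsub>P\<^esub>" unfolding d1_def by (intro P.elt_eqI P.zero_closed) (simp add: P.coords)
qed

lemma d2_graded_hom: "d2 \<in> graded_hom G' G"
proof (rule graded_homI[OF S_linearI])
  show "d2 L \<in> carrier G" if "L \<in> carrier G'" for L
    unfolding d2_def using that by (intro iota(1) functional_ev(1)) simp
  have add': "ev (L \<oplus>\<^bsub>G'\<^esub> M) = (\<lambda>i. ev L i + ev M i)" if "L \<in> carrier G'" "M \<in> carrier G'" for L M
    using ev_add[OF that] by (rule ext)
  show "d2 (L \<oplus>\<^bsub>G'\<^esub> M) = d2 L \<oplus>\<^bsub>G\<^esub> d2 M" if "L \<in> carrier G'" "M \<in> carrier G'" for L M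
    unfolding d2_def add'[OF that] using that by (intro iota_add functional_ev(1)) simp_all
  have smult': "ev (p \<odot>\<^bsub>G'\<^esub> L) = (\<lambda>i. p * ev L i)" for p L
    using ev_smult by (rule ext)
  show "d2 (p \<odot>\<^bsub>G'\<^esub> L) = p \<odot>\<^bsub>G\<^esub> d2 L" if "L \<in> carrier G'" for p L
    unfolding d2_def smult' using that by (intro iota_smult functional_ev(1)) simp
  show "d2 L \<in> hcomp G n" if L: "L \<in> hcomp G' n" for L n
    unfolding d2_def using L by (intro iota_hcomp functional_ev(1) ev_graded[OF L]) simp
qed

lemma d2_minimal: "minimal_differential G' d2 G"
  unfolding minimal_differential_def
proof (intro conjI d2_graded_hom)
  show "d2 ` carrier G' \<subseteq> irrelevant_mult G"
  proof
    fix g assume "g \<in> d2 ` carrier G'"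
    then obtain L where L: "L \<in> S_linear G S_mod" "g = iota (ev L)" by (auto simp: d2_def)
    show "g \<in> irrelevant_mult G"
      unfolding G.irrelevant_mult_eq L(2)
      using iota(1)[OF functional_ev(1)[OF L(1)]] iota_ev_minimal[OF L(1)] by blast
  qed
qed

text \<open>The kernel of \<open>d1\<close> consists of the relations without \<open>h t\<close>,
  that is of the syzygies, and each of these is some \<open>ev L\<close>.\<close>

lemma d2_exact: "exact_at G' d2 G d1 P"
  unfolding exact_at_def
proof (rule equalityI; rule subsetI)
  fix g assume "g \<in> d2 ` carrier G'"
  then obtain L where L: "L \<in> S_linear G S_mod" "g = iota (ev L)" by (auto simp: d2_def)
  note i = iota[OF functional_ev(1)[OF L(1)]]
  show "g \<in> a_kernel G P d1" using i by (simp add: a_kernel_iff d1_zero_iff L(2))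
next
  fix g assume "g \<in> a_kernel G P d1"
  then have g: "g \<in> carrier G" "\<And>t. t \<in> T \<Longrightarrow> cc g t = 0" by (auto simp: a_kernel_iff d1_zero_iff)
  obtain L where L: "L \<in> carrier (dual G)" "\<forall>i. ev L i = qq g i"
    using ev_surj[OF syzygy_qq[OF g]] by blast
  have "d2 L = g" unfolding d2_def by (rule iota_eqI[OF g]) (use L(2) in blast)+
  then show "g \<in> d2 ` carrier G'" using L(1) by auto
qed

lemma aug_augmentation: "augmentation P aug (Milnor_module f)"
  unfolding augmentation_def Milnor_module_def
proof
  have Pmem: "(\<Sum>t\<in>T. c t * h t) \<in> saturation (Jac f)" for c
  proof -
    have "(\<Sum>t\<in>T. c t * h t) = dot (\<lambda>_. 0) fd + (\<Sum>t\<in>T. c t * h t)" by (simp add: dot_def)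
    then show ?thesis unfolding saturation_eq by blast
  qed
  show "aug \<in> graded_hom P Qt.Q"
  proof (rule graded_homI[OF S_linearI])
    show "aug p \<in> carrier Qt.Q" for p using Pmem by (simp add: aug_def Qt.Q_carrier)
    show "aug (p \<oplus>\<^bsub>P\<^esub> p') = aug p \<oplus>\<^bsub>Qt.Q\<^esub> aug p'" if "p \<in> carrier P" "p' \<in> carrier P" for p p'
      using that by (simp add: aug_def Qt.Q_add P.coords distrib_right sum.distrib)
    show "aug (r \<odot>\<^bsub>P\<^esub> p) = r \<odot>\<^bsub>Qt.Q\<^esub> aug p" if "p \<in> carrier P" for r p
      using that by (simp add: aug_def Qt.Q_smult P.coords sum_distrib_left mult.assoc)
    show "aug p \<in> hcomp Qt.Q n" if p: "p \<in> hcomp P n" for p n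
    proof -
      have "(\<Sum>t\<in>T. cP p t * h t) \<in> homog n"
        using p by (intro homog_sum homog_mult'[OF _ h_homog]) (auto simp: P.hcomp_eq)
      then show ?thesis using Pmem by (auto simp: aug_def Qt.Q_hcomp)
    qed
  qed
  show "aug ` carrier P = carrier Qt.Q"
  proof (rule equalityI; rule subsetI)
    fix C assume "C \<in> carrier Qt.Q"
    then obtain x where x: "x \<in> saturation (Jac f)" "C = Qt.cl x" by (auto simp: Qt.Q_carrier)
    then obtain q c where qc: "x = dot q fd + (\<Sum>t\<in>T. c t * h t)" unfolding saturation_eq by blast
    have "Qt.cl x = aug (P.elt c)"
      unfolding aug_def Qt.cl_eq_iff by (simp add: qc P.coords Jac_eq_dot)
    then show "C \<in> aug ` carrier P" using x P.elt_closed by simp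
  qed (use Pmem in \<open>auto simp: aug_def Qt.Q_carrier\<close>)
qed

text \<open>A combination of the \<open>h t\<close> lies in the Jacobian ideal exactly when its
  coefficients can be completed to a relation.\<close>

lemma d1_exact: "exact_at G d1 P aug (Milnor_module f)"
  unfolding exact_at_def Milnor_module_def
proof (rule equalityI; rule subsetI)
  have aug0: "aug p = \<zero>\<^bsub>Qt.Q\<^esub> \<longleftrightarrow> (\<Sum>t\<in>T. cP p t * h t) \<in> Jac f" for p
    unfolding aug_def Qt.Q_zero Qt.cl_eq_iff by simp
  {
    fix p assume "p \<in> d1 ` carrier G"
    then obtain g where g: "g \<in> carrier G" "p = d1 g" by blast
    have "(\<Sum>t\<in>T. cP p t * h t) = dot (\<lambda>i. - qq g i) fd"
      using relation[OF g(1)] by (simp add: g(2) d1_def P.coords dot_def add_eq_0_iff)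
    then have "(\<Sum>t\<in>T. cP p t * h t) \<in> Jac f" unfolding Jac_eq_dot by blast
    then have "aug p = \<zero>\<^bsub>Qt.Q\<^esub>" by (simp only: aug0)
    moreover have "p \<in> carrier P" by (simp add: g(2) d1_def P.closed)
    ultimately show "p \<in> a_kernel P Qt.Q aug" unfolding a_kernel_iff by blast
  next
    fix p assume "p \<in> a_kernel P Qt.Q aug"
    then have p: "p \<in> carrier P" "(\<Sum>t\<in>T. cP p t * h t) \<in> Jac f" by (simp_all add: a_kernel_iff aug0)
    then obtain a where a: "(\<Sum>t\<in>T. cP p t * h t) = dot a fd" unfolding Jac_eq_dot by blast
    have "dot (\<lambda>i. - a i) fd + (\<Sum>t\<in>T. cP p t * h t) = 0" unfolding a by (simp add: dot_def)
    from relation_ex[OF this] obtain g where g: "g \<in> carrier G" "\<forall>t\<in>T. cc g t = cP p t" by blast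
    have "d1 g = p" unfolding d1_def by (rule P.elt_eqI[OF p(1)]) (simp add: g(2))
    then show "p \<in> d1 ` carrier G" using g(1) by blast
  }
qed

section \<open>The left end of both resolutions, for any model \<open>P'\<close> of the twisted dual
  of \<open>P\<close>\<close>

context
  fixes P' :: "('k poly3, 'q) gmodule" and c' :: "'q \<Rightarrow> 't \<Rightarrow> 'k poly3"
  assumes P': "graded_coords P' T (\<lambda>t. - aP t - 3 * n0) c'"
begin

interpretation P': graded_coords P' T "\<lambda>t. - aP t - 3 * n0" c' by (rule P')
interpretation G': graded_coords G' IG "\<lambda>i. - aG i + (- 3 * n0)" "\<lambda>L i. L (G.basis i)" by (rule coords_G')

lemma d3_carrier: "d3 c' u \<in> carrier G'"
proof -
  have "d3 c' u \<in> S_linear G S_mod"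
    by (rule S_linearI)
      (auto simp: d3_def G.closed cc_add cc_smult distrib_left sum.distrib sum_distrib_left mult.left_commute
        intro!: sum.cong)
  then show ?thesis by (simp add: d3_def)
qed

lemma d3_graded_hom: "d3 c' \<in> graded_hom P' G'"
proof (rule graded_homI[OF S_linearI])
  show "d3 c' u \<in> carrier G'" for u by (rule d3_carrier)
  show "d3 c' (u \<oplus>\<^bsub>P'\<^esub> v) = d3 c' u \<oplus>\<^bsub>G'\<^esub> d3 c' v" if "u \<in> carrier P'" "v \<in> carrier P'" for u v
    using that by (auto simp: d3_def P'.coords distrib_right sum.distrib fun_eq_iff)
  show "d3 c' (p \<odot>\<^bsub>P'\<^esub> u) = p \<odot>\<^bsub>G'\<^esub> d3 c' u" if "u \<in> carrier P'" for p u
    using that by (auto simp: d3_def P'.coords sum_distrib_left mult.assoc fun_eq_iff)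
  show "d3 c' u \<in> hcomp G' n" if u: "u \<in> hcomp P' n" for u n
  proof -
    have "d3 c' u g \<in> homog (j + (n + - 3 * n0))" if g: "g \<in> hcomp G j" for g j
    proof -
      have gc: "g \<in> carrier G" using g by (simp add: G.hcomp_eq)
      have "c' u t * cc g t \<in> homog (j + (n + - 3 * n0))" if t: "t \<in> T" for t
      proof (rule homog_mult'[OF _ cc_homog[OF g t]])
        show "c' u t \<in> homog (n + (- aP t - 3 * n0))" using u t by (simp add: P'.hcomp_eq)
      qed simp
      then show ?thesis using gc by (simp add: d3_def homog_sum)
    qed
    then show ?thesis using d3_carrier[of u] by (auto simp: image_subset_iff)
  qed
qed

text \<open>Transposition keeps the constant terms of the entries zero.\<close>

lemma d3_minimal: "minimal_differential P' (d3 c') G'"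
  unfolding minimal_differential_def
proof (intro conjI d3_graded_hom)
  show "d3 c' ` carrier P' \<subseteq> irrelevant_mult G'"
  proof
    fix L assume "L \<in> d3 c' ` carrier P'"
    then obtain u where u: "L = d3 c' u" by blast
    have "lookup (d3 c' u (G.basis i)) 0 = 0" for i
      using sum_lookup_0[of "cc (G.basis i)" "c' u"] cc_lookup_0[OF G.basis_closed]
      by (simp add: d3_def G.basis_closed)
    then show "L \<in> irrelevant_mult G'"
      unfolding G'.irrelevant_mult_eq using d3_carrier[of u] u by blast
  qed
qed

text \<open>Hom(M, S) = 0 in concrete form: evaluation at \<open>lift_rel\<close> returns a
  coordinate times a power of a variable.\<close>

lemma d3_inj: "inj_on (d3 c') (carrier P')"
proof (rule inj_onI)
  fix u v assume uv: "u \<in> carrier P'" "v \<in> carrier P'" "d3 c' u = d3 c' v"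
  obtain K where K: "\<And>t i. t \<in> T \<Longrightarrow> lift_rel K i t \<in> carrier G"
    "\<And>t i s. t \<in> T \<Longrightarrow> s \<in> T \<Longrightarrow> cc (lift_rel K i t) s = (if s = t then var i ^ K else 0)"
    using lift_rel_ex by metis
  show "u = v"
  proof (rule P'.coords_inj[OF uv(1,2)])
    fix t assume t: "t \<in> T"
    have *: "d3 c' w (lift_rel K 0 t) = c' w t * var 0 ^ K" for w
    proof -
      have "d3 c' w (lift_rel K 0 t) = (\<Sum>s\<in>T. if s = t then c' w t * var 0 ^ K else 0)"
        unfolding d3_def using K t by (auto intro!: sum.cong)
      then show ?thesis using t P.finite_I by simp
    qed
    have "c' u t * var 0 ^ K = d3 c' u (lift_rel K 0 t)" by (rule *[symmetric])
    also have "\<dots> = c' v t * var 0 ^ K" unfolding uv(3) by (rule *)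
    finally show "c' u t = c' v t" by (simp add: var_nonzero)
  qed
qed

text \<open>Functionals that factor through \<open>cc\<close> kill the Koszul syzygies and so have
  \<open>ev L = 0\<close>; \<open>functional_factors\<close> is the converse.\<close>

lemma d3_image: "d3 c' ` carrier P' = {L \<in> carrier G'. \<forall>i. ev L i = 0}"
proof (rule equalityI; rule subsetI)
  fix L assume "L \<in> d3 c' ` carrier P'"
  then obtain u where u: "L = d3 c' u" by blast
  have "ev L i = 0" for i
    using iota(3)[OF dot_koszul] by (simp add: u ev_def d3_def kappa_closed) (simp add: kappa_def)
  then show "L \<in> {L \<in> carrier G'. \<forall>i. ev L i = 0}" using d3_carrier u by blast
next
  fix L assume L: "L \<in> {L \<in> carrier G'. \<forall>i. ev L i = 0}"
  then have Ll: "L \<in> S_linear G S_mod" "L \<in> extensional (carrier G)" "\<And>i. ev L i = 0" by auto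
  obtain \<psi> where \<psi>: "\<forall>g\<in>carrier G. L g = (\<Sum>t\<in>T. cc g t * \<psi> t)"
    using functional_factors[OF Ll(1,3)] by blast
  have "d3 c' (P'.elt \<psi>) = L"
  proof (rule extensionalityI[of _ "carrier G"])
    show "d3 c' (P'.elt \<psi>) g = L g" if "g \<in> carrier G" for g
      using that \<psi> by (simp add: d3_def P'.coords mult.commute)
  qed (simp_all add: d3_def Ll(2))
  then show "L \<in> d3 c' ` carrier P'" using P'.elt_closed by blast
qed

lemma iota_ev_eq_zero_iff:
  assumes "L \<in> carrier G'" shows "d2 L = \<zero>\<^bsub>G\<^esub> \<longleftrightarrow> (\<forall>i. ev L i = 0)"
proof
  have e: "dot (ev L) fd = 0" by (rule functional_ev(1)) (use assms in simp)
  have z: "qq \<zero>\<^bsub>G\<^esub> i = 0" for i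
  proof -
    have "0 \<odot>\<^bsub>G\<^esub> \<zero>\<^bsub>G\<^esub> = \<zero>\<^bsub>G\<^esub>"
      by (rule G.coords_inj) (simp_all add: G.closed G.coords)
    then show ?thesis using qq_smult[OF G.zero_closed, of 0 i] by simp
  qed
  have zc: "cc \<zero>\<^bsub>G\<^esub> t = 0" if "t \<in> T" for t
  proof -
    have "0 \<odot>\<^bsub>G\<^esub> \<zero>\<^bsub>G\<^esub> = \<zero>\<^bsub>G\<^esub>"
      by (rule G.coords_inj) (simp_all add: G.closed G.coords)
    then show ?thesis using cc_smult[OF G.zero_closed that, of 0] by simp
  qed
  show "\<forall>i. ev L i = 0" if "d2 L = \<zero>\<^bsub>G\<^esub>" using iota(2)[OF e] z that by (simp add: d2_def)
  show "d2 L = \<zero>\<^bsub>G\<^esub>" if "\<forall>i. ev L i = 0"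
    unfolding d2_def by (rule iota_eqI[OF G.zero_closed zc]) (simp_all add: that z)
qed

lemma d3_exact: "exact_at P' (d3 c') G' d2 G"
  unfolding exact_at_def d3_image using iota_ev_eq_zero_iff by (auto simp: a_kernel_iff)

theorem milnor_resolution: "minimal_resolution\<^sub>3 P' (d3 c') G' d2 G d1 P aug (Milnor_module f)"
  unfolding minimal_resolution\<^sub>3_def
  using P'.graded_free_N G'.graded_free_N G.graded_free_N P.graded_free_N Qt.graded_module_Q
    d3_minimal d2_minimal d1_minimal aug_augmentation d3_inj d3_exact d2_exact d1_exact
  unfolding Milnor_module_def by blast

lemma J1_graded_hom: "J1 \<in> graded_hom G' (S_pow 3 (- n0))"
proof (rule graded_homI[OF S_linearI])
  show "J1 L \<in> carrier (S_pow 3 (- n0))" for L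
    by (simp add: J1_def S_pow_def gdirect_sum_simps)
  show "J1 (L \<oplus>\<^bsub>G'\<^esub> M) = J1 L \<oplus>\<^bsub>S_pow 3 (- n0)\<^esub> J1 M" if "L \<in> carrier G'" "M \<in> carrier G'" for L M
    unfolding J1_def S_pow_def gdirect_sum_simps ev_add[OF that] by (auto simp: fun_eq_iff)
  show "J1 (p \<odot>\<^bsub>G'\<^esub> L) = p \<odot>\<^bsub>S_pow 3 (- n0)\<^esub> J1 L" for p L
    unfolding J1_def S_pow_def gdirect_sum_simps ev_smult by (auto simp: fun_eq_iff)
  show "J1 L \<in> hcomp (S_pow 3 (- n0)) n" if "L \<in> hcomp G' n" for L n
  proof -
    have "ev L i \<in> homog (n + - n0)" for i
      unfolding diff_conv_add_uminus[symmetric] by (rule ev_graded[OF that])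
    then show ?thesis by (auto simp: J1_def S_pow_def gdirect_sum_simps)
  qed
qed

text \<open>Each \<open>ev L\<close> is a syzygy of the gradient, and these have no constant terms
  if the arrangement is not free.\<close>

lemma J1_minimal: "minimal_differential G' J1 (S_pow 3 (- n0))"
  unfolding minimal_differential_def
proof (intro conjI J1_graded_hom)
  interpret S3: graded_coords "S_pow 3 (- n0)" "{..<3}" "\<lambda>_. - n0" "\<lambda>u. u :: nat \<Rightarrow> 'k poly3"
    by (rule graded_coords_S_pow)
  show "J1 ` carrier G' \<subseteq> irrelevant_mult (S_pow 3 (- n0))"
  proof
    fix u assume "u \<in> J1 ` carrier G'"
    then obtain L where L: "L \<in> carrier G'" "u = J1 L" by blast
    have "lookup (ev L i) 0 = 0" for i
      by (rule syzygy_lookup_0[OF functional_ev(1)]) (use L in simp)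
    moreover have "J1 L \<in> carrier (S_pow 3 (- n0))"
      by (simp add: J1_def S_pow_def gdirect_sum_simps)
    ultimately show "u \<in> irrelevant_mult (S_pow 3 (- n0))"
      unfolding S3.irrelevant_mult_eq L(2) by (simp add: J1_def)
  qed
qed

lemma Jaug_augmentation: "augmentation (S_pow 3 (- n0)) Jaug (ideal_gmodule (Jac f))"
  unfolding augmentation_def
proof
  show "Jaug \<in> graded_hom (S_pow 3 (- n0)) (ideal_gmodule (Jac f))"
  proof (rule graded_homI[OF S_linearI])
    show "Jaug u \<in> carrier (ideal_gmodule (Jac f))" for u by (simp add: Jaug_def Jac_eq_dot)
    show "Jaug (u \<oplus>\<^bsub>S_pow 3 (- n0)\<^esub> v) = Jaug u \<oplus>\<^bsub>ideal_gmodule (Jac f)\<^esub> Jaug v" for u v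
      by (simp add: Jaug_def S_pow_def gdirect_sum_simps idx3_less dot_def algebra_simps)
    show "Jaug (p \<odot>\<^bsub>S_pow 3 (- n0)\<^esub> u) = p \<odot>\<^bsub>ideal_gmodule (Jac f)\<^esub> Jaug u" for p u
      by (simp add: Jaug_def S_pow_def gdirect_sum_simps idx3_less dot_def algebra_simps)
    show "Jaug u \<in> hcomp (ideal_gmodule (Jac f)) n" if "u \<in> hcomp (S_pow 3 (- n0)) n" for u n
    proof -
      have "u j \<in> homog (n + - n0)" if "j < 3" for j
        using \<open>u \<in> _\<close> that by (auto simp: S_pow_def gdirect_sum_simps)
      then have "u (idx3 i) * fd i \<in> homog n" for i
        by (rule homog_mult'[OF _ fd_homog]) (simp_all add: idx3_less)
      then show ?thesis by (simp add: Jaug_def Jac_eq_dot dot_def homog_add)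
    qed
  qed
  show "Jaug ` carrier (S_pow 3 (- n0)) = carrier (ideal_gmodule (Jac f))"
  proof (rule equalityI; rule subsetI)
    fix x assume "x \<in> carrier (ideal_gmodule (Jac f))"
    then obtain a where a: "x = dot a fd" by (auto simp: Jac_eq_dot)
    let ?u = "restrict (\<lambda>j. a (of_nat j)) {..<3}"
    have "Jaug ?u = x" by (simp add: Jaug_def a idx3_less)
    moreover have "?u \<in> carrier (S_pow 3 (- n0))" by (simp add: S_pow_def gdirect_sum_simps)
    ultimately show "x \<in> Jaug ` carrier (S_pow 3 (- n0))" by blast
  qed (auto simp: Jaug_def Jac_eq_dot)
qed

lemma J1_zero_iff: "J1 L = \<zero>\<^bsub>S_pow 3 (- n0)\<^esub> \<longleftrightarrow> (\<forall>i. ev L i = 0)"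
proof
  assume eq: "J1 L = \<zero>\<^bsub>S_pow 3 (- n0)\<^esub>"
  show "\<forall>i. ev L i = 0"
  proof
    fix i show "ev L i = 0"
      using fun_cong[OF eq, of "idx3 i"] by (simp add: J1_def S_pow_def gdirect_sum_simps idx3_less)
  qed
qed (auto simp: J1_def S_pow_def gdirect_sum_simps fun_eq_iff)

lemma J1_exact: "exact_at G' J1 (S_pow 3 (- n0)) Jaug (ideal_gmodule (Jac f))"
  unfolding exact_at_def
proof (rule equalityI; rule subsetI)
  fix u assume "u \<in> J1 ` carrier G'"
  then obtain L where L: "L \<in> carrier G'" "u = J1 L" by blast
  have "dot (ev L) fd = 0" by (rule functional_ev(1)) (use L in simp)
  then show "u \<in> a_kernel (S_pow 3 (- n0)) (ideal_gmodule (Jac f)) Jaug"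
    by (simp add: a_kernel_iff L(2) Jaug_def J1_def idx3_less S_pow_def gdirect_sum_simps)
next
  fix u assume "u \<in> a_kernel (S_pow 3 (- n0)) (ideal_gmodule (Jac f)) Jaug"
  then have u: "u \<in> carrier (S_pow 3 (- n0))" "dot (\<lambda>i. u (idx3 i)) fd = 0"
    by (simp_all add: a_kernel_iff Jaug_def)
  obtain L where L: "L \<in> carrier (dual G)" "\<forall>i. ev L i = u (idx3 i)" using ev_surj[OF u(2)] by blast
  have "J1 L = u"
  proof
    fix j show "J1 L j = u j"
      using u(1) by (cases "j < 3") (auto simp: J1_def L(2) S_pow_def gdirect_sum_simps PiE_def extensional_def)
  qed
  then show "u \<in> J1 ` carrier G'" using L(1) by auto
qed

theorem Jac_resolution: "minimal_resolution\<^sub>2 P' (d3 c') G' J1 (S_pow 3 (- n0)) Jaug (ideal_gmodule (Jac f))"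
proof -
  have "graded_free (S_pow 3 (- n0) :: ('k poly3, nat \<Rightarrow> 'k poly3) gmodule)"
    by (rule graded_coords.graded_free_N[OF graded_coords_S_pow])
  moreover have "exact_at P' (d3 c') G' J1 (S_pow 3 (- n0))"
    unfolding exact_at_def d3_image using J1_zero_iff by (auto simp: a_kernel_iff)
  ultimately show ?thesis
    unfolding minimal_resolution\<^sub>2_def
    using P'.graded_free_N G'.graded_free_N graded_module_ideal[OF homog_ideal_Jac]
      d3_minimal J1_minimal Jaug_augmentation d3_inj J1_exact by blast
qed

end

end


section \<open>Choice of generators\<close>

text \<open>Generators sit in degrees \<open>- a i\<close>, so \<open>degrees\<close> says that none
  lies below d - 1.\<close>

locale saturation_cover = nonfree_lines A l f fd
  for A :: "'x set" and l :: "'x \<Rightarrow> 'k::field_char_0 poly3" and f fd +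
  fixes Q :: "('k poly3, 'q) gmodule" and I :: "'i set" and a :: "'i \<Rightarrow> int" and \<epsilon> :: "'q \<Rightarrow> 'k poly3"
  assumes \<epsilon>_hom: "\<epsilon> \<in> graded_hom Q (ideal_gmodule (saturation (Jac f)))"
    and \<epsilon>_surj: "\<epsilon> ` carrier Q = saturation (Jac f)"
    and degrees: "i \<in> I \<Longrightarrow> a i \<le> - (int (card A) - 1)"
begin

lemma \<epsilon>_linear: "u \<in> carrier Q \<Longrightarrow> v \<in> carrier Q \<Longrightarrow> \<epsilon> (u \<oplus>\<^bsub>Q\<^esub> v) = \<epsilon> u + \<epsilon> v"
    "u \<in> carrier Q \<Longrightarrow> \<epsilon> (p \<odot>\<^bsub>Q\<^esub> u) = p * \<epsilon> u"
  using \<epsilon>_hom by (auto simp: graded_hom_def S_linear_def)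

lemma \<epsilon>_homog: "u \<in> hcomp Q n \<Longrightarrow> \<epsilon> u \<in> homog n"
  using \<epsilon>_hom by (auto simp: graded_hom_def)

text \<open>A choice of basis together with the images \<open>\<eta>\<close> of its elements. Both
  change under exchange, while \<open>\<epsilon>\<close> stays fixed.\<close>

definition adapted :: "('q \<Rightarrow> 'i \<Rightarrow> 'k poly3) \<Rightarrow> ('i \<Rightarrow> 'k poly3) \<Rightarrow> bool" where
  "adapted c \<eta> \<longleftrightarrow> graded_coords Q I a c \<and> (\<forall>u\<in>carrier Q. \<epsilon> u = (\<Sum>i\<in>I. c u i * \<eta> i))"

lemma adapted_exists:
  assumes "graded_coords Q I a c" shows "\<exists>\<eta>. adapted c \<eta>"
proof -
  interpret Q: graded_coords Q I a c by (rule assms)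
  have "\<epsilon> u = (\<Sum>i\<in>I. c u i * \<epsilon> (Q.basis i))" if "u \<in> carrier Q" for u
    by (rule Q.linear_expand[of \<epsilon>, OF \<epsilon>_linear that])
  then show ?thesis
    unfolding adapted_def by (intro exI[of _ "\<lambda>i. \<epsilon> (Q.basis i)"] conjI assms ballI)
qed

lemma adapted_homog:
  assumes "adapted c \<eta>" "i \<in> I" shows "\<eta> i \<in> homog (- a i)"
proof -
  interpret Q: graded_coords Q I a c using assms(1) by (simp add: adapted_def)
  have "\<epsilon> (Q.basis i) = (\<Sum>j\<in>I. c (Q.basis i) j * \<eta> j)"
    using assms(1) Q.basis_closed by (simp add: adapted_def)
  also have "\<dots> = (\<Sum>j\<in>I. if j = i then \<eta> j else 0)" by (rule sum.cong) (simp_all add: Q.coords_basis)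
  also have "\<dots> = \<eta> i" using assms(2) Q.finite_I by simp
  finally show ?thesis using \<epsilon>_homog[OF Q.basis_hcomp[of i]] by simp
qed

lemma fd_saturation: "fd k \<in> saturation (Jac f)"
proof -
  have "\<forall>k. fd k = dot (unit3 k) fd" unfolding forall3 by (simp add: dot_def unit3_def)
  then have "fd k \<in> Jac f" unfolding Jac_eq_dot by blast
  then show ?thesis using Jac_subset_saturation by blast
qed

text \<open>Take the component of degree d - 1 of any expansion: generators of that degree
  contribute constants, those of higher degree nothing.\<close>

lemma fd_expand:
  assumes "adapted c \<eta>"
  shows "\<exists>v. fd k = (\<Sum>i\<in>I. cst (v i) * \<eta> i) \<and> (\<forall>i\<in>I. v i \<noteq> 0 \<longrightarrow> a i = - n0)"
proof -
  have "fd k \<in> \<epsilon> ` carrier Q" unfolding \<epsilon>_surj by (rule fd_saturation)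
  then obtain u where u: "u \<in> carrier Q" "fd k = \<epsilon> u" by blast
  then have eq: "fd k = (\<Sum>i\<in>I. c u i * \<eta> i)" using assms by (simp add: adapted_def)
  define v where "v = (\<lambda>i. if a i = - n0 then lookup (c u i) 0 else 0)"
  have "hproj n0 (c u i * \<eta> i) = cst (v i) * \<eta> i" if i: "i \<in> I" for i
  proof -
    have "hproj n0 (\<eta> i * c u i) = \<eta> i * hproj (n0 - - a i) (c u i)"
      by (rule hproj_mult[OF adapted_homog[OF assms i]])
    moreover have "hproj (n0 - - a i) (c u i) = cst (v i)"
    proof (cases "a i = - n0")
      case True
      have "hproj 0 (c u i) = cst (lookup (hproj 0 (c u i)) 0)"
        by (rule homog_0_cst[OF hproj_homog])
      then show ?thesis using True by (simp add: v_def lookup_hproj mon_degree_def)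
    next
      case False
      then have "n0 - - a i < 0" using degrees[OF i] by simp
      then have "hproj (n0 - - a i) (c u i) = 0" by (rule homog_neg[OF hproj_homog])
      then show ?thesis using False by (simp add: v_def)
    qed
    ultimately show ?thesis by (simp add: mult.commute)
  qed
  then have "hproj n0 (fd k) = (\<Sum>i\<in>I. cst (v i) * \<eta> i)" unfolding eq hproj_sum by simp
  then have "fd k = (\<Sum>i\<in>I. cst (v i) * \<eta> i)" using hproj_of_homog[OF fd_homog, of n0 k] by simp
  moreover have "\<forall>i\<in>I. v i \<noteq> 0 \<longrightarrow> a i = - n0" by (simp add: v_def)
  ultimately show ?thesis by blast
qed

text \<open>\<open>D\<close> holds the generators already replaced. Since the derivative is not a
  combination of these alone, some other generator occurs in it with nonzero coefficient and can be
  exchanged.\<close>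

lemma adapted_exchange:
  assumes ad: "adapted c \<eta>" and D: "D \<subseteq> I" and indep: "\<And>v. fd k \<noteq> (\<Sum>i\<in>D. cst (v i) * \<eta> i)"
  obtains c' \<eta>' s where "adapted c' \<eta>'" "s \<in> I" "s \<notin> D" "a s = - n0" "\<eta>' s = fd k" "\<forall>i\<in>D. \<eta>' i = \<eta> i"
proof -
  interpret Q: graded_coords Q I a c using ad by (simp add: adapted_def)
  obtain v where v: "fd k = (\<Sum>i\<in>I. cst (v i) * \<eta> i)" "\<And>i. i \<in> I \<Longrightarrow> v i \<noteq> 0 \<Longrightarrow> a i = - n0"
    using fd_expand[OF ad] by blast
  have "\<exists>s\<in>I - D. v s \<noteq> 0"
  proof (rule ccontr)
    assume "\<not> (\<exists>s\<in>I - D. v s \<noteq> 0)"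
    then have "(\<Sum>i\<in>I. cst (v i) * \<eta> i) = (\<Sum>i\<in>D. cst (v i) * \<eta> i)"
      using D Q.finite_I by (intro sum.mono_neutral_right) auto
    then show False using indep[of v] v(1) by simp
  qed
  then obtain s where s: "s \<in> I" "s \<notin> D" "v s \<noteq> 0" by blast
  have av: "a i = a s" if "i \<in> I" "v i \<noteq> 0" for i using v(2)[OF that] v(2)[OF s(1,3)] by simp
  note ex = Q.exchange[where v = v, OF s(1,3) av]
  define c' where "c' = (\<lambda>x i. if i = s then cst (1 / v s) * c x s else c x i - cst (v i / v s) * c x s)"
  show thesis
  proof (rule that[of c' "\<eta>(s := fd k)" s])
    show "adapted c' (\<eta>(s := fd k))"
      unfolding adapted_def
    proof (intro conjI ballI)
      show "graded_coords Q I a c'" unfolding c'_def by (rule ex(1))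
      fix u assume "u \<in> carrier Q"
      then have "\<epsilon> u = (\<Sum>i\<in>I. c u i * \<eta> i)" using ad by (simp add: adapted_def)
      also have "\<dots> = (\<Sum>i\<in>I. c' u i * (\<eta>(s := fd k)) i)"
        unfolding c'_def v(1) by (rule ex(2)[symmetric])
      finally show "\<epsilon> u = (\<Sum>i\<in>I. c' u i * (\<eta>(s := fd k)) i)" .
    qed
    show "a s = - n0" by (rule v(2)[OF s(1,3)])
  qed (use s in auto)
qed

text \<open>A relation with constant coefficients is a syzygy with constant entries, which
  \<open>syzygy_lookup_0\<close> excludes.\<close>

lemma fd_independent:
  assumes "cst u0 * fd 0 + cst u1 * fd 1 + cst u2 * fd 2 = 0" shows "u0 = 0 \<and> u1 = 0 \<and> u2 = 0"
proof -
  define e where "e = (\<lambda>i::3. if i = 0 then cst u0 else if i = 1 then cst u1 else cst u2)"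
  have "dot e fd = 0" using assms by (simp add: dot_def e_def)
  then have "\<forall>i. lookup (e i) 0 = 0" using syzygy_lookup_0 by blast
  then show ?thesis unfolding forall3 e_def by simp
qed

text \<open>Three exchanges in a row, each leaving the earlier ones in place; independence of the
  partial derivatives supplies the premise of each.\<close>

lemma adapted_partials:
  assumes "graded_coords Q I a c0"
  obtains c \<eta> s where "adapted c \<eta>" "inj s" "range s \<subseteq> I" "\<forall>k. a (s k) = - n0" "\<forall>k. \<eta> (s k) = fd (k::3)"
proof -
  obtain \<eta>0 where ad0: "adapted c0 \<eta>0" using adapted_exists[OF assms] by blast
  have i0: "fd 0 \<noteq> (\<Sum>i\<in>{}. cst (v i) * \<eta>0 i)" for v
    using fd_independent[of 1 0 0] by auto
  obtain c1 \<eta>1 s0 where 1: "adapted c1 \<eta>1" "s0 \<in> I" "s0 \<notin> {}" "a s0 = - n0" "\<eta>1 s0 = fd 0"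
    "\<forall>i\<in>{}. \<eta>1 i = \<eta>0 i"
    by (rule adapted_exchange[OF ad0 empty_subsetI i0], rule that)
  have i1: "fd 1 \<noteq> (\<Sum>i\<in>{s0}. cst (v i) * \<eta>1 i)" for v
    using fd_independent[of "v s0" "-1" 0] 1(5) by (auto simp: single_uminus)
  have sub1: "{s0} \<subseteq> I" using 1(2) by simp
  obtain c2 \<eta>2 s1 where 2: "adapted c2 \<eta>2" "s1 \<in> I" "s1 \<notin> {s0}" "a s1 = - n0" "\<eta>2 s1 = fd 1"
    "\<forall>i\<in>{s0}. \<eta>2 i = \<eta>1 i"
    by (rule adapted_exchange[OF 1(1) sub1 i1], rule that)
  have \<eta>2: "\<eta>2 s0 = fd 0" using 2(6) 1(5) by simp
  have i2: "fd 2 \<noteq> (\<Sum>i\<in>{s0, s1}. cst (v i) * \<eta>2 i)" for v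
    using fd_independent[of "v s0" "v s1" "-1"] 2(3,5) \<eta>2 by (auto simp: single_uminus)
  have sub2: "{s0, s1} \<subseteq> I" using 1(2) 2(2) by simp
  obtain c3 \<eta>3 s2 where 3: "adapted c3 \<eta>3" "s2 \<in> I" "s2 \<notin> {s0, s1}" "a s2 = - n0" "\<eta>3 s2 = fd 2"
    "\<forall>i\<in>{s0, s1}. \<eta>3 i = \<eta>2 i"
    by (rule adapted_exchange[OF 2(1) sub2 i2], rule that)
  have \<eta>3: "\<eta>3 s0 = fd 0" "\<eta>3 s1 = fd 1" using 3(6) \<eta>2 2(5) by simp_all
  define s where "s = (\<lambda>k::3. if k = 0 then s0 else if k = 1 then s1 else s2)"
  have s: "s 0 = s0" "s 1 = s1" "s 2 = s2" by (simp_all add: s_def)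
  show thesis
  proof (rule that[OF 3(1), of s])
    have "\<forall>j k. s j = s k \<longrightarrow> j = k" unfolding forall3 s using 2(3) 3(3) by auto
    then show "inj s" by (auto simp: inj_def)
    have "\<forall>k. s k \<in> I" unfolding forall3 s using 1 2 3 by simp
    then show "range s \<subseteq> I" by blast
    show "\<forall>k. a (s k) = - n0" unfolding forall3 s using 1 2 3 by simp
    show "\<forall>k. \<eta>3 (s k) = fd k" unfolding forall3 s using \<eta>3 3(5) by simp
  qed
qed

text \<open>Through \<open>\<phi>\<close> the module \<open>G\<close> is the kernel of
  \<open>\<epsilon>\<close>. Coordinates at the positions \<open>s i\<close> become the coefficients
  of the partial derivatives, those at \<open>\<beta> t\<close> the coefficients of the remaining
  generators.\<close>

lemma relations_of_adapted:
  fixes G :: "('k poly3, 'g) gmodule" and P :: "('k poly3, 'p) gmodule" and T :: "'t set" and aP :: "'t \<Rightarrow> int"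
  assumes ad: "adapted c \<eta>" and s: "inj s" "range s \<subseteq> I" "\<And>k. a (s k) = - n0" "\<And>k. \<eta> (s k) = fd (k::3)"
    and G: "graded_coords G IG aG cG" and P: "graded_coords P T aP cP"
    and \<beta>: "bij_betw \<beta> T (I - range s)" "\<And>t. t \<in> T \<Longrightarrow> a (\<beta> t) = aP t"
    and \<phi>: "minimal_differential G \<phi> Q" "inj_on \<phi> (carrier G)"
    and ex: "exact_at G \<phi> Q \<epsilon> (ideal_gmodule (saturation (Jac f)))"
  shows "saturation_relations A l G IG aG cG P T aP cP (\<lambda>g i. c (\<phi> g) (s i)) (\<lambda>g t. c (\<phi> g) (\<beta> t)) (\<lambda>t. \<eta> (\<beta> t))"
proof -
  interpret Q: graded_coords Q I a c using ad by (simp add: adapted_def)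
  interpret G: graded_coords G IG aG cG by (rule G)
  interpret P: graded_coords P T aP cP by (rule P)
  have split: "(\<Sum>i\<in>I. g i) = (g (s 0) + g (s 1) + g (s 2)) + (\<Sum>t\<in>T. g (\<beta> t))" for g :: "'i \<Rightarrow> 'k poly3"
  proof -
    have "(\<Sum>i\<in>I. g i) = (\<Sum>i\<in>I - range s. g i) + (\<Sum>i\<in>range s. g i)"
      by (rule sum.subset_diff[OF s(2) Q.finite_I])
    also have "(\<Sum>i\<in>range s. g i) = (\<Sum>k\<in>UNIV. g (s k))" by (rule sum.reindex_cong[OF s(1)]) auto
    also have "(\<Sum>i\<in>I - range s. g i) = (\<Sum>t\<in>T. g (\<beta> t))"
      by (rule sum.reindex_bij_betw[OF \<beta>(1), symmetric])
    finally show ?thesis by (simp add: sum3 add.commute)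
  qed
  have \<beta>I: "\<beta> t \<in> I" if "t \<in> T" for t using \<beta>(1) that by (auto simp: bij_betw_def)
  have sI: "s k \<in> I" for k using s(2) by blast
  have \<epsilon>: "\<epsilon> u = dot (\<lambda>i. c u (s i)) fd + (\<Sum>t\<in>T. c u (\<beta> t) * \<eta> (\<beta> t))" if "u \<in> carrier Q" for u
    using ad that split[of "\<lambda>i. c u i * \<eta> i"] by (simp add: adapted_def dot_def s(4))
  have surj: "\<exists>u\<in>carrier Q. (\<forall>i. c u (s i) = q i) \<and> (\<forall>t\<in>T. c u (\<beta> t) = r t)" for q r
  proof -
    let ?u = "Q.elt (\<lambda>i. if i \<in> range s then q (inv_into UNIV s i) else r (inv_into T \<beta> i))"
    have "c ?u (s i) = q i" for i by (simp add: Q.coords_elt sI s(1))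
    moreover have "c ?u (\<beta> t) = r t" if "t \<in> T" for t
    proof -
      have "\<beta> t \<notin> range s" using \<beta>(1) that by (auto simp: bij_betw_def)
      moreover have "inv_into T \<beta> (\<beta> t) = t" using \<beta>(1) that by (auto simp: bij_betw_def)
      ultimately show ?thesis using that by (simp add: Q.coords_elt \<beta>I)
    qed
    ultimately show ?thesis using Q.elt_closed by blast
  qed
  have \<phi>hom: "\<phi> \<in> graded_hom G Q" and \<phi>min: "\<phi> ` carrier G \<subseteq> irrelevant_mult Q"
    using \<phi>(1) by (auto simp: minimal_differential_def)
  have \<phi>: "g \<in> carrier G \<Longrightarrow> \<phi> g \<in> carrier Q" "g \<in> carrier G \<Longrightarrow> g' \<in> carrier G \<Longrightarrow> \<phi> (g \<oplus>\<^bsub>G\<^esub> g') = \<phi> g \<oplus>\<^bsub>Q\<^esub> \<phi> g'"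
    "g \<in> carrier G \<Longrightarrow> \<phi> (p \<odot>\<^bsub>G\<^esub> g) = p \<odot>\<^bsub>Q\<^esub> \<phi> g" for g g' p
    using \<phi>hom by (auto simp: graded_hom_def S_linear_def)
  have \<phi>h: "g \<in> hcomp G n \<Longrightarrow> \<phi> g \<in> hcomp Q n" for g n using \<phi>hom by (auto simp: graded_hom_def)
  have ker: "\<phi> ` carrier G = {u \<in> carrier Q. \<epsilon> u = 0}"
    using ex by (auto simp: exact_at_def a_kernel_iff)
  have "saturation_relations_axioms A l G T aP (\<lambda>g i. c (\<phi> g) (s i)) (\<lambda>g t. c (\<phi> g) (\<beta> t)) (\<lambda>t. \<eta> (\<beta> t))"
    unfolding saturation_relations_axioms_def f_def[symmetric] fd_def[symmetric]
  proof (intro conjI allI impI)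
    fix g g' i t p
    assume g: "g \<in> carrier G"
    show "c (\<phi> (p \<odot>\<^bsub>G\<^esub> g)) (s i) = p * c (\<phi> g) (s i)" by (simp add: \<phi> g Q.coords sI)
    show "dot (\<lambda>i. c (\<phi> g) (s i)) fd + (\<Sum>t\<in>T. c (\<phi> g) (\<beta> t) * \<eta> (\<beta> t)) = 0"
    proof -
      have "\<phi> g \<in> {u \<in> carrier Q. \<epsilon> u = 0}" unfolding ker[symmetric] using g by (rule imageI)
      then show ?thesis using \<epsilon>[OF \<phi>(1)[OF g]] by simp
    qed
    show "c (\<phi> (p \<odot>\<^bsub>G\<^esub> g)) (\<beta> t) = p * c (\<phi> g) (\<beta> t)" if "t \<in> T" using that by (simp add: \<phi> g Q.coords \<beta>I)
    show "lookup (c (\<phi> g) (\<beta> t)) 0 = 0" if "t \<in> T"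
      using \<phi>min g \<beta>I[OF that] by (auto simp: Q.irrelevant_mult_eq)
    assume g': "g' \<in> carrier G"
    show "c (\<phi> (g \<oplus>\<^bsub>G\<^esub> g')) (s i) = c (\<phi> g) (s i) + c (\<phi> g') (s i)" by (simp add: \<phi> g g' Q.coords sI)
    show "c (\<phi> (g \<oplus>\<^bsub>G\<^esub> g')) (\<beta> t) = c (\<phi> g) (\<beta> t) + c (\<phi> g') (\<beta> t)" if "t \<in> T"
      using that by (simp add: \<phi> g g' Q.coords \<beta>I)
    assume eq: "\<forall>i. c (\<phi> g) (s i) = c (\<phi> g') (s i)" "\<forall>t. t \<in> T \<longrightarrow> c (\<phi> g) (\<beta> t) = c (\<phi> g') (\<beta> t)"
    have "\<phi> g = \<phi> g'"
    proof (rule Q.coords_inj[OF \<phi>(1)[OF g] \<phi>(1)[OF g']])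
      fix i assume i: "i \<in> I"
      show "c (\<phi> g) i = c (\<phi> g') i"
      proof (cases "i \<in> range s")
        case True
        then show ?thesis using eq(1) by auto
      next
        case False
        then have "i \<in> \<beta> ` T" using i \<beta>(1) by (simp add: bij_betw_def)
        then show ?thesis using eq(2) by auto
      qed
    qed
    then show "g = g'" using \<open>inj_on \<phi> (carrier G)\<close> g g' by (auto dest: inj_onD)
  next
    fix q :: "3 \<Rightarrow> 'k poly3" and r :: "'t \<Rightarrow> 'k poly3"
    assume 0: "dot q fd + (\<Sum>t\<in>T. r t * \<eta> (\<beta> t)) = 0"
    obtain u where u: "u \<in> carrier Q" "\<forall>i. c u (s i) = q i" "\<forall>t\<in>T. c u (\<beta> t) = r t" using surj by blast
    have "\<epsilon> u = 0" using \<epsilon>[OF u(1)] u 0 by simp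
    then have "u \<in> \<phi> ` carrier G" unfolding ker using u(1) by simp
    then obtain g where "g \<in> carrier G" "u = \<phi> g" by blast
    then show "\<exists>g\<in>carrier G. (\<forall>i. c (\<phi> g) (s i) = q i) \<and> (\<forall>t\<in>T. c (\<phi> g) (\<beta> t) = r t)" using u by blast
  next
    fix g n i t assume g: "g \<in> hcomp G n"
    have "c (\<phi> g) (s i) \<in> homog (n + - n0)" using \<phi>h[OF g] sI[of i] s(3)[of i] by (auto simp: Q.hcomp_eq)
    then show "c (\<phi> g) (s i) \<in> homog (n - n0)" unfolding diff_conv_add_uminus[symmetric] .
    show "c (\<phi> g) (\<beta> t) \<in> homog (n + aP t)" if "t \<in> T"
      using \<phi>h[OF g] \<beta>I[OF that] \<beta>(2)[OF that] by (auto simp: Q.hcomp_eq)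
  next
    show "\<eta> (\<beta> t) \<in> homog (- aP t)" if "t \<in> T" for t
      using adapted_homog[OF ad \<beta>I[OF that]] \<beta>(2)[OF that] by simp
  next
    show "saturation (Jac f) = {dot q fd + (\<Sum>t\<in>T. r t * \<eta> (\<beta> t)) |q r. True}"
    proof (rule equalityI; rule subsetI)
      fix x assume "x \<in> saturation (Jac f)"
      then obtain u where u: "u \<in> carrier Q" "x = \<epsilon> u" unfolding \<epsilon>_surj[symmetric] by blast
      show "x \<in> {dot q fd + (\<Sum>t\<in>T. r t * \<eta> (\<beta> t)) |q r. True}"
        unfolding u(2) \<epsilon>[OF u(1)]
        by (intro CollectI exI[of _ "\<lambda>i. c u (s i)"] exI[of _ "\<lambda>t. c u (\<beta> t)"] conjI refl TrueI)
    next
      fix x assume "x \<in> {dot q fd + (\<Sum>t\<in>T. r t * \<eta> (\<beta> t)) |q r. True}"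
      then obtain q r where x: "x = dot q fd + (\<Sum>t\<in>T. r t * \<eta> (\<beta> t))" by blast
      obtain u where u: "u \<in> carrier Q" "\<forall>i. c u (s i) = q i" "\<forall>t\<in>T. c u (\<beta> t) = r t" using surj by blast
      have "x = \<epsilon> u" using \<epsilon>[OF u(1)] u x by simp
      then show "x \<in> saturation (Jac f)" using \<epsilon>_surj u(1) by blast
    qed
  qed
  then show ?thesis
    using nonfree_lines_axioms G P unfolding saturation_relations_def by blast
qed

end


text \<open>Renumbers the generators left over in the first summand, so that the smaller free module
  has literally the form of a power of S plus \<open>F\<close>.\<close>

lemma bij_betw_complement_sum:
  fixes S :: "(nat + 'r) set"
  assumes "S \<subseteq> Inl ` {..<b}" "card S = k"
  shows "k \<le> b" and "\<exists>\<beta>. bij_betw (case_sum (Inl \<circ> \<beta>) Inr) (Sum_Type.Plus {..<b - k} R) (Sum_Type.Plus {..<b} R - S)"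
proof -
  define S' where "S' = {j. Inl j \<in> S}"
  have S: "S = Inl ` S'" using assms(1) by (auto simp: S'_def)
  have S': "S' \<subseteq> {..<b}" using assms(1) by (auto simp: S'_def)
  have "card S' = k" using assms(2) unfolding S by (simp add: card_image)
  then show "k \<le> b" using card_mono[OF _ S'] by simp
  have "card ({..<b} - S') = b - k"
    using card_Diff_subset[OF finite_subset[OF S' finite_lessThan] S'] \<open>card S' = k\<close> by simp
  then obtain \<beta> where \<beta>: "bij_betw \<beta> {..<b - k} ({..<b} - S')"
    using ex_bij_betw_nat_finite[of "{..<b} - S'"] by (auto simp: atLeast0LessThan)
  have "inj_on (case_sum (Inl \<circ> \<beta>) Inr) (Sum_Type.Plus {..<b - k} R)"
    using \<beta> by (auto simp: inj_on_def bij_betw_def split: sum.splits)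
  moreover have "case_sum (Inl \<circ> \<beta>) Inr ` (Sum_Type.Plus {..<b - k} R) = (Inl ` (\<beta> ` {..<b - k})) \<union> Inr ` R"
    by (auto simp: Sum_Type.Plus_def image_Un image_image)
  moreover have "(Inl ` (\<beta> ` {..<b - k})) \<union> Inr ` R = Sum_Type.Plus {..<b} R - S"
    using \<beta> unfolding S bij_betw_def by auto
  ultimately have "bij_betw (case_sum (Inl \<circ> \<beta>) Inr) (Sum_Type.Plus {..<b - k} R) (Sum_Type.Plus {..<b} R - S)"
    unfolding bij_betw_def by simp
  then show "\<exists>\<beta>. bij_betw (case_sum (Inl \<circ> \<beta>) Inr) (Sum_Type.Plus {..<b - k} R) (Sum_Type.Plus {..<b} R - S)"
    by (rule exI[of _ \<beta>])
qed

section \<open>Degrees of the generators and assembly of the resolutions\<close>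

context nonfree_lines
begin

text \<open>The saturation vanishes below degree \<open>d - 1\<close>, which excludes generators of smaller degree; those of
  degree \<open>d - 1\<close> are excluded by the hypothesis on direct summands.\<close>

lemma generator_degrees:
  fixes F :: "('k poly3, 'f) gmodule"
  assumes F: "graded_coords F R aF cF" and s: "s \<in> R"
    and nosum: "\<not> has_direct_summand F (twist S_mod (- n0))"
    and B: "graded_coords B J aB cB"
    and \<epsilon>: "\<epsilon> \<in> graded_hom (B \<oplus>\<^sub>g F) (ideal_gmodule (saturation (Jac f)))"
    and ker: "\<And>u. u \<in> carrier (B \<oplus>\<^sub>g F) \<Longrightarrow> \<epsilon> u = 0 \<Longrightarrow> u \<in> irrelevant_mult (B \<oplus>\<^sub>g F)"
  shows "aF s < - n0"
proof (rule ccontr)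
  assume "\<not> aF s < - n0"
  interpret F: graded_coords F R aF cF by (rule F)
  interpret B: graded_coords B J aB cB by (rule B)
  interpret Q: graded_coords "B \<oplus>\<^sub>g F" "Sum_Type.Plus J R" "case_sum aB aF" "\<lambda>u. case_sum (cB (fst u)) (cF (snd u))"
    by (rule graded_coords_gsum[OF B F])
  have "aF s \<noteq> - n0" using nosum F.has_direct_summand[OF s] by metis
  then have lt: "- aF s < n0" using \<open>\<not> aF s < - n0\<close> by simp
  let ?u = "Q.basis (Inr s)"
  have u: "?u \<in> hcomp (B \<oplus>\<^sub>g F) (- aF s)" using Q.basis_hcomp[of "Inr s"] by simp
  have "\<epsilon> ?u \<in> hcomp (ideal_gmodule (saturation (Jac f))) (- aF s)"
    using \<epsilon> u unfolding graded_hom_def by blast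
  then have "\<epsilon> ?u = 0" using saturation_low_degree[OF _ _ lt] by simp
  then have "?u \<in> irrelevant_mult (B \<oplus>\<^sub>g F)" by (rule ker[OF Q.basis_closed])
  then have "lookup (case_sum (cB (fst ?u)) (cF (snd ?u)) (Inr s)) 0 = 0"
    unfolding Q.irrelevant_mult_eq using s by blast
  then show False using Q.coords_basis[OF InrI[OF s], of "Inr s"] by simp
qed

theorem resolutions:
  fixes d :: int and b :: nat
    and F :: "('k poly3, 'f) gmodule"
    and G :: "('k poly3, 'g) gmodule"
    and \<phi> :: "'g \<Rightarrow> (nat \<Rightarrow> 'k poly3) \<times> 'f"
    and \<epsilon> :: "(nat \<Rightarrow> 'k poly3) \<times> 'f \<Rightarrow> 'k poly3"
  assumes d: "d = int (card A)"
    and F: "graded_free F"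
    and G: "graded_free G"
    and nosum: "\<not> has_direct_summand F (twist S_mod (- d + 1))"
    and res: "minimal_resolution\<^sub>1 G \<phi> (S_pow b (- d + 1) \<oplus>\<^sub>g F) \<epsilon> (ideal_gmodule (saturation (Jac f)))"
  shows "b \<ge> 3 \<and>
    (\<exists>d3 d2 d1 e.
       minimal_resolution\<^sub>3
         (S_pow (b - 3) (- 2 * d + 2) \<oplus>\<^sub>g twist (dual F) (- 3 * d + 3)) d3
         (twist (dual G) (- 3 * d + 3)) d2
         G d1
         (S_pow (b - 3) (- d + 1) \<oplus>\<^sub>g F) e
         (Milnor_module f)) \<and>
    (\<exists>d2 d1 e.
       minimal_resolution\<^sub>2
         (S_pow (b - 3) (- 2 * d + 2) \<oplus>\<^sub>g twist (dual F) (- 3 * d + 3)) d2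
         (twist (dual G) (- 3 * d + 3)) d1
         (S_pow 3 (- d + 1)) e
         (ideal_gmodule (Jac f)))"
proof -
  obtain r aF and cF :: "'f \<Rightarrow> nat \<Rightarrow> 'k poly3" where Fc: "graded_coords F {..<r} aF cF"
    by (rule graded_free_coords[OF F])
  obtain rG aG and cG :: "'g \<Rightarrow> nat \<Rightarrow> 'k poly3" where Gc: "graded_coords G {..<rG} aG cG"
    by (rule graded_free_coords[OF G])
  have dn: "- d + 1 = - n0" "- 3 * d + 3 = - 3 * n0" "- 2 * d + 2 = - 2 * n0" using d by simp_all
  let ?Q = "S_pow b (- n0) \<oplus>\<^sub>g F :: ('k poly3, (nat \<Rightarrow> 'k poly3) \<times> 'f) gmodule"
  let ?aQ = "case_sum (\<lambda>_. - n0) aF"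
  let ?cQ = "\<lambda>u. case_sum (fst u) (cF (snd u))"
  have Qc: "graded_coords ?Q (Sum_Type.Plus {..<b} {..<r}) ?aQ ?cQ"
    by (rule graded_coords_gsum[OF graded_coords_S_pow Fc])
  interpret Q: graded_coords ?Q "Sum_Type.Plus {..<b} {..<r}" ?aQ ?cQ by (rule Qc)
  have \<phi>: "minimal_differential G \<phi> ?Q" "inj_on \<phi> (carrier G)"
    and \<epsilon>: "\<epsilon> \<in> graded_hom ?Q (ideal_gmodule (saturation (Jac f)))" "\<epsilon> ` carrier ?Q = saturation (Jac f)"
    and ex: "exact_at G \<phi> ?Q \<epsilon> (ideal_gmodule (saturation (Jac f)))"
    using res unfolding dn minimal_resolution\<^sub>1_def augmentation_def by auto
  have ker: "u \<in> irrelevant_mult ?Q" if "u \<in> carrier ?Q" "\<epsilon> u = 0" for u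
  proof -
    have "u \<in> a_kernel ?Q (ideal_gmodule (saturation (Jac f))) \<epsilon>" using that by (simp add: a_kernel_iff)
    then have "u \<in> \<phi> ` carrier G" using ex by (simp add: exact_at_def)
    then show ?thesis using \<phi>(1) by (auto simp: minimal_differential_def)
  qed
  have aF: "aF s < - n0" if "s \<in> {..<r}" for s
    by (rule generator_degrees[OF Fc that nosum[unfolded dn] graded_coords_S_pow \<epsilon>(1) ker])
  have "saturation_cover A l ?Q (Sum_Type.Plus {..<b} {..<r}) ?aQ \<epsilon>"
    by unfold_locales (use \<epsilon> aF in \<open>force simp: f_def\<close>)+
  then interpret C: saturation_cover A l f fd ?Q "Sum_Type.Plus {..<b} {..<r}" ?aQ \<epsilon>
    by (simp_all only: f_def fd_def)
  obtain c \<eta> s where ad: "C.adapted c \<eta>" and s1: "inj s" "range s \<subseteq> Sum_Type.Plus {..<b} {..<r}"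
    "\<forall>k. ?aQ (s k) = - n0" "\<forall>k. \<eta> (s k) = fd (k::3)"
    by (rule C.adapted_partials[OF Qc], rule that)
  note s = s1(1,2) spec[OF s1(3)] spec[OF s1(4)]
  \<comment> \<open>The generators of \<open>F\<close> have degrees above d - 1, so the partial
    derivatives occupy three places of the other summand.\<close>
  have "range s \<subseteq> Inl ` {..<b}"
  proof
    fix i assume i: "i \<in> range s"
    then show "i \<in> Inl ` {..<b}"
    proof (cases i)
      case (Inr j)
      then have "j \<in> {..<r}" "aF j = - n0" using i s(2,3) by (auto simp: image_iff) (metis sum.case(2))
      then show ?thesis using aF[of j] by simp
    qed (use s(2) in auto)
  qed
  moreover have "card (range s) = 3" using s(1) by (simp add: card_image)
  ultimately have b: "3 \<le> b" and "\<exists>\<beta>. bij_betw (case_sum (Inl \<circ> \<beta>) Inr) (Sum_Type.Plus {..<b - 3} {..<r}) (Sum_Type.Plus {..<b} {..<r} - range s)"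
    by (rule bij_betw_complement_sum)+
  then obtain \<beta> where \<beta>: "bij_betw (case_sum (Inl \<circ> \<beta>) Inr) (Sum_Type.Plus {..<b - 3} {..<r}) (Sum_Type.Plus {..<b} {..<r} - range s)" by blast
  let ?P = "S_pow (b - 3) (- n0) \<oplus>\<^sub>g F :: ('k poly3, (nat \<Rightarrow> 'k poly3) \<times> 'f) gmodule"
  have Pc: "graded_coords ?P (Sum_Type.Plus {..<b - 3} {..<r}) ?aQ ?cQ"
    by (rule graded_coords_gsum[OF graded_coords_S_pow Fc])
  have a\<beta>: "?aQ (case_sum (Inl \<circ> \<beta>) Inr t) = ?aQ t" for t by (cases t) simp_all
  have "saturation_relations A l G {..<rG} aG cG ?P (Sum_Type.Plus {..<b - 3} {..<r}) ?aQ ?cQ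
      (\<lambda>g i. c (\<phi> g) (s i)) (\<lambda>g t. c (\<phi> g) (case_sum (Inl \<circ> \<beta>) Inr t)) (\<lambda>t. \<eta> (case_sum (Inl \<circ> \<beta>) Inr t))"
    by (rule C.relations_of_adapted[OF ad s Gc Pc \<beta> a\<beta> \<phi> ex])
  then interpret R: saturation_relations A l f fd G "{..<rG}" aG cG ?P "Sum_Type.Plus {..<b - 3} {..<r}" ?aQ ?cQ
      "\<lambda>g i. c (\<phi> g) (s i)" "\<lambda>g t. c (\<phi> g) (case_sum (Inl \<circ> \<beta>) Inr t)" "\<lambda>t. \<eta> (case_sum (Inl \<circ> \<beta>) Inr t)"
    by (simp_all only: f_def fd_def)
  let ?P' = "S_pow (b - 3) (- 2 * n0) \<oplus>\<^sub>g twist (dual F) (- 3 * n0) :: ('k poly3, (nat \<Rightarrow> 'k poly3) \<times> ('f \<Rightarrow> 'k poly3)) gmodule"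
  \<comment> \<open>Dualizing negates the twist by \<open>- n0\<close>, and twisting by
    \<open>- 3 * n0\<close> then leaves \<open>- 2 * n0\<close> on the first summand.\<close>
  have a': "case_sum (\<lambda>_. - 2 * n0) (\<lambda>i. - aF i + - 3 * n0) = (\<lambda>t. - ?aQ t - 3 * n0)"
    by (rule ext) (simp split: sum.split)
  have P'c: "graded_coords ?P' (Sum_Type.Plus {..<b - 3} {..<r}) (\<lambda>t. - ?aQ t - 3 * n0)
      (\<lambda>u. case_sum (fst u) (\<lambda>i. snd u (graded_coords.basis F {..<r} cF i)))"
    unfolding a'[symmetric]
    by (rule graded_coords_gsum[OF graded_coords_S_pow graded_coords_twist[OF graded_coords.graded_coords_dual[OF Fc]]])
  show ?thesis
    unfolding dn using b R.milnor_resolution[OF P'c] R.Jac_resolution[OF P'c] by blast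
qed

end

theorem theorem9p1:
  fixes A :: "'k::field_char_0 line set"
    and f :: "'k poly3"
    and d :: int
    and b :: nat
    and F :: "('k poly3, 'f) gmodule"
    and G :: "('k poly3, 'g) gmodule"
    and \<phi> :: "'g \<Rightarrow> (nat \<Rightarrow> 'k poly3) \<times> 'f"
    and \<epsilon> :: "(nat \<Rightarrow> 'k poly3) \<times> 'f \<Rightarrow> 'k poly3"
  assumes "line_arrangement A"
    and "defining_polynomial A f"
    and "d = int (card A)"
    and "graded_free F"
    and "graded_free G"
    and "\<not> has_direct_summand F (twist S_mod (- d + 1))"
    and "minimal_resolution\<^sub>1 G \<phi> (S_pow b (- d + 1) \<oplus>\<^sub>g F) \<epsilon>
           (ideal_gmodule (saturation (Jac f)))"
    and "\<not> free_arrangement A"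
  shows "b \<ge> 3 \<and>
    (\<exists>d3 d2 d1 e.
       minimal_resolution\<^sub>3
         (S_pow (b - 3) (- 2 * d + 2) \<oplus>\<^sub>g twist (dual F) (- 3 * d + 3)) d3
         (twist (dual G) (- 3 * d + 3)) d2
         G d1
         (S_pow (b - 3) (- d + 1) \<oplus>\<^sub>g F) e
         (Milnor_module f)) \<and>
    (\<exists>d2 d1 e.
       minimal_resolution\<^sub>2
         (S_pow (b - 3) (- 2 * d + 2) \<oplus>\<^sub>g twist (dual F) (- 3 * d + 3)) d2
         (twist (dual G) (- 3 * d + 3)) d1
         (S_pow 3 (- d + 1)) e
         (ideal_gmodule (Jac f)))"
proof -
  obtain l where l': "\<forall>L\<in>A. linear_form (l L) \<and> L = zero_locus (l L)" and f: "f = prod l A"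
    using assms(2) unfolding defining_polynomial_def by blast
  have l: "linear_form (l L)" "L = zero_locus (l L)" if "L \<in> A" for L using l' that by blast+
  \<comment> \<open>Freeness is existential in the defining polynomial, so its failure applies to
    the given \<open>f\<close>.\<close>
  have "Jac f \<noteq> saturation (Jac f)" using assms(2,8) unfolding free_arrangement_def by blast
  then obtain g where g: "g \<in> saturation (Jac f)" "g \<notin> Jac f" using Jac_subset_saturation[of f] by blast
  \<comment> \<open>For the empty arrangement \<open>f\<close> is 1 and the Jacobian ideal is zero,
    which is already saturated.\<close>
  have "A \<noteq> {}"
  proof
    assume "A = {}"
    then have "f = cst 1" using f by simp
    then have "partial_deriv i f = 0" for i by (simp add: partial_deriv_single del: single_one)
    then have J: "Jac f = {0}" unfolding Jac_eq by (auto simp: dot_def)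
    obtain k where "\<forall>i. var i ^ k * g \<in> Jac f" using saturation_var_power[OF g(1)] by blast
    then have "var 0 ^ k * g = 0" unfolding J by blast
    then have "g = 0" by (simp add: var_nonzero)
    then show False using g(2) J by simp
  qed
  have "nonfree_lines A l"
  proof (rule nonfree_lines.intro)
    show "distinct_lines A l"
    proof
      show "finite A" using assms(1) by (simp add: line_arrangement_def)
      show "\<not> l L dvd l M" if LM: "L \<in> A" "M \<in> A" "L \<noteq> M" for L M
      proof
        assume "l L dvd l M"
        then obtain c where c: "c \<noteq> 0" "l M = cst c * l L" by (rule dvd_linear_form[OF l(1)[OF LM(1)] l(1)[OF LM(2)]])
        have "L = zero_locus (l L)" by (rule l(2)[OF LM(1)])
        also have "\<dots> = zero_locus (l M)" unfolding c(2) by (rule zero_locus_cst_mult[OF c(1), symmetric])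
        also have "\<dots> = M" by (rule l(2)[OF LM(2), symmetric])
        finally show False using LM(3) by blast
      qed
    qed (use \<open>A \<noteq> {}\<close> l(1) in auto)
    show "nonfree_lines_axioms A l" unfolding nonfree_lines_axioms_def f[symmetric] using g by blast
  qed
  then interpret nonfree_lines A l f "\<lambda>i. partial_deriv i f" by (simp_all only: f)
  show ?thesis by (rule resolutions[OF assms(3-7)])
qed

end
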